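(* Let $\mathbb{X}=[X_1\rightrightarrows X_0]$ be a Lie groupoid with an integrable connection $\mathcal{H}$, let $G$ be a Lie group with Lie algebra $\mathfrak{g}$, and let $(E_G\xrightarrow{\pi}X_0,\mathbb{X})$ be a principal $G$-bundle over $\mathbb{X}$. Let $\omega$ be a connection $1$-form on the (ordinary) principal $G$-bundle $E_G\to X_0$, and let $\mathcal{D}:\mathrm{At}(E_G)\to\mathrm{ad}(E_G)$ be the corresponding homomorphism of vector bundles over $X_0$. Then $\mathcal{D}$ defines a connection on $(E_G\xrightarrow{\pi}X_0,\mathbb{X})$ if and only if $\omega$ is a $\mathfrak{g}$-valued differential $1$-form on the Lie groupoid $[s^*E_G\rightrightarrows E_G]$ (with respect to $\widetilde{\mathcal{H}}$).
   Context: Manifolds are $C^\infty$ and second countable, not necessarily Hausdorff. A Lie groupoid $\mathbb{X}=[X_1\rightrightarrows X_0]$ has smooth structure maps $s,t,m,e,i$ (source, target, multiplication, identity section, inversion), with $s$ (hence $t$) a submersion; $\gamma\circ\gamma'$ is defined when $s(\gamma)=t(\gamma')$. A connection on $\mathbb{X}$ is a smooth distribution $\mathcal{H}\subset TX_1$ such that (1) $T_\gamma X_1=\mathcal{H}_\gamma\oplus\ker(ds)_\gamma$ for all $\gamma\in X_1$; (2) $(de)_x(T_xX_0)=\mathcal{H}_{e(x)}$ for all $x\in X_0$; (3) $\theta_\gamma\circ\theta_{\gamma'}=\theta_{\gamma\circ\gamma'}$ for all composable $\gamma,\gamma'$, where $\theta_\gamma:T_{s(\gamma)}X_0\to T_{t(\gamma)}X_0$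 is $(dt)_\gamma\circ((ds)_\gamma|_{\mathcal{H}_\gamma})^{-1}$. It is integrable if the distribution $\mathcal{H}$ is integrable. For a form $\varphi$ on $X_1$ (real- or $\mathfrak g$-valued) let $\widehat{\mathcal{H}}(\varphi)(v_1,\dots,v_k)=\varphi(P_{\mathcal{H}}v_1,\dots,P_{\mathcal{H}}v_k)$, with $P_{\mathcal{H}}$ the projection onto $\mathcal{H}$ along $\ker(ds)$. A form $\varphi$ on the object manifold $X_0$ is a differential form on the groupoid (with respect to $\mathcal{H}$) if $\widehat{\mathcal{H}}(s^*\varphi)=\widehat{\mathcal{H}}(t^*\varphi)$. A principal $G$-bundle $(E_G\to X_0,\mathbb{X})$ is a right principal $G$-bundle $\pi:E_G\to X_0$ with a smooth left action $\mu:X_1\times_{s,X_0,\pi}E_G\to E_G$, $(\gamma,p)\mapsto\gamma\cdot p$, of $\mathbb{X}$ (so $\pi(\gamma\cdot p)=t(\gamma)$, identities act trivially, $\gamma'\cdot(\gamma\cdot p)=(\gamma'\circ\gamma)\cdot p$) with $(\gamma\cdot p)\cdot g=\gamma\cdot(p\cdot g)$. The groupoid $[s^*E_G\rightrightarrows E_G]$ has arrows $s^*E_G=X_1\times_{s,X_0,\pi}E_G$, source $\mathrm{pr}_2:(\gamma,a)\mapsto a$ and target $\mu:(\gamma,a)\mapsto\gamma\cdot a$. The pullback connection is $\widetilde{\mathcal{H}}=(d\,\mathrm{pr}_1)^{-1}(\mathcal{H})\subset T(s^*E_G)$, a complement of $\ker(d\,\mathrm{pr}_2)$; so $\omega\in\Omega^1(E_G,\mathfrak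 g)$ is a differential form on $[s^*E_G\rightrightarrows E_G]$ if $\widehat{\widetilde{\mathcal{H}}}(\mathrm{pr}_2^*\omega)=\widehat{\widetilde{\mathcal{H}}}(\mu^*\omega)$. For $\pi(a)=s(\gamma)$ define $\widetilde\theta_{(\gamma,a)}:T_aE_G\to T_{\gamma\cdot a}E_G$ by $\widetilde\theta_{(\gamma,a)}(w)=d\mu_{(\gamma,a)}(h,w)$, where $h\in\mathcal{H}_\gamma$ is the unique vector with $ds(h)=d\pi(w)$. Let $\mathrm{At}(E_G)=(TE_G)/G$ and $\mathrm{ad}(E_G)=(E_G\times\mathfrak{g})/G\cong\ker(d\pi)/G$. An arrow $\gamma$ acts on $TX_0$ by $\theta_\gamma$, on $\mathrm{At}(E_G)$ by $\gamma\cdot[w]=[\widetilde\theta_{(\gamma,a)}(w)]$ for $w\in T_aE_G$, and on $\mathrm{ad}(E_G)$ by restriction (that is, $\gamma\cdot[a,x]=[\gamma\cdot a,x]$). A connection on $(E_G\to X_0,\mathbb{X})$ is a splitting of the Atiyah sequence $0\to\mathrm{ad}(E_G)\to\mathrm{At}(E_G)\to TX_0\to0$ of vector bundles that is compatible with these actions of $\mathbb{X}$. A connection $1$-form on $\pi$ is a $G$-equivariant $\omega:TE_G\to\mathfrak{g}$ restricting to the Maurer-Cartan form on the fibers; the corresponding $\mathcal{D}:\mathrm{At}(E_G)\to\mathrm{ad}(E_G)$ is the quotient by $G$ of $(a,v)\mapsto(a,\omega(a)(v))$, and it splits the underlying Atiyah sequence over $X_0$; $\mathcal{D}$ defines a connection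 on $(E_G\to X_0,\mathbb{X})$ when it is compatible with the actions of $\mathbb{X}$, i.e. $\mathcal{D}(\gamma\cdot[w])=\gamma\cdot\mathcal{D}([w])$. *)

theory Defs
  imports
    "HOL-Analysis.Analysis"
    "HOL-Algebra.Group"
    "HOL-Library.Function_Algebras"
begin

instantiation "fun" :: (type, real_vector) real_vector
begin

definition scaleR_fun :: "real \<Rightarrow> ('a \<Rightarrow> 'b) \<Rightarrow> 'a \<Rightarrow> 'b" where
  "scaleR_fun r f = (\<lambda>x. r *\<^sub>R f x)"

instance
  by standard (auto simp: scaleR_fun_def fun_eq_iff scaleR_add_right scaleR_add_left)

end

section \<open>Smooth manifolds\<close>

text \<open>
  A chart takes values in a relatively open subset of a linear subspace (its model) of a
  Euclidean space.  The dimension is thus not tied to the type: dimension 0 is allowed, the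
  dimension may differ between components, and a submanifold has the same model type as the
  ambient manifold.
\<close>

record ('a, 'e) chart =
  cdom :: "'a set"
  cmodel :: "'e set"
  cmap :: "'a \<Rightarrow> 'e"

record ('a, 'e) mfd =
  mtop :: "'a topology"
  atlas :: "('a, 'e) chart set"

abbreviation points :: "('a, 'e) mfd \<Rightarrow> 'a set" where
  "points M \<equiv> topspace (mtop M)"

definition cinv :: "('a, 'e) chart \<Rightarrow> 'e \<Rightarrow> 'a" where
  "cinv c = inv_into (cdom c) (cmap c)"

text \<open>
  Continuous differentiability on a relatively open subset \<open>A\<close> of a linear subspace \<open>V\<close>.
  There \<open>D x\<close> is determined on \<open>V\<close> only, so the derivatives are taken in directions of \<open>V\<close>.
\<close>

primrec C_k_on :: "nat \<Rightarrow> 'e set \<Rightarrow> 'e set \<Rightarrow> ('e::euclidean_space \<Rightarrow> 'f::euclidean_space) \<Rightarrow> bool" where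
  "C_k_on 0 V A f = continuous_on A f"
| "C_k_on (Suc k) V A f =
     (\<exists>D. (\<forall>x\<in>A. (f has_derivative D x) (at x within A)) \<and> (\<forall>v\<in>V. C_k_on k V A (\<lambda>x. D x v)))"

definition C_inf_on :: "'e set \<Rightarrow> 'e set \<Rightarrow> ('e::euclidean_space \<Rightarrow> 'f::euclidean_space) \<Rightarrow> bool" where
  "C_inf_on V A f \<longleftrightarrow> (\<forall>k. C_k_on k V A f)"

definition is_chart :: "'a topology \<Rightarrow> ('a, 'e::euclidean_space) chart \<Rightarrow> bool" where
  "is_chart T c \<longleftrightarrow>
     openin T (cdom c) \<and> subspace (cmodel c) \<and>
     openin (top_of_set (cmodel c)) (cmap c ` cdom c) \<and>
     homeomorphic_map (subtopology T (cdom c)) (top_of_set (cmap c ` cdom c)) (cmap c)"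

definition compatible_charts :: "('a, 'e::euclidean_space) chart \<Rightarrow> ('a, 'e) chart \<Rightarrow> bool" where
  "compatible_charts c c' \<longleftrightarrow>
     C_inf_on (cmodel c) (cmap c ` (cdom c \<inter> cdom c')) (cmap c' \<circ> cinv c) \<and>
     C_inf_on (cmodel c') (cmap c' ` (cdom c \<inter> cdom c')) (cmap c \<circ> cinv c')"

definition second_countable_top :: "'a topology \<Rightarrow> bool" where
  "second_countable_top T \<longleftrightarrow>
     (\<exists>B. countable B \<and> (\<forall>U\<in>B. openin T U) \<and>
          (\<forall>U x. openin T U \<and> x \<in> U \<longrightarrow> (\<exists>W\<in>B. x \<in> W \<and> W \<subseteq> U)))"

text \<open>The atlas need not be maximal, and no separation axiom is imposed.\<close>

definition manifold :: "('a, 'e::euclidean_space) mfd \<Rightarrow> bool" where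
  "manifold M \<longleftrightarrow>
     second_countable_top (mtop M) \<and>
     (\<forall>c\<in>atlas M. is_chart (mtop M) c) \<and>
     (\<Union>c\<in>atlas M. cdom c) = points M \<and>
     (\<forall>c\<in>atlas M. \<forall>c'\<in>atlas M. compatible_charts c c')"

definition max_atlas :: "('a, 'e::euclidean_space) mfd \<Rightarrow> ('a, 'e) chart set" where
  "max_atlas M = {c. is_chart (mtop M) c \<and> (\<forall>c'\<in>atlas M. compatible_charts c c')}"

definition charts_at :: "('a, 'e) mfd \<Rightarrow> 'a \<Rightarrow> ('a, 'e) chart set" where
  "charts_at M p = {c \<in> atlas M. p \<in> cdom c}"

definition smooth_on ::
  "('a, 'e::euclidean_space) mfd \<Rightarrow> 'a set \<Rightarrow> ('b, 'f::euclidean_space) mfd \<Rightarrow> ('a \<Rightarrow> 'b) \<Rightarrow> bool" where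
  "smooth_on M U N f \<longleftrightarrow>
     openin (mtop M) U \<and>
     continuous_map (subtopology (mtop M) U) (mtop N) f \<and>
     (\<forall>c\<in>atlas M. \<forall>d\<in>atlas N.
        C_inf_on (cmodel c) (cmap c ` {p \<in> cdom c \<inter> U. f p \<in> cdom d}) (cmap d \<circ> f \<circ> cinv c))"

abbreviation smooth_map ::
  "('a, 'e::euclidean_space) mfd \<Rightarrow> ('b, 'f::euclidean_space) mfd \<Rightarrow> ('a \<Rightarrow> 'b) \<Rightarrow> bool" where
  "smooth_map M N f \<equiv> smooth_on M (points M) N f"

definition prod_mfd :: "('a, 'e) mfd \<Rightarrow> ('b, 'f) mfd \<Rightarrow> ('a \<times> 'b, 'e \<times> 'f) mfd" where
  "prod_mfd M N =
     \<lparr>mtop = prod_topology (mtop M) (mtop N),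
      atlas = {\<lparr>cdom = cdom c \<times> cdom d, cmodel = cmodel c \<times> cmodel d,
                cmap = map_prod (cmap c) (cmap d)\<rparr> | c d. c \<in> atlas M \<and> d \<in> atlas N}\<rparr>"

text \<open>
  The charts of an embedded submanifold \<open>S\<close> are the restrictions of the slice charts of the
  ambient manifold, that is, of the charts that map \<open>S\<close> to a linear subspace \<open>W\<close>.
  A fibre product along a submersion is an embedded submanifold of the product.
\<close>

definition submfd :: "('a, 'e::euclidean_space) mfd \<Rightarrow> 'a set \<Rightarrow> ('a, 'e) mfd" where
  "submfd M S =
     \<lparr>mtop = subtopology (mtop M) S,
      atlas = {\<lparr>cdom = cdom c \<inter> S, cmodel = W, cmap = cmap c\<rparr> | c W.
                 c \<in> max_atlas M \<and> subspace W \<and> W \<subseteq> cmodel c \<and>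
                 cmap c ` (cdom c \<inter> S) = cmap c ` cdom c \<inter> W}\<rparr>"

definition fibprod ::
  "('a, 'e::euclidean_space) mfd \<Rightarrow> ('a \<Rightarrow> 'c) \<Rightarrow> ('b, 'f::euclidean_space) mfd \<Rightarrow> ('b \<Rightarrow> 'c)
    \<Rightarrow> ('a \<times> 'b, 'e \<times> 'f) mfd" where
  "fibprod M f N g =
     submfd (prod_mfd M N) {(x, y). x \<in> points M \<and> y \<in> points N \<and> f x = g y}"


section \<open>Tangent spaces\<close>

text \<open>
  A tangent vector at \<open>p\<close> is the family of its coordinate vectors in the charts around \<open>p\<close>,
  which transform by the derivatives of the transition maps; it is 0 at all other charts.
  Vector space operations are pointwise.  A point of the tangent bundle is a pair \<open>(p, v)\<close>.
\<close>

type_synonym ('a, 'e) tvec = "('a, 'e) chart \<Rightarrow> 'e"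

definition tangent_space :: "('a, 'e::euclidean_space) mfd \<Rightarrow> 'a \<Rightarrow> ('a, 'e) tvec set" where
  "tangent_space M p =
     {v. (\<forall>c\<in>charts_at M p. v c \<in> cmodel c \<and>
            (\<forall>c'\<in>charts_at M p.
               v c' = frechet_derivative (cmap c' \<circ> cinv c)
                        (at (cmap c p) within cmap c ` (cdom c \<inter> cdom c')) (v c))) \<and>
         (\<forall>c. c \<notin> charts_at M p \<longrightarrow> v c = 0)}"

text \<open>The differential at \<open>p\<close> of a map that is smooth near \<open>p\<close>.\<close>

definition tangent_map ::
  "('a, 'e::euclidean_space) mfd \<Rightarrow> ('b, 'f::euclidean_space) mfd \<Rightarrow> ('a \<Rightarrow> 'b) \<Rightarrow> 'a
    \<Rightarrow> ('a, 'e) tvec \<Rightarrow> ('b, 'f) tvec" where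
  "tangent_map M N f p v =
     (let c = (SOME c. c \<in> charts_at M p) in
      (\<lambda>d. if d \<in> charts_at N (f p)
          then frechet_derivative (cmap d \<circ> f \<circ> cinv c)
                 (at (cmap c p) within cmap c ` {q \<in> cdom c. f q \<in> cdom d}) (v c)
          else 0))"

definition tangent_ker ::
  "('a, 'e::euclidean_space) mfd \<Rightarrow> ('b, 'f::euclidean_space) mfd \<Rightarrow> ('a \<Rightarrow> 'b) \<Rightarrow> 'a
    \<Rightarrow> ('a, 'e) tvec set" where
  "tangent_ker M N f p = {v \<in> tangent_space M p. tangent_map M N f p v = 0}"

definition submersion ::
  "('a, 'e::euclidean_space) mfd \<Rightarrow> ('b, 'f::euclidean_space) mfd \<Rightarrow> ('a \<Rightarrow> 'b) \<Rightarrow> bool" where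
  "submersion M N f \<longleftrightarrow>
     smooth_map M N f \<and>
     (\<forall>p\<in>points M. tangent_map M N f p ` tangent_space M p = tangent_space N (f p))"

definition smooth_vector_field ::
  "('a, 'e::euclidean_space) mfd \<Rightarrow> 'a set \<Rightarrow> ('a \<Rightarrow> ('a, 'e) tvec) \<Rightarrow> bool" where
  "smooth_vector_field M U X \<longleftrightarrow>
     openin (mtop M) U \<and> (\<forall>p\<in>U. X p \<in> tangent_space M p) \<and>
     (\<forall>c\<in>atlas M. C_inf_on (cmodel c) (cmap c ` (cdom c \<inter> U)) (\<lambda>x. X (cinv c x) c))"

definition smooth_distribution ::
  "('a, 'e::euclidean_space) mfd \<Rightarrow> ('a \<Rightarrow> ('a, 'e) tvec set) \<Rightarrow> bool" where
  "smooth_distribution M H \<longleftrightarrow>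
     (\<forall>p\<in>points M. \<exists>U B. openin (mtop M) U \<and> p \<in> U \<and> finite B \<and>
        (\<forall>X\<in>B. smooth_vector_field M U X) \<and>
        (\<forall>q\<in>U. inj_on (\<lambda>X. X q) B \<and> independent ((\<lambda>X. X q) ` B) \<and>
                span ((\<lambda>X. X q) ` B) = H q))"

text \<open>
  Through every point there passes an integral manifold: an immersed submanifold \<open>N\<close> whose
  tangent spaces are the members of the distribution.
\<close>

definition integrable_distribution ::
  "('a, 'e::euclidean_space) mfd \<Rightarrow> ('a \<Rightarrow> ('a, 'e) tvec set) \<Rightarrow> bool" where
  "integrable_distribution M H \<longleftrightarrow>
     (\<forall>p\<in>points M. \<exists>N :: ('a, 'e) mfd.
        manifold N \<and> p \<in> points N \<and> points N \<subseteq> points M \<and> smooth_map N M (\<lambda>q. q) \<and>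
        (\<forall>q\<in>points N. inj_on (tangent_map N M (\<lambda>q. q) q) (tangent_space N q) \<and>
                      tangent_map N M (\<lambda>q. q) q ` tangent_space N q = H q))"


section \<open>Lie groups\<close>

record ('g, 'k) lie_grp = "'g monoid" +
  gmfd :: "('g, 'k) mfd"

definition lie_group :: "('g, 'k::euclidean_space) lie_grp \<Rightarrow> bool" where
  "lie_group G \<longleftrightarrow>
     group G \<and> manifold (gmfd G) \<and> points (gmfd G) = carrier G \<and>
     smooth_map (prod_mfd (gmfd G) (gmfd G)) (gmfd G) (\<lambda>(g, h). g \<otimes>\<^bsub>G\<^esub> h) \<and>
     smooth_map (gmfd G) (gmfd G) (\<lambda>g. inv\<^bsub>G\<^esub> g)"

definition lie_algebra :: "('g, 'k::euclidean_space) lie_grp \<Rightarrow> ('g, 'k) tvec set" where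
  "lie_algebra G = tangent_space (gmfd G) \<one>\<^bsub>G\<^esub>"

definition Adj :: "('g, 'k::euclidean_space) lie_grp \<Rightarrow> 'g \<Rightarrow> ('g, 'k) tvec \<Rightarrow> ('g, 'k) tvec" where
  "Adj G g = tangent_map (gmfd G) (gmfd G) (\<lambda>h. g \<otimes>\<^bsub>G\<^esub> h \<otimes>\<^bsub>G\<^esub> inv\<^bsub>G\<^esub> g) \<one>\<^bsub>G\<^esub>"

definition maurer_cartan ::
  "('g, 'k::euclidean_space) lie_grp \<Rightarrow> 'g \<Rightarrow> ('g, 'k) tvec \<Rightarrow> ('g, 'k) tvec" where
  "maurer_cartan G g = tangent_map (gmfd G) (gmfd G) (\<lambda>h. inv\<^bsub>G\<^esub> g \<otimes>\<^bsub>G\<^esub> h) g"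

definition smooth_lie_function ::
  "('g, 'k::euclidean_space) lie_grp \<Rightarrow> ('a, 'e::euclidean_space) mfd \<Rightarrow> 'a set
    \<Rightarrow> ('a \<Rightarrow> ('g, 'k) tvec) \<Rightarrow> bool" where
  "smooth_lie_function G M U f \<longleftrightarrow>
     openin (mtop M) U \<and> (\<forall>p\<in>U. f p \<in> lie_algebra G) \<and>
     (\<forall>c\<in>atlas M. \<forall>d\<in>charts_at (gmfd G) \<one>\<^bsub>G\<^esub>.
        C_inf_on (cmodel c) (cmap c ` (cdom c \<inter> U)) (\<lambda>x. f (cinv c x) d))"

text \<open>Smooth 1-forms on a manifold with values in the Lie algebra of \<open>G\<close>.\<close>

definition lie_one_form ::
  "('g, 'k::euclidean_space) lie_grp \<Rightarrow> ('a, 'e::euclidean_space) mfd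
    \<Rightarrow> ('a \<Rightarrow> ('a, 'e) tvec \<Rightarrow> ('g, 'k) tvec) \<Rightarrow> bool" where
  "lie_one_form G M \<omega> \<longleftrightarrow>
     (\<forall>p\<in>points M. \<forall>u\<in>tangent_space M p. \<forall>v\<in>tangent_space M p. \<forall>r::real.
        \<omega> p u \<in> lie_algebra G \<and> \<omega> p (u + v) = \<omega> p u + \<omega> p v \<and> \<omega> p (r *\<^sub>R u) = r *\<^sub>R \<omega> p u) \<and>
     (\<forall>U X. smooth_vector_field M U X \<longrightarrow> smooth_lie_function G M U (\<lambda>p. \<omega> p (X p)))"


section \<open>Lie groupoids and their connections\<close>

text \<open>The composition \<open>gcomp X (\<gamma>, \<gamma>')\<close> is meaningful if the source of \<open>\<gamma>\<close> is the target of \<open>\<gamma>'\<close>.\<close>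

record ('x, 'e, 'y, 'f) lie_gpd =
  objs :: "('x, 'e) mfd"
  arrs :: "('y, 'f) mfd"
  src :: "'y \<Rightarrow> 'x"
  tgt :: "'y \<Rightarrow> 'x"
  gcomp :: "'y \<times> 'y \<Rightarrow> 'y"
  gid :: "'x \<Rightarrow> 'y"
  ginv :: "'y \<Rightarrow> 'y"

definition lie_groupoid ::
  "('x, 'e::euclidean_space, 'y, 'f::euclidean_space) lie_gpd \<Rightarrow> bool" where
  "lie_groupoid X \<longleftrightarrow>
     manifold (objs X) \<and> manifold (arrs X) \<and>
     submersion (arrs X) (objs X) (src X) \<and>
     smooth_map (arrs X) (objs X) (tgt X) \<and>
     smooth_map (fibprod (arrs X) (src X) (arrs X) (tgt X)) (arrs X) (gcomp X) \<and>
     smooth_map (objs X) (arrs X) (gid X) \<and>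
     smooth_map (arrs X) (arrs X) (ginv X) \<and>
     (\<forall>x\<in>points (objs X). src X (gid X x) = x \<and> tgt X (gid X x) = x) \<and>
     (\<forall>\<gamma>\<in>points (arrs X). \<forall>\<gamma>'\<in>points (arrs X). src X \<gamma> = tgt X \<gamma>' \<longrightarrow>
        src X (gcomp X (\<gamma>, \<gamma>')) = src X \<gamma>' \<and> tgt X (gcomp X (\<gamma>, \<gamma>')) = tgt X \<gamma>) \<and>
     (\<forall>\<gamma>\<in>points (arrs X). \<forall>\<gamma>'\<in>points (arrs X). \<forall>\<gamma>''\<in>points (arrs X).
        src X \<gamma> = tgt X \<gamma>' \<and> src X \<gamma>' = tgt X \<gamma>'' \<longrightarrow>
        gcomp X (gcomp X (\<gamma>, \<gamma>'), \<gamma>'') = gcomp X (\<gamma>, gcomp X (\<gamma>', \<gamma>''))) \<and>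
     (\<forall>\<gamma>\<in>points (arrs X).
        gcomp X (gid X (tgt X \<gamma>), \<gamma>) = \<gamma> \<and> gcomp X (\<gamma>, gid X (src X \<gamma>)) = \<gamma> \<and>
        src X (ginv X \<gamma>) = tgt X \<gamma> \<and> tgt X (ginv X \<gamma>) = src X \<gamma> \<and>
        gcomp X (\<gamma>, ginv X \<gamma>) = gid X (tgt X \<gamma>) \<and> gcomp X (ginv X \<gamma>, \<gamma>) = gid X (src X \<gamma>))"

abbreviation dsrc ::
  "('x, 'e::euclidean_space, 'y, 'f::euclidean_space) lie_gpd \<Rightarrow> 'y \<Rightarrow> ('y, 'f) tvec \<Rightarrow> ('x, 'e) tvec" where
  "dsrc X \<equiv> tangent_map (arrs X) (objs X) (src X)"

abbreviation dtgt ::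
  "('x, 'e::euclidean_space, 'y, 'f::euclidean_space) lie_gpd \<Rightarrow> 'y \<Rightarrow> ('y, 'f) tvec \<Rightarrow> ('x, 'e) tvec" where
  "dtgt X \<equiv> tangent_map (arrs X) (objs X) (tgt X)"

text \<open>The inverse of the restriction of the differential of the source map to \<open>H \<gamma>\<close>.\<close>

definition horizontal_lift ::
  "('x, 'e::euclidean_space, 'y, 'f::euclidean_space) lie_gpd \<Rightarrow> ('y \<Rightarrow> ('y, 'f) tvec set)
    \<Rightarrow> 'y \<Rightarrow> ('x, 'e) tvec \<Rightarrow> ('y, 'f) tvec" where
  "horizontal_lift X H \<gamma> u = (THE h. h \<in> H \<gamma> \<and> dsrc X \<gamma> h = u)"

definition theta ::
  "('x, 'e::euclidean_space, 'y, 'f::euclidean_space) lie_gpd \<Rightarrow> ('y \<Rightarrow> ('y, 'f) tvec set)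
    \<Rightarrow> 'y \<Rightarrow> ('x, 'e) tvec \<Rightarrow> ('x, 'e) tvec" where
  "theta X H \<gamma> u = dtgt X \<gamma> (horizontal_lift X H \<gamma> u)"

definition groupoid_connection ::
  "('x, 'e::euclidean_space, 'y, 'f::euclidean_space) lie_gpd \<Rightarrow> ('y \<Rightarrow> ('y, 'f) tvec set) \<Rightarrow> bool" where
  "groupoid_connection X H \<longleftrightarrow>
     smooth_distribution (arrs X) H \<and>
     (\<forall>\<gamma>\<in>points (arrs X).
        H \<gamma> \<inter> tangent_ker (arrs X) (objs X) (src X) \<gamma> = {0} \<and>
        {h + k | h k. h \<in> H \<gamma> \<and> k \<in> tangent_ker (arrs X) (objs X) (src X) \<gamma>}
          = tangent_space (arrs X) \<gamma>) \<and>
     (\<forall>x\<in>points (objs X).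
        tangent_map (objs X) (arrs X) (gid X) x ` tangent_space (objs X) x = H (gid X x)) \<and>
     (\<forall>\<gamma>\<in>points (arrs X). \<forall>\<gamma>'\<in>points (arrs X). src X \<gamma> = tgt X \<gamma>' \<longrightarrow>
        (\<forall>u\<in>tangent_space (objs X) (src X \<gamma>').
           theta X H \<gamma> (theta X H \<gamma>' u) = theta X H (gcomp X (\<gamma>, \<gamma>')) u))"

text \<open>The projection onto \<open>H \<gamma>\<close> along the kernel of the differential of the source map.\<close>

definition horizontal_proj ::
  "('x, 'e::euclidean_space, 'y, 'f::euclidean_space) lie_gpd \<Rightarrow> ('y \<Rightarrow> ('y, 'f) tvec set)
    \<Rightarrow> 'y \<Rightarrow> ('y, 'f) tvec \<Rightarrow> ('y, 'f) tvec" where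
  "horizontal_proj X H \<gamma> v =
     (THE h. h \<in> H \<gamma> \<and> v - h \<in> tangent_ker (arrs X) (objs X) (src X) \<gamma>)"

definition horizontal_form ::
  "('x, 'e::euclidean_space, 'y, 'f::euclidean_space) lie_gpd \<Rightarrow> ('y \<Rightarrow> ('y, 'f) tvec set)
    \<Rightarrow> ('y \<Rightarrow> ('y, 'f) tvec \<Rightarrow> 'v) \<Rightarrow> 'y \<Rightarrow> ('y, 'f) tvec \<Rightarrow> 'v" where
  "horizontal_form X H \<phi> \<gamma> v = \<phi> \<gamma> (horizontal_proj X H \<gamma> v)"

definition pullback_form ::
  "('a, 'e::euclidean_space) mfd \<Rightarrow> ('b, 'f::euclidean_space) mfd \<Rightarrow> ('a \<Rightarrow> 'b)
    \<Rightarrow> ('b \<Rightarrow> ('b, 'f) tvec \<Rightarrow> 'v) \<Rightarrow> 'a \<Rightarrow> ('a, 'e) tvec \<Rightarrow> 'v" where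
  "pullback_form M N f \<phi> p v = \<phi> (f p) (tangent_map M N f p v)"

text \<open>
  Lie algebra valued differential 1-forms on a groupoid; the distribution \<open>H\<close> need only be
  complementary to the kernel of the differential of the source map.
\<close>

definition groupoid_lie_one_form ::
  "('g, 'k::euclidean_space) lie_grp \<Rightarrow> ('x, 'e::euclidean_space, 'y, 'f::euclidean_space) lie_gpd
    \<Rightarrow> ('y \<Rightarrow> ('y, 'f) tvec set) \<Rightarrow> ('x \<Rightarrow> ('x, 'e) tvec \<Rightarrow> ('g, 'k) tvec) \<Rightarrow> bool" where
  "groupoid_lie_one_form G X H \<phi> \<longleftrightarrow>
     lie_one_form G (objs X) \<phi> \<and>
     (\<forall>\<gamma>\<in>points (arrs X). \<forall>v\<in>tangent_space (arrs X) \<gamma>.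
        horizontal_form X H (pullback_form (arrs X) (objs X) (src X) \<phi>) \<gamma> v =
        horizontal_form X H (pullback_form (arrs X) (objs X) (tgt X) \<phi>) \<gamma> v)"


section \<open>Principal bundles\<close>

record ('p, 'q, 'x, 'g) pbundle =
  total :: "('p, 'q) mfd"
  proj :: "'p \<Rightarrow> 'x"
  ract :: "'p \<times> 'g \<Rightarrow> 'p"

text \<open>Local triviality makes the action free and transitive on the fibres.\<close>

definition principal_bundle ::
  "('g, 'k::euclidean_space) lie_grp \<Rightarrow> ('x, 'e::euclidean_space) mfd
    \<Rightarrow> ('p, 'q::euclidean_space, 'x, 'g) pbundle \<Rightarrow> bool" where
  "principal_bundle G M E \<longleftrightarrow>
     manifold (total E) \<and> smooth_map (total E) M (proj E) \<and>
     smooth_map (prod_mfd (total E) (gmfd G)) (total E) (ract E) \<and>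
     (\<forall>a\<in>points (total E). ract E (a, \<one>\<^bsub>G\<^esub>) = a) \<and>
     (\<forall>a\<in>points (total E). \<forall>g\<in>carrier G. \<forall>h\<in>carrier G.
        ract E (ract E (a, g), h) = ract E (a, g \<otimes>\<^bsub>G\<^esub> h)) \<and>
     (\<forall>a\<in>points (total E). \<forall>g\<in>carrier G. proj E (ract E (a, g)) = proj E a) \<and>
     (\<forall>x\<in>points M. \<exists>U \<psi> \<psi>'.
        openin (mtop M) U \<and> x \<in> U \<and>
        smooth_on (prod_mfd M (gmfd G)) (U \<times> carrier G) (total E) \<psi> \<and>
        smooth_on (total E) {a \<in> points (total E). proj E a \<in> U} (prod_mfd M (gmfd G)) \<psi>' \<and>
        (\<forall>y\<in>U. \<forall>g\<in>carrier G. \<psi>' (\<psi> (y, g)) = (y, g)) \<and>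
        (\<forall>a\<in>points (total E). proj E a \<in> U \<longrightarrow> \<psi>' a \<in> U \<times> carrier G \<and> \<psi> (\<psi>' a) = a) \<and>
        (\<forall>y\<in>U. \<forall>g\<in>carrier G. proj E (\<psi> (y, g)) = y \<and>
           (\<forall>h\<in>carrier G. ract E (\<psi> (y, g), h) = \<psi> (y, g \<otimes>\<^bsub>G\<^esub> h))))"

definition source_pullback ::
  "('x, 'e::euclidean_space, 'y, 'f::euclidean_space) lie_gpd
    \<Rightarrow> ('p, 'q::euclidean_space, 'x, 'g) pbundle \<Rightarrow> ('y \<times> 'p, 'f \<times> 'q) mfd" where
  "source_pullback X E = fibprod (arrs X) (src X) (total E) (proj E)"

definition groupoid_principal_bundle ::
  "('g, 'k::euclidean_space) lie_grp \<Rightarrow> ('x, 'e::euclidean_space, 'y, 'f::euclidean_space) lie_gpd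
    \<Rightarrow> ('p, 'q::euclidean_space, 'x, 'g) pbundle \<Rightarrow> ('y \<times> 'p \<Rightarrow> 'p) \<Rightarrow> bool" where
  "groupoid_principal_bundle G X E \<mu> \<longleftrightarrow>
     principal_bundle G (objs X) E \<and>
     smooth_map (source_pullback X E) (total E) \<mu> \<and>
     (\<forall>a\<in>points (total E). \<mu> (gid X (proj E a), a) = a) \<and>
     (\<forall>\<gamma>\<in>points (arrs X). \<forall>a\<in>points (total E). src X \<gamma> = proj E a \<longrightarrow>
        proj E (\<mu> (\<gamma>, a)) = tgt X \<gamma> \<and>
        (\<forall>\<gamma>'\<in>points (arrs X). src X \<gamma>' = tgt X \<gamma> \<longrightarrow>
           \<mu> (\<gamma>', \<mu> (\<gamma>, a)) = \<mu> (gcomp X (\<gamma>', \<gamma>), a)) \<and>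
        (\<forall>g\<in>carrier G. ract E (\<mu> (\<gamma>, a), g) = \<mu> (\<gamma>, ract E (a, g))))"

text \<open>The groupoid with arrows \<open>(\<gamma>, a) : a \<rightarrow> \<gamma> \<cdot> a\<close>.\<close>

definition pullback_groupoid ::
  "('x, 'e::euclidean_space, 'y, 'f::euclidean_space) lie_gpd
    \<Rightarrow> ('p, 'q::euclidean_space, 'x, 'g) pbundle \<Rightarrow> ('y \<times> 'p \<Rightarrow> 'p)
    \<Rightarrow> ('p, 'q, 'y \<times> 'p, 'f \<times> 'q) lie_gpd" where
  "pullback_groupoid X E \<mu> =
     \<lparr>objs = total E, arrs = source_pullback X E, src = snd, tgt = \<mu>,
      gcomp = (\<lambda>((\<gamma>', b), (\<gamma>, a)). (gcomp X (\<gamma>', \<gamma>), a)),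
      gid = (\<lambda>a. (gid X (proj E a), a)),
      ginv = (\<lambda>(\<gamma>, a). (ginv X \<gamma>, \<mu> (\<gamma>, a)))\<rparr>"

definition pullback_connection ::
  "('x, 'e::euclidean_space, 'y, 'f::euclidean_space) lie_gpd \<Rightarrow> ('y \<Rightarrow> ('y, 'f) tvec set)
    \<Rightarrow> ('p, 'q::euclidean_space, 'x, 'g) pbundle
    \<Rightarrow> 'y \<times> 'p \<Rightarrow> ('y \<times> 'p, 'f \<times> 'q) tvec set" where
  "pullback_connection X H E z =
     {v \<in> tangent_space (source_pullback X E) z.
        tangent_map (source_pullback X E) (arrs X) fst z v \<in> H (fst z)}"

definition connection_form ::
  "('g, 'k::euclidean_space) lie_grp \<Rightarrow> ('p, 'q::euclidean_space, 'x, 'g) pbundle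
    \<Rightarrow> ('p \<Rightarrow> ('p, 'q) tvec \<Rightarrow> ('g, 'k) tvec) \<Rightarrow> bool" where
  "connection_form G E \<omega> \<longleftrightarrow>
     lie_one_form G (total E) \<omega> \<and>
     (\<forall>a\<in>points (total E). \<forall>g\<in>carrier G.
        (\<forall>v\<in>tangent_space (total E) a.
           \<omega> (ract E (a, g)) (tangent_map (total E) (total E) (\<lambda>b. ract E (b, g)) a v)
             = Adj G (inv\<^bsub>G\<^esub> g) (\<omega> a v)) \<and>
        (\<forall>u\<in>tangent_space (gmfd G) g.
           \<omega> (ract E (a, g)) (tangent_map (gmfd G) (total E) (\<lambda>h. ract E (a, h)) g u)
             = maurer_cartan G g u))"


section \<open>The Atiyah and adjoint bundles\<close>

text \<open>The orbit relations of \<open>G\<close> on the tangent bundle of the total space and on its product with the Lie algebra.\<close>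

definition at_rel ::
  "('g, 'k::euclidean_space) lie_grp \<Rightarrow> ('p, 'q::euclidean_space, 'x, 'g) pbundle
    \<Rightarrow> (('p \<times> ('p, 'q) tvec) \<times> ('p \<times> ('p, 'q) tvec)) set" where
  "at_rel G E =
     {((a, w), (ract E (a, g), tangent_map (total E) (total E) (\<lambda>b. ract E (b, g)) a w)) | a w g.
        a \<in> points (total E) \<and> w \<in> tangent_space (total E) a \<and> g \<in> carrier G}"

definition ad_rel ::
  "('g, 'k::euclidean_space) lie_grp \<Rightarrow> ('p, 'q::euclidean_space, 'x, 'g) pbundle
    \<Rightarrow> (('p \<times> ('g, 'k) tvec) \<times> ('p \<times> ('g, 'k) tvec)) set" where
  "ad_rel G E =
     {((a, x), (ract E (a, g), Adj G (inv\<^bsub>G\<^esub> g) x)) | a x g.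
        a \<in> points (total E) \<and> x \<in> lie_algebra G \<and> g \<in> carrier G}"

definition at_class ::
  "('g, 'k::euclidean_space) lie_grp \<Rightarrow> ('p, 'q::euclidean_space, 'x, 'g) pbundle
    \<Rightarrow> 'p \<Rightarrow> ('p, 'q) tvec \<Rightarrow> ('p \<times> ('p, 'q) tvec) set" where
  "at_class G E a w = at_rel G E `` {(a, w)}"

definition ad_class ::
  "('g, 'k::euclidean_space) lie_grp \<Rightarrow> ('p, 'q::euclidean_space, 'x, 'g) pbundle
    \<Rightarrow> 'p \<Rightarrow> ('g, 'k) tvec \<Rightarrow> ('p \<times> ('g, 'k) tvec) set" where
  "ad_class G E a x = ad_rel G E `` {(a, x)}"

definition At_fibre ::
  "('g, 'k::euclidean_space) lie_grp \<Rightarrow> ('p, 'q::euclidean_space, 'x, 'g) pbundle \<Rightarrow> 'x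
    \<Rightarrow> ('p \<times> ('p, 'q) tvec) set set" where
  "At_fibre G E x =
     {(a, w). a \<in> points (total E) \<and> proj E a = x \<and> w \<in> tangent_space (total E) a} // at_rel G E"

definition ad_fibre ::
  "('g, 'k::euclidean_space) lie_grp \<Rightarrow> ('p, 'q::euclidean_space, 'x, 'g) pbundle \<Rightarrow> 'x
    \<Rightarrow> ('p \<times> ('g, 'k) tvec) set set" where
  "ad_fibre G E x =
     {(a, y). a \<in> points (total E) \<and> proj E a = x \<and> y \<in> lie_algebra G} // ad_rel G E"

text \<open>
  A splitting of the Atiyah sequence, given as a retraction \<open>D\<close> of the inclusion of the adjoint
  bundle.  Sections of the Atiyah bundle over \<open>U\<close> are the \<open>G\<close>-invariant vector fields over \<open>U\<close>,
  and sections of the adjoint bundle are the \<open>G\<close>-equivariant functions to the Lie algebra;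
  \<open>D\<close> is smooth if it maps smooth sections to smooth sections.  A function \<open>f\<close> representing
  the image of an invariant vector field is automatically equivariant.
\<close>

definition atiyah_splitting ::
  "('g, 'k::euclidean_space) lie_grp \<Rightarrow> ('x, 'e::euclidean_space) mfd
    \<Rightarrow> ('p, 'q::euclidean_space, 'x, 'g) pbundle
    \<Rightarrow> (('p \<times> ('p, 'q) tvec) set \<Rightarrow> ('p \<times> ('g, 'k) tvec) set) \<Rightarrow> bool" where
  "atiyah_splitting G M E D \<longleftrightarrow>
     (\<forall>x\<in>points M. \<forall>C\<in>At_fibre G E x. D C \<in> ad_fibre G E x) \<and>
     (\<forall>a\<in>points (total E). \<forall>v\<in>tangent_space (total E) a. \<forall>w\<in>tangent_space (total E) a.
        \<forall>y\<in>lie_algebra G. \<forall>z\<in>lie_algebra G. \<forall>r::real.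
          D (at_class G E a v) = ad_class G E a y \<and> D (at_class G E a w) = ad_class G E a z \<longrightarrow>
          D (at_class G E a (v + w)) = ad_class G E a (y + z) \<and>
          D (at_class G E a (r *\<^sub>R v)) = ad_class G E a (r *\<^sub>R y)) \<and>
     (\<forall>a\<in>points (total E). \<forall>y\<in>lie_algebra G.
        D (at_class G E a (tangent_map (gmfd G) (total E) (\<lambda>h. ract E (a, h)) \<one>\<^bsub>G\<^esub> y))
          = ad_class G E a y) \<and>
     (\<forall>U W. openin (mtop M) U \<and>
        smooth_vector_field (total E) {a \<in> points (total E). proj E a \<in> U} W \<and>
        (\<forall>a\<in>points (total E). \<forall>g\<in>carrier G. proj E a \<in> U \<longrightarrow>
           tangent_map (total E) (total E) (\<lambda>b. ract E (b, g)) a (W a) = W (ract E (a, g))) \<longrightarrow>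
        (\<exists>f. smooth_lie_function G (total E) {a \<in> points (total E). proj E a \<in> U} f \<and>
           (\<forall>a\<in>points (total E). proj E a \<in> U \<longrightarrow>
              D (at_class G E a (W a)) = ad_class G E a (f a))))"

text \<open>
  \<open>atiyah_map\<close>, \<open>At_action\<close> and \<open>ad_action\<close> are quotients by \<open>G\<close> of maps on representatives: the image of a class
  is the union of the classes of the images of its representatives, which all coincide.
\<close>

definition atiyah_map ::
  "('g, 'k::euclidean_space) lie_grp \<Rightarrow> ('p, 'q::euclidean_space, 'x, 'g) pbundle
    \<Rightarrow> ('p \<Rightarrow> ('p, 'q) tvec \<Rightarrow> ('g, 'k) tvec)
    \<Rightarrow> ('p \<times> ('p, 'q) tvec) set \<Rightarrow> ('p \<times> ('g, 'k) tvec) set" where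
  "atiyah_map G E \<omega> C = (\<Union>(a, w)\<in>C. ad_class G E a (\<omega> a w))"

definition theta_tilde ::
  "('x, 'e::euclidean_space, 'y, 'f::euclidean_space) lie_gpd \<Rightarrow> ('y \<Rightarrow> ('y, 'f) tvec set)
    \<Rightarrow> ('p, 'q::euclidean_space, 'x, 'g) pbundle \<Rightarrow> ('y \<times> 'p \<Rightarrow> 'p)
    \<Rightarrow> 'y \<Rightarrow> 'p \<Rightarrow> ('p, 'q) tvec \<Rightarrow> ('p, 'q) tvec" where
  "theta_tilde X H E \<mu> \<gamma> a w =
     (let P = source_pullback X E;
          h = horizontal_lift X H \<gamma> (tangent_map (total E) (objs X) (proj E) a w)
      in tangent_map P (total E) \<mu> (\<gamma>, a)
           (THE v. v \<in> tangent_space P (\<gamma>, a) \<and>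
                   tangent_map P (arrs X) fst (\<gamma>, a) v = h \<and>
                   tangent_map P (total E) snd (\<gamma>, a) v = w))"

definition At_action ::
  "('g, 'k::euclidean_space) lie_grp \<Rightarrow> ('x, 'e::euclidean_space, 'y, 'f::euclidean_space) lie_gpd
    \<Rightarrow> ('y \<Rightarrow> ('y, 'f) tvec set) \<Rightarrow> ('p, 'q::euclidean_space, 'x, 'g) pbundle \<Rightarrow> ('y \<times> 'p \<Rightarrow> 'p)
    \<Rightarrow> 'y \<Rightarrow> ('p \<times> ('p, 'q) tvec) set \<Rightarrow> ('p \<times> ('p, 'q) tvec) set" where
  "At_action G X H E \<mu> \<gamma> C =
     (\<Union>(a, w)\<in>C. at_class G E (\<mu> (\<gamma>, a)) (theta_tilde X H E \<mu> \<gamma> a w))"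

definition ad_action ::
  "('g, 'k::euclidean_space) lie_grp \<Rightarrow> ('p, 'q::euclidean_space, 'x, 'g) pbundle \<Rightarrow> ('y \<times> 'p \<Rightarrow> 'p)
    \<Rightarrow> 'y \<Rightarrow> ('p \<times> ('g, 'k) tvec) set \<Rightarrow> ('p \<times> ('g, 'k) tvec) set" where
  "ad_action G E \<mu> \<gamma> C = (\<Union>(a, x)\<in>C. ad_class G E (\<mu> (\<gamma>, a)) x)"

text \<open>A splitting of the Atiyah sequence that is compatible with the actions of the arrows.\<close>

definition defines_connection ::
  "('g, 'k::euclidean_space) lie_grp \<Rightarrow> ('x, 'e::euclidean_space, 'y, 'f::euclidean_space) lie_gpd
    \<Rightarrow> ('y \<Rightarrow> ('y, 'f) tvec set) \<Rightarrow> ('p, 'q::euclidean_space, 'x, 'g) pbundle \<Rightarrow> ('y \<times> 'p \<Rightarrow> 'p)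
    \<Rightarrow> (('p \<times> ('p, 'q) tvec) set \<Rightarrow> ('p \<times> ('g, 'k) tvec) set) \<Rightarrow> bool" where
  "defines_connection G X H E \<mu> D \<longleftrightarrow>
     atiyah_splitting G (objs X) E D \<and>
     (\<forall>\<gamma>\<in>points (arrs X). \<forall>C\<in>At_fibre G E (src X \<gamma>).
        D (At_action G X H E \<mu> \<gamma> C) = ad_action G E \<mu> \<gamma> (D C))"

end

theory Submission
  imports Defs
begin

text \<open>
  An arrow \<open>(\<gamma>, a)\<close> of the pulled back groupoid carries the tangent vectors \<open>(u, w)\<close> with
  \<open>ds u = d\<pi> w\<close>, and its horizontal vectors are the pairs of a vector \<open>w\<close> and the horizontal lift of
  \<open>d\<pi> w\<close>.  Hence \<open>\<omega>\<close> is a form on this groupoid iff \<open>\<omega> w = \<omega> (\<theta> w)\<close> for all \<open>w\<close>, where \<open>\<theta> w\<close> is the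
  image of \<open>w\<close> under the action.  On the other hand \<open>D\<close> always splits the Atiyah sequence; it sends
  \<open>\<gamma> \<cdot> [w]\<close> to the class of \<open>(\<gamma> \<cdot> a, \<omega> (\<theta> w))\<close> whereas \<open>\<gamma> \<cdot> D [w]\<close> is the class of
  \<open>(\<gamma> \<cdot> a, \<omega> w)\<close>; as \<open>G\<close> acts freely, these classes agree iff \<open>\<omega> w = \<omega> (\<theta> w)\<close>.
  The analytic content is the description of the tangent spaces of the fibre product.
\<close>

section \<open>Calculus on relatively open subsets of subspaces\<close>

text \<open>Two features of the encoding shape the proof. First, charts take values in linear
  subspaces, so a derivative is determined only on the directions of the model; every comparison of
  derivatives is made on model vectors, within the whole model. Second, the atlas of
  \<open>submfd\<close> consists only of restrictions of slice charts, so the tangent spaces of a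
  fibre product say nothing until slice charts are exhibited around every point. A local
  trivialization of the bundle supplies them, together with an equation
  \<open>L (cmap c (x, z)) = cmap b (proj E z) - cmap b (s x)\<close>. Linearizing this equation
  shows that a pair \<open>(u, w)\<close> with \<open>ds u = d\<pi> w\<close> really comes from a
  tangent vector of the fibre product. Slice charts belong to the maximal atlas, while tangent
  vectors have coordinates in atlas charts. The two are compared through an atlas chart and to first
  order, which is why the calculus is built on \<open>mdiff\<close> and
  \<open>dmanifold\<close>.\<close>

lemma C_k_on_cong:
  assumes "\<And>x. x \<in> A \<Longrightarrow> f x = g x" "C_k_on k V A f"
  shows "C_k_on k V A g"
proof (cases k)
  case 0
  then show ?thesis using assms continuous_on_cong[of A A f g] by simp
next
  case (Suc j)
  then obtain D where D: "\<And>x. x \<in> A \<Longrightarrow> (f has_derivative D x) (at x within A)"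
    "\<And>v. v \<in> V \<Longrightarrow> C_k_on j V A (\<lambda>x. D x v)" using assms(2) by auto
  have "(g has_derivative D x) (at x within A)" if "x \<in> A" for x
    by (rule has_derivative_transform[OF that _ D(1)[OF that]]) (simp add: assms(1))
  with D(2) Suc show ?thesis by auto
qed

lemma C_k_on_SucI:
  assumes "\<And>x. x \<in> A \<Longrightarrow> (f has_derivative D x) (at x within A)"
    "\<And>v. v \<in> V \<Longrightarrow> C_k_on k V A (\<lambda>x. D x v)"
  shows "C_k_on (Suc k) V A f"
  using assms by auto

lemma C_k_on_SucE:
  assumes "C_k_on (Suc k) V A f"
  obtains D where "\<And>x. x \<in> A \<Longrightarrow> (f has_derivative D x) (at x within A)"
    "\<And>v. v \<in> V \<Longrightarrow> C_k_on k V A (\<lambda>x. D x v)"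
  using assms by auto

lemma C_k_on_subset: "C_k_on k V A f \<Longrightarrow> B \<subseteq> A \<Longrightarrow> C_k_on k V B f"
proof (induction k arbitrary: f)
  case 0
  then show ?case using continuous_on_subset by auto
next
  case (Suc k)
  obtain D where D: "\<And>x. x \<in> A \<Longrightarrow> (f has_derivative D x) (at x within A)"
    "\<And>v. v \<in> V \<Longrightarrow> C_k_on k V A (\<lambda>x. D x v)" using Suc.prems(1) by (rule C_k_on_SucE) blast
  show ?case
    by (rule C_k_on_SucI[where D=D]) (use D Suc.IH Suc.prems(2) has_derivative_subset in blast)+
qed

text \<open>The product and chain rules leave one factor undifferentiated, so their inductions must
  lower the order of that factor by one.\<close>

lemma C_k_on_Suc: "C_k_on (Suc k) V A f \<Longrightarrow> C_k_on k V A f"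
proof (induction k arbitrary: f)
  case 0
  then show ?case using has_derivative_continuous_on[of A f] by auto
next
  case (Suc k)
  obtain D where D: "\<And>x. x \<in> A \<Longrightarrow> (f has_derivative D x) (at x within A)"
    "\<And>v. v \<in> V \<Longrightarrow> C_k_on (Suc k) V A (\<lambda>x. D x v)" using Suc.prems by (rule C_k_on_SucE) blast
  show ?case by (rule C_k_on_SucI[where D=D]) (use D Suc.IH in blast)+
qed

lemma C_k_on_const: "C_k_on k V A (\<lambda>x. c)"
  by (induction k arbitrary: c) (auto intro!: exI[of _ "\<lambda>x v. 0"])

lemma C_k_on_linear: "bounded_linear f \<Longrightarrow> C_k_on k V A f"
  by (cases k) (auto intro!: exI[of _ "\<lambda>x. f"] C_k_on_const
      simp: bounded_linear_imp_has_derivative linear_continuous_on)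

lemma C_k_on_add: "C_k_on k V A f \<Longrightarrow> C_k_on k V A g \<Longrightarrow> C_k_on k V A (\<lambda>x. f x + g x)"
proof (induction k arbitrary: f g)
  case 0
  then show ?case by (auto intro: continuous_intros)
next
  case (Suc k)
  obtain D where D: "\<And>x. x \<in> A \<Longrightarrow> (f has_derivative D x) (at x within A)"
    "\<And>v. v \<in> V \<Longrightarrow> C_k_on k V A (\<lambda>x. D x v)" using Suc.prems(1) by (rule C_k_on_SucE) blast
  obtain D' where D': "\<And>x. x \<in> A \<Longrightarrow> (g has_derivative D' x) (at x within A)"
    "\<And>v. v \<in> V \<Longrightarrow> C_k_on k V A (\<lambda>x. D' x v)" using Suc.prems(2) by (rule C_k_on_SucE) blast
  show ?case
    by (rule C_k_on_SucI[where D="\<lambda>x v. D x v + D' x v"])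
      (intro has_derivative_add D(1) D'(1) Suc.IH D(2) D'(2); assumption)+
qed

lemma C_k_on_sum:
  "finite S \<Longrightarrow> (\<And>i. i \<in> S \<Longrightarrow> C_k_on k V A (f i)) \<Longrightarrow> C_k_on k V A (\<lambda>x. \<Sum>i\<in>S. f i x)"
  by (induction S rule: finite_induct) (auto intro: C_k_on_add C_k_on_const)

lemma C_k_on_linear_compose:
  "bounded_linear L \<Longrightarrow> C_k_on k V A f \<Longrightarrow> C_k_on k V A (\<lambda>x. L (f x))"
proof (induction k arbitrary: f)
  case 0
  then show ?case by (auto intro: bounded_linear.continuous_on)
next
  case (Suc k)
  obtain D where D: "\<And>x. x \<in> A \<Longrightarrow> (f has_derivative D x) (at x within A)"
    "\<And>v. v \<in> V \<Longrightarrow> C_k_on k V A (\<lambda>x. D x v)" using Suc.prems(2) by (rule C_k_on_SucE) blast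
  show ?case
    by (rule C_k_on_SucI[where D="\<lambda>x v. L (D x v)"])
      (intro bounded_linear.has_derivative[OF Suc.prems(1)] D(1) Suc.IH[OF Suc.prems(1)] D(2); assumption)+
qed

lemma C_k_on_Pair:
  "C_k_on k V A f \<Longrightarrow> C_k_on k V A g \<Longrightarrow> C_k_on k V A (\<lambda>x. (f x, g x))"
proof (induction k arbitrary: f g)
  case 0
  then show ?case by (auto intro: continuous_intros)
next
  case (Suc k)
  obtain D where D: "\<And>x. x \<in> A \<Longrightarrow> (f has_derivative D x) (at x within A)"
    "\<And>v. v \<in> V \<Longrightarrow> C_k_on k V A (\<lambda>x. D x v)" using Suc.prems(1) by (rule C_k_on_SucE) blast
  obtain D' where D': "\<And>x. x \<in> A \<Longrightarrow> (g has_derivative D' x) (at x within A)"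
    "\<And>v. v \<in> V \<Longrightarrow> C_k_on k V A (\<lambda>x. D' x v)" using Suc.prems(2) by (rule C_k_on_SucE) blast
  show ?case
    by (rule C_k_on_SucI[where D="\<lambda>x v. (D x v, D' x v)"])
      (intro has_derivative_Pair D(1) D'(1) Suc.IH D(2) D'(2); assumption)+
qed

lemma C_k_on_scaleR:
  fixes \<phi> :: "'e::euclidean_space \<Rightarrow> real"
  shows "C_k_on k V A \<phi> \<Longrightarrow> C_k_on k V A h \<Longrightarrow> C_k_on k V A (\<lambda>x. \<phi> x *\<^sub>R h x)"
proof (induction k arbitrary: \<phi> h)
  case 0
  then show ?case by (auto intro: continuous_intros)
next
  case (Suc k)
  obtain D where D: "\<And>x. x \<in> A \<Longrightarrow> (\<phi> has_derivative D x) (at x within A)"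
    "\<And>v. v \<in> V \<Longrightarrow> C_k_on k V A (\<lambda>x. D x v)" using Suc.prems(1) by (rule C_k_on_SucE) blast
  obtain D' where D': "\<And>x. x \<in> A \<Longrightarrow> (h has_derivative D' x) (at x within A)"
    "\<And>v. v \<in> V \<Longrightarrow> C_k_on k V A (\<lambda>x. D' x v)" using Suc.prems(2) by (rule C_k_on_SucE) blast
  show ?case
    by (rule C_k_on_SucI[where D="\<lambda>x v. \<phi> x *\<^sub>R D' x v + D x v *\<^sub>R h x"])
      (intro has_derivative_scaleR D(1) D'(1) C_k_on_add Suc.IH D(2) D'(2) Suc.prems[THEN C_k_on_Suc]; assumption)+
qed

section \<open>Derivatives within a linear subspace\<close>

lemma at_within_openin:
  assumes "openin (top_of_set V) A" "x \<in> A"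
  shows "at x within A = at x within V"
proof -
  obtain T where "open T" "A = V \<inter> T" using assms(1) by (auto simp: openin_open)
  with assms(2) show ?thesis by (intro at_within_nhd[of x T]) auto
qed

text \<open>The line through \<open>x\<close> in direction \<open>v\<close> stays in
  \<open>V\<close>; along it both derivatives become the ordinary derivative of a curve, which is
  unique. Outside \<open>V\<close> nothing is claimed, and nothing could be.\<close>

lemma has_derivative_unique_subspace:
  fixes f :: "'e::real_normed_vector \<Rightarrow> 'f::real_normed_vector"
  assumes V: "subspace V" "x \<in> V" "v \<in> V"
    and D: "(f has_derivative D) (at x within V)" "(f has_derivative D') (at x within V)"
  shows "D v = D' v"
proof -
  have line: "((\<lambda>t::real. x + t *\<^sub>R v) has_derivative (\<lambda>t. t *\<^sub>R v)) (at 0)"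
    by (auto intro!: derivative_eq_intros)
  have sub: "range (\<lambda>t::real. x + t *\<^sub>R v) \<subseteq> V"
    using V by (auto intro: subspace_add subspace_scale)
  have "(f \<circ> (\<lambda>t. x + t *\<^sub>R v) has_derivative F \<circ> (\<lambda>t. t *\<^sub>R v)) (at 0)"
    if "(f has_derivative F) (at x within V)" for F
    using diff_chain_within[OF line, of f F] has_derivative_subset[OF that sub] by simp
  then have "D \<circ> (\<lambda>t. t *\<^sub>R v) = D' \<circ> (\<lambda>t. t *\<^sub>R v)"
    using D has_derivative_unique by blast
  then show ?thesis by (metis comp_apply scaleR_one)
qed

text \<open>Pairing \<open>f\<close> with a vector orthogonal to \<open>V'\<close> gives 0 on
  \<open>A\<close>, so the pairing with \<open>D v\<close> is 0 as well; a subspace is its own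
  double orthogonal complement.\<close>

lemma has_derivative_in_subspace:
  fixes f :: "'e::euclidean_space \<Rightarrow> 'f::euclidean_space"
  assumes V: "subspace V" "openin (top_of_set V) A" "x \<in> A" "v \<in> V"
    and V': "subspace V'" "f ` A \<subseteq> V'"
    and D: "(f has_derivative D) (at x within V)"
  shows "D v \<in> V'"
proof -
  have A: "at x within A = at x within V" by (rule at_within_openin[OF V(2,3)])
  have xV: "x \<in> V" using V(2,3) openin_imp_subset by blast
  have "y \<bullet> D v = 0" if y: "y \<in> orthogonal_comp V'" for y
  proof -
    have 0: "y \<bullet> f z = 0" if "z \<in> A" for z
      using y that V'(2) by (auto simp: orthogonal_comp_def orthogonal_def inner_commute[of y])
    have "((\<lambda>z. y \<bullet> f z) has_derivative (\<lambda>z. y \<bullet> D z)) (at x within V)"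
      using D by (rule has_derivative_inner_right)
    moreover have "((\<lambda>z. y \<bullet> f z) has_derivative (\<lambda>z. 0)) (at x within A)"
      by (rule has_derivative_transform[OF V(3) _ has_derivative_const]) (use 0 in auto)
    ultimately show ?thesis
      unfolding A using has_derivative_unique_subspace[OF V(1) xV V(4)] by blast
  qed
  then have "D v \<in> orthogonal_comp (orthogonal_comp V')"
    by (auto simp: orthogonal_comp_def orthogonal_def)
  then show ?thesis using orthogonal_comp_self[OF V'(1)] by simp
qed

text \<open>The chain rule evaluates \<open>Dg (f x)\<close> in the direction \<open>Df x v\<close>,
  which varies with \<open>x\<close>, whereas \<open>C_k_on\<close> controls \<open>Dg\<close> only
  in fixed directions of \<open>V'\<close>. Since \<open>Df x v\<close> lies in \<open>V'\<close>,
  it is expanded in an orthonormal basis; this leaves scalar functions times derivatives in fixed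
  directions.\<close>

lemma C_k_on_compose:
  fixes f :: "'e::euclidean_space \<Rightarrow> 'f::euclidean_space" and g :: "'f \<Rightarrow> 'h::euclidean_space"
  assumes V: "subspace V" "openin (top_of_set V) A" "subspace V'" "B \<subseteq> V'" "f ` A \<subseteq> B"
  shows "C_k_on k V A f \<Longrightarrow> C_k_on k V' B g \<Longrightarrow> C_k_on k V A (\<lambda>x. g (f x))"
proof (induction k arbitrary: g)
  case 0
  then show ?case using V continuous_on_compose2 by (metis C_k_on.simps(1))
next
  case (Suc k)
  obtain Df where Df: "\<And>x. x \<in> A \<Longrightarrow> (f has_derivative Df x) (at x within A)"
    "\<And>v. v \<in> V \<Longrightarrow> C_k_on k V A (\<lambda>x. Df x v)" using Suc.prems(1) by auto
  obtain Dg where Dg: "\<And>x. x \<in> B \<Longrightarrow> (g has_derivative Dg x) (at x within B)"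
    "\<And>v. v \<in> V' \<Longrightarrow> C_k_on k V' B (\<lambda>x. Dg x v)" using Suc.prems(2) by auto
  obtain S where S: "S \<subseteq> V'" "pairwise orthogonal S" "\<And>x. x \<in> S \<Longrightarrow> norm x = 1"
    "independent S" "span S = V'"
    by (rule orthonormal_basis_subspace[OF V(3)]) blast
  have fin: "finite S" using S(4) independent_imp_finite by blast
  have expand: "w = (\<Sum>b\<in>S. (w \<bullet> b) *\<^sub>R b)" if w: "w \<in> V'" for w
  proof (rule vector_eq_dot_span[of _ S])
    show "w \<in> span S" using w S(5) by simp
    show "(\<Sum>b\<in>S. (w \<bullet> b) *\<^sub>R b) \<in> span S" by (intro span_sum span_scale span_base)
    fix i assume i: "i \<in> S"
    have "i \<bullet> (\<Sum>b\<in>S. (w \<bullet> b) *\<^sub>R b) = (\<Sum>b\<in>S. (w \<bullet> b) * (i \<bullet> b))" by (simp add: inner_sum_right)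
    also have "\<dots> = (\<Sum>b\<in>S. if b = i then w \<bullet> i else 0)"
      using S(2,3) i by (intro sum.cong)
        (auto simp: pairwise_def orthogonal_def norm_eq_1)
    finally show "i \<bullet> w = i \<bullet> (\<Sum>b\<in>S. (w \<bullet> b) *\<^sub>R b)" using i fin by (simp add: inner_commute)
  qed
  have "((\<lambda>x. g (f x)) has_derivative (\<lambda>v. Dg (f x) (Df x v))) (at x within A)" if "x \<in> A" for x
    using diff_chain_within[OF Df(1)[OF that], of g "Dg (f x)"]
      has_derivative_subset[OF Dg(1) V(5)] that V(5) by (auto simp: o_def)
  moreover have "C_k_on k V A (\<lambda>x. Dg (f x) (Df x v))" if v: "v \<in> V" for v
  proof (rule C_k_on_cong[of _ "\<lambda>x. \<Sum>b\<in>S. (Df x v \<bullet> b) *\<^sub>R Dg (f x) b"])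
    show "(\<Sum>b\<in>S. (Df x v \<bullet> b) *\<^sub>R Dg (f x) b) = Dg (f x) (Df x v)" if x: "x \<in> A" for x
    proof -
      have "Df x v \<in> V'"
        by (rule has_derivative_in_subspace[OF V(1,2) x v V(3) _ Df(1)[OF x, unfolded at_within_openin[OF V(2) x]]])
          (use V in auto)
      moreover have "linear (Dg (f x))"
        using Dg(1)[of "f x"] x V(5) has_derivative_linear by blast
      ultimately show ?thesis
        by (subst (2) expand) (auto simp: linear_sum linear_scale)
    qed
    have "C_k_on k V A (\<lambda>x. Dg (f x) b)" if "b \<in> S" for b
      by (rule Suc.IH[OF C_k_on_Suc[OF Suc.prems(1)] Dg(2)]) (use that S in auto)
    then show "C_k_on k V A (\<lambda>x. \<Sum>b\<in>S. (Df x v \<bullet> b) *\<^sub>R Dg (f x) b)"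
      by (intro C_k_on_sum[OF fin] C_k_on_scaleR
          C_k_on_linear_compose[OF bounded_linear_inner_left] Df(2)[OF v]) auto
  qed
  ultimately show ?case by (rule C_k_on_SucI)
qed

section \<open>Closure properties of smooth functions\<close>

lemma C_inf_on_cong: "C_inf_on V A f \<Longrightarrow> (\<And>x. x \<in> A \<Longrightarrow> f x = g x) \<Longrightarrow> C_inf_on V A g"
  unfolding C_inf_on_def using C_k_on_cong by blast

lemma C_inf_on_subset: "C_inf_on V A f \<Longrightarrow> B \<subseteq> A \<Longrightarrow> C_inf_on V B f"
  unfolding C_inf_on_def using C_k_on_subset by blast

lemma C_inf_on_linear: "bounded_linear f \<Longrightarrow> C_inf_on V A f"
  unfolding C_inf_on_def using C_k_on_linear by blast

lemma C_inf_on_linear_compose: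
  "bounded_linear L \<Longrightarrow> C_inf_on V A f \<Longrightarrow> C_inf_on V A (\<lambda>x. L (f x))"
  unfolding C_inf_on_def using C_k_on_linear_compose by blast

lemma C_inf_on_add: "C_inf_on V A f \<Longrightarrow> C_inf_on V A g \<Longrightarrow> C_inf_on V A (\<lambda>x. f x + g x)"
  unfolding C_inf_on_def using C_k_on_add by blast

lemma C_inf_on_diff:
  assumes "C_inf_on V A f" "C_inf_on V A g" shows "C_inf_on V A (\<lambda>x. f x - g x)"
  using C_inf_on_add[OF assms(1) C_inf_on_linear_compose[OF bounded_linear_minus[OF bounded_linear_ident] assms(2)]]
  by simp

lemma C_inf_on_Pair:
  "C_inf_on V A f \<Longrightarrow> C_inf_on V A g \<Longrightarrow> C_inf_on V A (\<lambda>x. (f x, g x))"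
  unfolding C_inf_on_def using C_k_on_Pair by blast

lemma C_inf_on_compose:
  assumes "subspace V" "openin (top_of_set V) A" "subspace V'" "B \<subseteq> V'" "f ` A \<subseteq> B"
    "C_inf_on V A f" "C_inf_on V' B g"
  shows "C_inf_on V A (\<lambda>x. g (f x))"
  using assms C_k_on_compose[OF assms(1-5)] unfolding C_inf_on_def by blast

lemma C_inf_on_continuous: "C_inf_on V A f \<Longrightarrow> continuous_on A f"
  unfolding C_inf_on_def using C_k_on.simps(1) by blast

lemma C_inf_on_differentiable:
  assumes "C_inf_on V A f" "openin (top_of_set V) A" "x \<in> A"
  shows "f differentiable (at x within V)"
proof -
  obtain D where "(f has_derivative D) (at x within A)"
    using assms(1,3) unfolding C_inf_on_def by (metis C_k_on.simps(2))
  then show ?thesis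
    unfolding at_within_openin[OF assms(2,3)] by (rule differentiableI)
qed

lemma C_inf_on_map_prod:
  assumes "subspace V" "openin (top_of_set V) A" "subspace W" "openin (top_of_set W) B"
    "C_inf_on V A f" "C_inf_on W B g"
  shows "C_inf_on (V \<times> W) (A \<times> B) (map_prod f g)"
proof -
  have *: "subspace (V \<times> W)" "openin (top_of_set (V \<times> W)) (A \<times> B)"
    using assms subspace_Times openin_Times by auto
  have "C_inf_on (V \<times> W) (A \<times> B) (\<lambda>z. (f (fst z), g (snd z)))"
    by (intro C_inf_on_Pair
        C_inf_on_compose[OF * assms(1) openin_imp_subset[OF assms(2)] _ C_inf_on_linear[OF bounded_linear_fst] assms(5)]
        C_inf_on_compose[OF * assms(3) openin_imp_subset[OF assms(4)] _ C_inf_on_linear[OF bounded_linear_snd] assms(6)])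
      auto
  then show ?thesis by (rule C_inf_on_cong) (auto simp: map_prod_def split: prod.split)
qed

section \<open>Tangent spaces and differentials\<close>

lemma is_chart_inj: "is_chart T c \<Longrightarrow> inj_on (cmap c) (cdom c)"
  unfolding is_chart_def homeomorphic_map_def quotient_map_def
  by (metis homeomorphic_imp_injective_map homeomorphic_map_def openin_subset quotient_map_def
      topspace_subtopology_subset)

lemma is_chart_subspace: "is_chart T c \<Longrightarrow> subspace (cmodel c)"
  unfolding is_chart_def by blast

lemma cinv_cmap [simp]: "is_chart T c \<Longrightarrow> p \<in> cdom c \<Longrightarrow> cinv c (cmap c p) = p"
  unfolding cinv_def using inv_into_f_f is_chart_inj by metis

lemma is_chart_openin:
  assumes "is_chart T c" "openin T U"
  shows "openin (top_of_set (cmodel c)) (cmap c ` (cdom c \<inter> U))"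
proof -
  have "openin (top_of_set (cmap c ` cdom c)) (cmap c ` (cdom c \<inter> U))"
    using assms homeomorphic_imp_open_map
    unfolding is_chart_def open_map_def by (metis inf_commute openin_subtopology_Int)
  then show ?thesis
    using assms(1) openin_trans unfolding is_chart_def by blast
qed

lemma is_chart_cmodel: "is_chart T c \<Longrightarrow> p \<in> cdom c \<Longrightarrow> cmap c p \<in> cmodel c"
  unfolding is_chart_def by (meson imageI openin_imp_subset subsetD)

lemma is_chart_at_within:
  assumes "is_chart T c" "openin T U" "p \<in> cdom c" "p \<in> U"
  shows "at (cmap c p) within cmap c ` (cdom c \<inter> U) = at (cmap c p) within cmodel c"
  using at_within_openin[OF is_chart_openin[OF assms(1,2)]] assms(3,4) by blast

text \<open>When the model is a proper subspace, \<open>frechet_derivative\<close> chooses one of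
  many derivatives; on model vectors the choice does not matter. This lemma is the way from the
  definitions, which use that operator, to an arbitrary derivative \<open>D\<close>.\<close>

lemma frechet_derivative_chart:
  assumes c: "is_chart T c" "openin T U" "p \<in> cdom c" "p \<in> U"
    and D: "(f has_derivative D) (at (cmap c p) within cmodel c)" and v: "v \<in> cmodel c"
  shows "frechet_derivative f (at (cmap c p) within cmap c ` (cdom c \<inter> U)) v = D v"
  unfolding is_chart_at_within[OF c]
  using has_derivative_unique_subspace[OF is_chart_subspace[OF c(1)] is_chart_cmodel[OF c(1,3)] v _ D]
    frechet_derivative_works D differentiableI by blast

lemma continuous_map_openin_vimage:
  assumes f: "continuous_map T T' f" and U: "openin T U" and U': "openin T' U'"
  shows "openin T {q \<in> U. f q \<in> U'}"
proof -
  have "{q \<in> U. f q \<in> U'} = U \<inter> {q \<in> topspace T. f q \<in> U'}"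
    using openin_subset[OF U] by auto
  then show ?thesis
    using openin_continuous_map_preimage[OF f U'] U by auto
qed

text \<open>The chain rule through an intermediate chart \<open>d\<close>. The points sent by
  \<open>f\<close> into \<open>cdom d\<close> form an open set, on which \<open>cinv d\<close>
  cancels \<open>cmap d\<close> and which does not change the filter. With the identity for
  \<open>f\<close> this also composes chart changes.\<close>

lemma has_derivative_chart_compose:
  fixes c :: "('a, 'e::euclidean_space) chart" and d :: "('b, 'f::euclidean_space) chart"
    and h :: "'b \<Rightarrow> 'h::euclidean_space"
  assumes c: "is_chart T c" "p \<in> cdom c" and d: "is_chart T' d" "f p \<in> cdom d"
    and f: "continuous_map T T' f"
    and D: "(cmap d \<circ> f \<circ> cinv c has_derivative D) (at (cmap c p) within cmodel c)"
    and D': "(h \<circ> cinv d has_derivative D') (at (cmap d (f p)) within cmodel d)"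
  shows "(h \<circ> f \<circ> cinv c has_derivative D' \<circ> D) (at (cmap c p) within cmodel c)"
proof -
  define U where "U = {q \<in> cdom c. f q \<in> cdom d}"
  define A where "A = cmap c ` (cdom c \<inter> U)"
  have U: "openin T U"
    using c d f unfolding U_def is_chart_def by (intro continuous_map_openin_vimage) auto
  have pU: "p \<in> U" using c d by (simp add: U_def)
  have A: "at (cmap c p) within A = at (cmap c p) within cmodel c"
    unfolding A_def by (rule is_chart_at_within[OF c(1) U c(2) pU])
  have img: "(cmap d \<circ> f \<circ> cinv c) ` A \<subseteq> cmodel d"
    using c d by (auto simp: A_def U_def intro: is_chart_cmodel)
  have "(h \<circ> cinv d has_derivative D') (at ((cmap d \<circ> f \<circ> cinv c) (cmap c p)) within (cmap d \<circ> f \<circ> cinv c) ` A)"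
    using has_derivative_subset[OF D' img] c by simp
  with D have 1: "((h \<circ> cinv d) \<circ> (cmap d \<circ> f \<circ> cinv c) has_derivative D' \<circ> D) (at (cmap c p) within A)"
    unfolding A[symmetric] by (rule diff_chain_within)
  have 2: "(h \<circ> f \<circ> cinv c) x = ((h \<circ> cinv d) \<circ> (cmap d \<circ> f \<circ> cinv c)) x" if "x \<in> A" for x
    using that c d by (auto simp: A_def U_def)
  have "cmap c p \<in> A" using c pU by (auto simp: A_def)
  from has_derivative_transform[OF this 2 1] show ?thesis by (simp only: A)
qed

lemma has_derivative_chart_in:
  assumes c: "is_chart T c" "p \<in> cdom c" and d: "is_chart T' d" "f p \<in> cdom d"
    and f: "continuous_map T T' f"
    and D: "(cmap d \<circ> f \<circ> cinv c has_derivative D) (at (cmap c p) within cmodel c)"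
    and v: "v \<in> cmodel c"
  shows "D v \<in> cmodel d"
proof -
  define U where "U = {q \<in> cdom c. f q \<in> cdom d}"
  have U: "openin T U"
    using c d f unfolding U_def is_chart_def by (intro continuous_map_openin_vimage) auto
  have pU: "p \<in> U" using c d by (simp add: U_def)
  show ?thesis
    by (rule has_derivative_in_subspace[OF is_chart_subspace[OF c(1)] is_chart_openin[OF c(1) U] _ v
          is_chart_subspace[OF d(1)] _ D])
      (use c d pU in \<open>auto simp: U_def intro: is_chart_cmodel\<close>)
qed

text \<open>Of smoothness, the calculus of tangent vectors only uses first derivatives in charts.\<close>

definition mdiff ::
  "('a, 'e::euclidean_space) mfd \<Rightarrow> ('b, 'f::euclidean_space) mfd \<Rightarrow> ('a \<Rightarrow> 'b) \<Rightarrow> bool" where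
  "mdiff M N f \<longleftrightarrow>
     continuous_map (mtop M) (mtop N) f \<and>
     (\<forall>c\<in>atlas M. \<forall>d\<in>atlas N. \<forall>p\<in>cdom c. f p \<in> cdom d \<longrightarrow>
        (cmap d \<circ> f \<circ> cinv c) differentiable (at (cmap c p) within cmodel c))"

text \<open>The condition \<open>mdiff M M (\<lambda>x. x)\<close> says that all chart changes are
  differentiable. This first-order notion of a manifold suffices for tangent vectors and is the one
  established for the fibre product.\<close>

definition dmanifold :: "('a, 'e::euclidean_space) mfd \<Rightarrow> bool" where
  "dmanifold M \<longleftrightarrow>
     (\<forall>c\<in>atlas M. is_chart (mtop M) c) \<and> (\<Union>c\<in>atlas M. cdom c) = points M \<and> mdiff M M (\<lambda>x. x)"

lemma charts_atD:
  assumes "dmanifold M" "c \<in> charts_at M p"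
  shows "is_chart (mtop M) c" "p \<in> cdom c" "c \<in> atlas M" "p \<in> points M"
  using assms unfolding dmanifold_def charts_at_def by auto

lemma charts_at_ex:
  assumes "dmanifold M" "p \<in> points M" obtains c where "c \<in> charts_at M p"
  using assms unfolding dmanifold_def charts_at_def by blast

lemma dmanifold_openin_cdom: "dmanifold M \<Longrightarrow> c \<in> charts_at M p \<Longrightarrow> openin (mtop M) (cdom c)"
  using charts_atD(1)[of M c p] by (simp add: is_chart_def)

lemma mdiff_continuous: "mdiff M N f \<Longrightarrow> continuous_map (mtop M) (mtop N) f"
  unfolding mdiff_def by blast

lemma mdiff_points: "mdiff M N f \<Longrightarrow> p \<in> points M \<Longrightarrow> f p \<in> points N"
  unfolding mdiff_def by (meson continuous_map_image_subset_topspace image_subset_iff)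

lemma mdiff_derivative:
  assumes "mdiff M N f" "c \<in> charts_at M p" "d \<in> charts_at N (f p)"
  obtains D where "(cmap d \<circ> f \<circ> cinv c has_derivative D) (at (cmap c p) within cmodel c)"
proof -
  have "(cmap d \<circ> f \<circ> cinv c) differentiable (at (cmap c p) within cmodel c)"
    using assms unfolding mdiff_def charts_at_def by simp
  then show ?thesis using that unfolding differentiable_def by blast
qed

lemma transition_derivative:
  assumes "dmanifold M" "c \<in> charts_at M p" "d \<in> charts_at M p"
  obtains D where "(cmap d \<circ> cinv c has_derivative D) (at (cmap c p) within cmodel c)"
proof -
  obtain D where "(cmap d \<circ> (\<lambda>x. x) \<circ> cinv c has_derivative D) (at (cmap c p) within cmodel c)"
    by (rule mdiff_derivative[of M M "\<lambda>x. x" c p d]) (use assms in \<open>auto simp: dmanifold_def\<close>)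
  then show ?thesis using that by (simp add: o_def)
qed

section \<open>Tangent vectors and their coordinates\<close>

lemma tangent_space_cmodel: "v \<in> tangent_space M p \<Longrightarrow> c \<in> charts_at M p \<Longrightarrow> v c \<in> cmodel c"
  unfolding tangent_space_def by blast

lemma tangent_space_outside: "v \<in> tangent_space M p \<Longrightarrow> c \<notin> charts_at M p \<Longrightarrow> v c = 0"
  unfolding tangent_space_def by blast

lemma tangent_space_transition:
  assumes M: "dmanifold M" "v \<in> tangent_space M p" "c \<in> charts_at M p" "d \<in> charts_at M p"
    and D: "(cmap d \<circ> cinv c has_derivative D) (at (cmap c p) within cmodel c)"
  shows "v d = D (v c)"
proof -
  have "v d = frechet_derivative (cmap d \<circ> cinv c) (at (cmap c p) within cmap c ` (cdom c \<inter> cdom d)) (v c)"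
    using M unfolding tangent_space_def by blast
  also have "\<dots> = D (v c)"
    by (rule frechet_derivative_chart[OF charts_atD(1)[OF M(1,3)] dmanifold_openin_cdom[OF M(1,4)] _ _ D])
      (use charts_atD(2)[OF M(1)] M(3,4) tangent_space_cmodel[OF M(2,3)] in auto)
  finally show ?thesis .
qed

text \<open>The transformation law may be checked against any derivative within the model instead of
  the chosen \<open>frechet_derivative\<close> on the overlap.\<close>

lemma tangent_spaceI:
  assumes M: "dmanifold M"
    and v: "\<And>c. c \<in> charts_at M p \<Longrightarrow> v c \<in> cmodel c"
    and D: "\<And>c d D. c \<in> charts_at M p \<Longrightarrow> d \<in> charts_at M p \<Longrightarrow>
      (cmap d \<circ> cinv c has_derivative D) (at (cmap c p) within cmodel c) \<Longrightarrow> v d = D (v c)"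
    and 0: "\<And>c. c \<notin> charts_at M p \<Longrightarrow> v c = 0"
  shows "v \<in> tangent_space M p"
proof -
  have "v d = frechet_derivative (cmap d \<circ> cinv c) (at (cmap c p) within cmap c ` (cdom c \<inter> cdom d)) (v c)"
    if cd: "c \<in> charts_at M p" "d \<in> charts_at M p" for c d
  proof -
    obtain D where D': "(cmap d \<circ> cinv c has_derivative D) (at (cmap c p) within cmodel c)"
      by (rule transition_derivative[OF M cd])
    show ?thesis
      unfolding D[OF cd D']
      by (rule frechet_derivative_chart[OF charts_atD(1)[OF M cd(1)] dmanifold_openin_cdom[OF M cd(2)] _ _ D', symmetric])
        (use charts_atD(2)[OF M] cd v in auto)
  qed
  with v 0 show ?thesis unfolding tangent_space_def by blast
qed

lemma tangent_space_eqI: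
  assumes "dmanifold M" "v \<in> tangent_space M p" "w \<in> tangent_space M p" "c \<in> charts_at M p" "v c = w c"
  shows "v = w"
proof
  fix d
  show "v d = w d"
  proof (cases "d \<in> charts_at M p")
    case True
    obtain D where D: "(cmap d \<circ> cinv c has_derivative D) (at (cmap c p) within cmodel c)"
      by (rule transition_derivative[OF assms(1,4) True])
    show ?thesis
      using tangent_space_transition[OF assms(1,2,4) True D]
        tangent_space_transition[OF assms(1,3,4) True D] assms(5) by simp
  next
    case False
    then show ?thesis using tangent_space_outside[OF assms(2)] tangent_space_outside[OF assms(3)] by simp
  qed
qed

lemma has_derivative_transition_compose:
  fixes M :: "('a, 'e::euclidean_space) mfd" and h :: "'a \<Rightarrow> 'h::euclidean_space"
  assumes M: "dmanifold M" "c \<in> charts_at M p" "d \<in> charts_at M p"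
    and D: "(cmap d \<circ> cinv c has_derivative D) (at (cmap c p) within cmodel c)"
      "(h \<circ> cinv d has_derivative D') (at (cmap d p) within cmodel d)"
  shows "(h \<circ> cinv c has_derivative D' \<circ> D) (at (cmap c p) within cmodel c)"
  using has_derivative_chart_compose[OF charts_atD(1,2)[OF M(1,2)] charts_atD(1)[OF M(1,3)], of "\<lambda>x. x" D h D']
    charts_atD(2)[OF M(1,3)] D by (simp add: o_def)

text \<open>One coordinate vector determines a tangent vector: its other coordinates are the images
  under the derivatives of the chart changes from \<open>c\<close>.\<close>

lemma tangent_space_ex:
  fixes M :: "('a, 'e::euclidean_space) mfd"
  assumes M: "dmanifold M" and c: "c \<in> charts_at M p" and \<xi>: "\<xi> \<in> cmodel c"
  obtains v where "v \<in> tangent_space M p" "v c = \<xi>"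
proof -
  define F where "F d = (SOME D. (cmap d \<circ> cinv c has_derivative D) (at (cmap c p) within cmodel c))" for d :: "('a, 'e) chart"
  have F: "(cmap d \<circ> cinv c has_derivative F d) (at (cmap c p) within cmodel c)"
    if "d \<in> charts_at M p" for d
    using transition_derivative[OF M c that] someI_ex unfolding F_def by metis
  note cD = charts_atD[OF M]
  \<comment> \<open>The derivatives \<open>F d\<close> are chosen arbitrarily; only their values at
    \<open>\<xi>\<close> matter, and these are forced.\<close>
  have uniq: "D \<xi> = F d \<xi>"
    if "d \<in> charts_at M p" "(cmap d \<circ> cinv c has_derivative D) (at (cmap c p) within cmodel c)" for d D
    using has_derivative_unique_subspace[OF is_chart_subspace[OF cD(1)[OF c]] _ \<xi> that(2) F[OF that(1)]]
      is_chart_cmodel[OF cD(1)[OF c] cD(2)[OF c]] by blast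
  define v where "v d = (if d \<in> charts_at M p then F d \<xi> else 0)" for d :: "('a, 'e) chart"
  have "v \<in> tangent_space M p"
  proof (rule tangent_spaceI[OF M])
    fix d assume d: "d \<in> charts_at M p"
    show "v d \<in> cmodel d"
      using has_derivative_chart_in[OF cD(1)[OF c] cD(2)[OF c] cD(1)[OF d], of "\<lambda>x. x"] F[OF d] \<xi> cD(2)[OF d] d
      by (simp add: v_def o_def)
  next
    \<comment> \<open>The cocycle property: going from \<open>c\<close> to \<open>d'\<close> through
      \<open>d\<close> is a derivative of the direct chart change, so \<open>uniq\<close>
      applies.\<close>
    fix d d' D assume d: "d \<in> charts_at M p" "d' \<in> charts_at M p"
      and "(cmap d' \<circ> cinv d has_derivative D) (at (cmap d p) within cmodel d)"
    then have "(cmap d' \<circ> cinv c has_derivative D \<circ> F d) (at (cmap c p) within cmodel c)"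
      using has_derivative_transition_compose[OF M c d(1) F[OF d(1)]] by blast
    with uniq[OF d(2) this] show "v d' = D (v d)" using d by (simp add: v_def)
  qed (simp add: v_def)
  moreover have "v c = \<xi>"
  proof -
    have "((\<lambda>x. x) has_derivative (\<lambda>x. x)) (at (cmap c p) within cmodel c)" by (rule has_derivative_ident)
    then have "(cmap c \<circ> cinv c has_derivative (\<lambda>x. x)) (at (cmap c p) within cmap c ` (cdom c \<inter> cdom c))"
      by (intro has_derivative_transform[OF _ _ has_derivative_ident])
        (use cD[OF c] in auto)
    then have "(cmap c \<circ> cinv c has_derivative (\<lambda>x. x)) (at (cmap c p) within cmodel c)"
      using is_chart_at_within[OF cD(1)[OF c] dmanifold_openin_cdom[OF M c] cD(2)[OF c] cD(2)[OF c]] by simp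
    from uniq[OF c this] show ?thesis using c by (simp add: v_def)
  qed
  ultimately show ?thesis by (rule that)
qed

lemma tangent_space_add:
  assumes M: "dmanifold M" and v: "v \<in> tangent_space M p" "w \<in> tangent_space M p"
  shows "v + w \<in> tangent_space M p"
proof (rule tangent_spaceI[OF M])
  fix c d D assume *: "c \<in> charts_at M p" "d \<in> charts_at M p"
    "(cmap d \<circ> cinv c has_derivative D) (at (cmap c p) within cmodel c)"
  then show "(v + w) d = D ((v + w) c)"
    using tangent_space_transition[OF M _ *] v linear_add[OF has_derivative_linear[OF *(3)]] by simp
next
  show "(v + w) c \<in> cmodel c" if "c \<in> charts_at M p" for c
    using that v tangent_space_cmodel charts_atD(1)[OF M] is_chart_subspace subspace_add
    by (metis plus_fun_apply)
next
  show "(v + w) c = 0" if "c \<notin> charts_at M p" for c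
    using tangent_space_outside[OF v(1) that] tangent_space_outside[OF v(2) that] by simp
qed

lemma tangent_space_scale:
  assumes M: "dmanifold M" and v: "v \<in> tangent_space M p"
  shows "r *\<^sub>R v \<in> tangent_space M p"
proof (rule tangent_spaceI[OF M])
  fix c d D assume *: "c \<in> charts_at M p" "d \<in> charts_at M p"
    "(cmap d \<circ> cinv c has_derivative D) (at (cmap c p) within cmodel c)"
  then show "(r *\<^sub>R v) d = D ((r *\<^sub>R v) c)"
    using tangent_space_transition[OF M _ *] v linear_scale[OF has_derivative_linear[OF *(3)]]
    by (simp add: scaleR_fun_def)
next
  show "(r *\<^sub>R v) c \<in> cmodel c" if "c \<in> charts_at M p" for c
    using that v tangent_space_cmodel charts_atD(1)[OF M] is_chart_subspace subspace_scale
    by (metis scaleR_fun_def)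
next
  show "(r *\<^sub>R v) c = 0" if "c \<notin> charts_at M p" for c
    using tangent_space_outside[OF v that] by (simp add: scaleR_fun_def)
qed

lemma tangent_space_diff:
  assumes "dmanifold M" "v \<in> tangent_space M p" "w \<in> tangent_space M p"
  shows "v - w \<in> tangent_space M p"
  using tangent_space_add[OF assms(1,2) tangent_space_scale[OF assms(1,3), of "-1"]] by simp

text \<open>\<open>tangent_map\<close> is defined with a chosen chart \<open>b\<close> at
  \<open>p\<close>. The chain rule for the change from \<open>b\<close> to \<open>c\<close>,
  together with the transformation law of \<open>v\<close>, replaces \<open>b\<close> by any chart
  \<open>c\<close>.\<close>

lemma tangent_map_apply:
  assumes M: "dmanifold M" and N: "dmanifold N" and f: "mdiff M N f"
    and c: "c \<in> charts_at M p" and d: "d \<in> charts_at N (f p)" and v: "v \<in> tangent_space M p"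
    and D: "(cmap d \<circ> f \<circ> cinv c has_derivative D) (at (cmap c p) within cmodel c)"
  shows "tangent_map M N f p v d = D (v c)"
proof -
  define b where "b = (SOME b. b \<in> charts_at M p)"
  have b: "b \<in> charts_at M p" unfolding b_def using c by (rule someI)
  note cD = charts_atD[OF M]
  obtain D' where D': "(cmap c \<circ> cinv b has_derivative D') (at (cmap b p) within cmodel b)"
    by (rule transition_derivative[OF M b c])
  have comp: "(cmap d \<circ> f \<circ> cinv b has_derivative D \<circ> D') (at (cmap b p) within cmodel b)"
    by (rule has_derivative_transition_compose[OF M b c D' D])
  have "openin (mtop M) {q \<in> cdom b. f q \<in> cdom d}"
    by (intro continuous_map_openin_vimage[OF mdiff_continuous[OF f]]
        dmanifold_openin_cdom[OF M b] dmanifold_openin_cdom[OF N d])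
  then have "frechet_derivative (cmap d \<circ> f \<circ> cinv b)
      (at (cmap b p) within cmap b ` (cdom b \<inter> {q \<in> cdom b. f q \<in> cdom d})) (v b) = (D \<circ> D') (v b)"
    by (rule frechet_derivative_chart[OF cD(1)[OF b] _ _ _ comp])
      (use b cD(2) charts_atD(2)[OF N d] tangent_space_cmodel[OF v b] in auto)
  moreover have "cdom b \<inter> {q \<in> cdom b. f q \<in> cdom d} = {q \<in> cdom b. f q \<in> cdom d}" by auto
  moreover have "v c = D' (v b)" by (rule tangent_space_transition[OF M v b c D'])
  ultimately show ?thesis
    using d unfolding tangent_map_def by (simp add: Let_def flip: b_def)
qed

lemma tangent_map_outside: "d \<notin> charts_at N (f p) \<Longrightarrow> tangent_map M N f p v d = 0"
  unfolding tangent_map_def by (simp add: Let_def)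

lemma tangent_map_in:
  assumes M: "dmanifold M" and N: "dmanifold N" and f: "mdiff M N f"
    and p: "p \<in> points M" and v: "v \<in> tangent_space M p"
  shows "tangent_map M N f p v \<in> tangent_space N (f p)"
proof (rule tangent_spaceI[OF N])
  obtain c where c: "c \<in> charts_at M p" by (rule charts_at_ex[OF M p])
  note cD = charts_atD[OF M c] and app = tangent_map_apply[OF M N f c _ v]
  fix d assume d: "d \<in> charts_at N (f p)"
  obtain D where D: "(cmap d \<circ> f \<circ> cinv c has_derivative D) (at (cmap c p) within cmodel c)"
    by (rule mdiff_derivative[OF f c d])
  show "tangent_map M N f p v d \<in> cmodel d"
    unfolding app[OF d D]
    by (rule has_derivative_chart_in[OF cD(1,2) charts_atD(1,2)[OF N d] mdiff_continuous[OF f] D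
          tangent_space_cmodel[OF v c]])
  fix d' D' assume d': "d' \<in> charts_at N (f p)"
    and D': "(cmap d' \<circ> cinv d has_derivative D') (at (cmap d (f p)) within cmodel d)"
  have "(cmap d' \<circ> f \<circ> cinv c has_derivative D' \<circ> D) (at (cmap c p) within cmodel c)"
    by (rule has_derivative_chart_compose[OF cD(1,2) charts_atD(1,2)[OF N d] mdiff_continuous[OF f] D D'])
  from app[OF d' this] app[OF d D] show "tangent_map M N f p v d' = D' (tangent_map M N f p v d)"
    by simp
qed (rule tangent_map_outside)

lemma tangent_map_add:
  assumes M: "dmanifold M" and N: "dmanifold N" and f: "mdiff M N f"
    and p: "p \<in> points M" and v: "v \<in> tangent_space M p" "w \<in> tangent_space M p"
  shows "tangent_map M N f p (v + w) = tangent_map M N f p v + tangent_map M N f p w"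
proof
  fix d
  obtain c where c: "c \<in> charts_at M p" by (rule charts_at_ex[OF M p])
  show "tangent_map M N f p (v + w) d = (tangent_map M N f p v + tangent_map M N f p w) d"
  proof (cases "d \<in> charts_at N (f p)")
    case True
    obtain D where D: "(cmap d \<circ> f \<circ> cinv c has_derivative D) (at (cmap c p) within cmodel c)"
      by (rule mdiff_derivative[OF f c True])
    show ?thesis
      using tangent_map_apply[OF M N f c True _ D] v tangent_space_add[OF M v]
        linear_add[OF has_derivative_linear[OF D]] by simp
  qed (simp add: tangent_map_outside)
qed

lemma tangent_map_scale:
  assumes M: "dmanifold M" and N: "dmanifold N" and f: "mdiff M N f"
    and p: "p \<in> points M" and v: "v \<in> tangent_space M p"
  shows "tangent_map M N f p (r *\<^sub>R v) = r *\<^sub>R tangent_map M N f p v"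
proof
  fix d
  obtain c where c: "c \<in> charts_at M p" by (rule charts_at_ex[OF M p])
  show "tangent_map M N f p (r *\<^sub>R v) d = (r *\<^sub>R tangent_map M N f p v) d"
  proof (cases "d \<in> charts_at N (f p)")
    case True
    obtain D where D: "(cmap d \<circ> f \<circ> cinv c has_derivative D) (at (cmap c p) within cmodel c)"
      by (rule mdiff_derivative[OF f c True])
    show ?thesis
      using tangent_map_apply[OF M N f c True _ D] v tangent_space_scale[OF M v]
        linear_scale[OF has_derivative_linear[OF D]] by (simp add: scaleR_fun_def)
  qed (simp add: tangent_map_outside scaleR_fun_def)
qed

lemma tangent_map_diff:
  assumes M: "dmanifold M" and N: "dmanifold N" and f: "mdiff M N f"
    and p: "p \<in> points M" and v: "v \<in> tangent_space M p" "w \<in> tangent_space M p"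
  shows "tangent_map M N f p (v - w) = tangent_map M N f p v - tangent_map M N f p w"
  using tangent_map_add[OF M N f p v(1) tangent_space_scale[OF M v(2), of "-1"]]
    tangent_map_scale[OF M N f p v(2), of "-1"] by simp

lemma mdiff_compose:
  assumes N: "dmanifold N" and M: "dmanifold M" and K: "dmanifold K" and f: "mdiff M N f" and g: "mdiff N K g"
  shows "mdiff M K (\<lambda>x. g (f x))"
  unfolding mdiff_def
proof (intro conjI ballI impI)
  show "continuous_map (mtop M) (mtop K) (\<lambda>x. g (f x))"
    using continuous_map_compose[OF mdiff_continuous[OF f] mdiff_continuous[OF g]] by (simp add: o_def)
  fix c e p assume "c \<in> atlas M" "e \<in> atlas K" "p \<in> cdom c" "g (f p) \<in> cdom e"
  then have c: "c \<in> charts_at M p" and e: "e \<in> charts_at K (g (f p))" by (auto simp: charts_at_def)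
  obtain d where d: "d \<in> charts_at N (f p)"
    using charts_at_ex[OF N mdiff_points[OF f]] charts_atD(4)[OF M c] by blast
  obtain D where D: "(cmap d \<circ> f \<circ> cinv c has_derivative D) (at (cmap c p) within cmodel c)"
    by (rule mdiff_derivative[OF f c d])
  obtain D' where D': "(cmap e \<circ> g \<circ> cinv d has_derivative D') (at (cmap d (f p)) within cmodel d)"
    by (rule mdiff_derivative[OF g d e])
  have "((cmap e \<circ> g) \<circ> f \<circ> cinv c has_derivative D' \<circ> D) (at (cmap c p) within cmodel c)"
    by (rule has_derivative_chart_compose[OF charts_atD(1,2)[OF M c] charts_atD(1,2)[OF N d]
          mdiff_continuous[OF f] D D'])
  then show "(cmap e \<circ> (\<lambda>x. g (f x)) \<circ> cinv c) differentiable (at (cmap c p) within cmodel c)"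
    by (auto simp: o_def intro: differentiableI)
qed

lemma tangent_map_compose:
  assumes N: "dmanifold N" and M: "dmanifold M" and K: "dmanifold K" and f: "mdiff M N f" and g: "mdiff N K g"
    and p: "p \<in> points M" and v: "v \<in> tangent_space M p"
  shows "tangent_map M K (\<lambda>x. g (f x)) p v = tangent_map N K g (f p) (tangent_map M N f p v)"
proof
  fix e
  obtain c where c: "c \<in> charts_at M p" by (rule charts_at_ex[OF M p])
  obtain d where d: "d \<in> charts_at N (f p)"
    using charts_at_ex[OF N mdiff_points[OF f p]] by blast
  show "tangent_map M K (\<lambda>x. g (f x)) p v e = tangent_map N K g (f p) (tangent_map M N f p v) e"
  proof (cases "e \<in> charts_at K (g (f p))")
    case e: True
    obtain D where D: "(cmap d \<circ> f \<circ> cinv c has_derivative D) (at (cmap c p) within cmodel c)"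
      by (rule mdiff_derivative[OF f c d])
    obtain D' where D': "(cmap e \<circ> g \<circ> cinv d has_derivative D') (at (cmap d (f p)) within cmodel d)"
      by (rule mdiff_derivative[OF g d e])
    have "((cmap e \<circ> g) \<circ> f \<circ> cinv c has_derivative D' \<circ> D) (at (cmap c p) within cmodel c)"
      by (rule has_derivative_chart_compose[OF charts_atD(1,2)[OF M c] charts_atD(1,2)[OF N d]
            mdiff_continuous[OF f] D D'])
    then have "(cmap e \<circ> (\<lambda>x. g (f x)) \<circ> cinv c has_derivative D' \<circ> D) (at (cmap c p) within cmodel c)"
      by (simp add: o_def)
    from tangent_map_apply[OF M K mdiff_compose[OF N M K f g] c e v this]
    show ?thesis
      using tangent_map_apply[OF M N f c d v D]
        tangent_map_apply[OF N K g d e tangent_map_in[OF M N f p v] D'] by simp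
  qed (simp add: tangent_map_outside)
qed

text \<open>The maps agree on \<open>points M\<close> only, but chart domains lie there. Hence both
  \<open>frechet_derivative\<close> terms choose from the same set of derivatives, and the choices
  coincide.\<close>

lemma tangent_map_cong:
  assumes M: "dmanifold M" and eq: "\<And>x. x \<in> points M \<Longrightarrow> f x = g x" and p: "p \<in> points M"
  shows "tangent_map M N f p v = tangent_map M N g p v"
proof -
  define c where "c = (SOME c. c \<in> charts_at M p)"
  have c: "c \<in> charts_at M p"
    unfolding c_def using charts_at_ex[OF M p] someI by metis
  note cD = charts_atD[OF M c]
  have sub: "cdom c \<subseteq> points M" using cD(1) openin_subset unfolding is_chart_def by blast
  have A: "{q \<in> cdom c. f q \<in> cdom d} = {q \<in> cdom c. g q \<in> cdom d}" for d using sub eq by auto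
  have "(F has_derivative D) (at (cmap c p) within cmap c ` {q \<in> cdom c. g q \<in> cdom d}) \<longleftrightarrow>
    (F' has_derivative D) (at (cmap c p) within cmap c ` {q \<in> cdom c. g q \<in> cdom d})"
    if "d \<in> charts_at N (g p)" "F = cmap d \<circ> f \<circ> cinv c" "F' = cmap d \<circ> g \<circ> cinv c" for d D F F'
  proof -
    have "cmap c p \<in> cmap c ` {q \<in> cdom c. g q \<in> cdom d}" using cD(2) that by (auto simp: charts_at_def)
    moreover have "F x = F' x" if "x \<in> cmap c ` {q \<in> cdom c. g q \<in> cdom d}" for x
      using that \<open>F = _\<close> \<open>F' = _\<close> cD(1) sub eq by auto
    ultimately show ?thesis
      using has_derivative_transform[of "cmap c p" _ F F'] has_derivative_transform[of "cmap c p" _ F' F]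
      by auto
  qed
  then have "frechet_derivative (cmap d \<circ> f \<circ> cinv c) (at (cmap c p) within cmap c ` {q \<in> cdom c. g q \<in> cdom d})
     = frechet_derivative (cmap d \<circ> g \<circ> cinv c) (at (cmap c p) within cmap c ` {q \<in> cdom c. g q \<in> cdom d})"
    if "d \<in> charts_at N (g p)" for d using that unfolding frechet_derivative_def by simp
  then show ?thesis
    unfolding tangent_map_def Let_def c_def[symmetric] A using eq[OF p] by auto
qed

lemma tangent_map_ident:
  assumes M: "dmanifold M" and p: "p \<in> points M" and v: "v \<in> tangent_space M p"
  shows "tangent_map M M (\<lambda>x. x) p v = v"
proof -
  obtain c where c: "c \<in> charts_at M p" by (rule charts_at_ex[OF M p])
  have idm: "mdiff M M (\<lambda>x. x)" using M unfolding dmanifold_def by blast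
  show ?thesis
  proof (rule tangent_space_eqI[OF M tangent_map_in[OF M M idm p v] v c])
    obtain D where D: "(cmap c \<circ> (\<lambda>x. x) \<circ> cinv c has_derivative D) (at (cmap c p) within cmodel c)"
      using mdiff_derivative[OF idm c] c by blast
    then have D': "(cmap c \<circ> cinv c has_derivative D) (at (cmap c p) within cmodel c)" by (simp add: o_def)
    show "tangent_map M M (\<lambda>x. x) p v c = v c"
      using tangent_map_apply[OF M M idm c c v D] tangent_space_transition[OF M v c c D'] by simp
  qed
qed

section \<open>From smoothness to first-order differentiability\<close>

lemma smooth_on_C_inf_on:
  "smooth_on M U N f \<Longrightarrow> c \<in> atlas M \<Longrightarrow> d \<in> atlas N \<Longrightarrow>
    C_inf_on (cmodel c) (cmap c ` {p \<in> cdom c \<inter> U. f p \<in> cdom d}) (cmap d \<circ> f \<circ> cinv c)"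
  unfolding smooth_on_def by blast

text \<open>Stated for atlases of charts rather than for \<open>manifold\<close>, so that it also
  applies to the action map on the fibre product, of which only \<open>dmanifold\<close> is
  proved.\<close>

lemma smooth_map_mdiff:
  assumes M: "\<And>c. c \<in> atlas M \<Longrightarrow> is_chart (mtop M) c" and N: "\<And>c. c \<in> atlas N \<Longrightarrow> is_chart (mtop N) c"
    and f: "smooth_map M N f"
  shows "mdiff M N f"
  unfolding mdiff_def
proof (intro conjI ballI impI)
  show cont: "continuous_map (mtop M) (mtop N) f"
    using f unfolding smooth_on_def by simp
  fix c d p assume *: "c \<in> atlas M" "d \<in> atlas N" "p \<in> cdom c" "f p \<in> cdom d"
  define U where "U = {q \<in> cdom c. f q \<in> cdom d}"
  have op: "openin (mtop M) (cdom c)" "openin (mtop N) (cdom d)"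
    using * M N unfolding is_chart_def by auto
  have U: "openin (mtop M) U"
    unfolding U_def by (rule continuous_map_openin_vimage[OF cont op])
  have "{p \<in> cdom c \<inter> points M. f p \<in> cdom d} = cdom c \<inter> U"
    using openin_subset[OF op(1)] by (auto simp: U_def)
  then have "C_inf_on (cmodel c) (cmap c ` (cdom c \<inter> U)) (cmap d \<circ> f \<circ> cinv c)"
    using smooth_on_C_inf_on[OF f *(1,2)] by simp
  then show "(cmap d \<circ> f \<circ> cinv c) differentiable (at (cmap c p) within cmodel c)"
    by (rule C_inf_on_differentiable[OF _ is_chart_openin[OF M[OF *(1)] U]]) (use * in \<open>auto simp: U_def\<close>)
qed

lemma compatible_charts_dmanifold:
  assumes ch: "\<And>c. c \<in> atlas M \<Longrightarrow> is_chart (mtop M) c" and cov: "(\<Union>c\<in>atlas M. cdom c) = points M"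
    and compat: "\<And>c d. c \<in> atlas M \<Longrightarrow> d \<in> atlas M \<Longrightarrow> compatible_charts c d"
  shows "dmanifold M"
proof -
  have "C_inf_on (cmodel c) (cmap c ` {p \<in> cdom c \<inter> points M. p \<in> cdom d}) (cmap d \<circ> cinv c)"
    if cd: "c \<in> atlas M" "d \<in> atlas M" for c d
  proof -
    have "openin (mtop M) (cdom c)" using ch[OF cd(1)] unfolding is_chart_def by blast
    then have "{p \<in> cdom c \<inter> points M. p \<in> cdom d} = cdom c \<inter> cdom d"
      using openin_subset by auto
    then show ?thesis
      using compat[OF cd] unfolding compatible_charts_def by simp
  qed
  then have "smooth_map M M (\<lambda>x. x)" unfolding smooth_on_def by (simp add: o_def)
  then show ?thesis
    using cov ch smooth_map_mdiff[of M M] unfolding dmanifold_def by blast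
qed

lemma manifold_dmanifold: "manifold M \<Longrightarrow> dmanifold M"
  by (rule compatible_charts_dmanifold) (auto simp: manifold_def)

lemma manifold_smooth_map_mdiff:
  "manifold M \<Longrightarrow> manifold N \<Longrightarrow> smooth_map M N f \<Longrightarrow> mdiff M N f"
  by (rule smooth_map_mdiff) (auto simp: manifold_def)

section \<open>Products and embedded submanifolds\<close>

abbreviation prod_chart :: "('a, 'e) chart \<Rightarrow> ('b, 'f) chart \<Rightarrow> ('a \<times> 'b, 'e \<times> 'f) chart" where
  "prod_chart c d \<equiv> \<lparr>cdom = cdom c \<times> cdom d, cmodel = cmodel c \<times> cmodel d,
                     cmap = map_prod (cmap c) (cmap d)\<rparr>"

lemma mtop_prod_mfd [simp]: "mtop (prod_mfd M N) = prod_topology (mtop M) (mtop N)"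
  by (simp add: prod_mfd_def)

lemma atlas_prod_mfd: "atlas (prod_mfd M N) = {prod_chart c d | c d. c \<in> atlas M \<and> d \<in> atlas N}"
  by (simp add: prod_mfd_def)

lemma charts_at_prod_mfd:
  "charts_at (prod_mfd M N) (p, q) = {prod_chart c d | c d. c \<in> charts_at M p \<and> d \<in> charts_at N q}"
  unfolding charts_at_def atlas_prod_mfd by fastforce

lemma is_chart_prod:
  assumes c: "is_chart T c" and d: "is_chart T' d"
  shows "is_chart (prod_topology T T') (prod_chart c d)"
proof -
  have im: "map_prod (cmap c) (cmap d) ` (cdom c \<times> cdom d) = cmap c ` cdom c \<times> cmap d ` cdom d"
    by (rule map_prod_surj_on) auto
  obtain f where f: "homeomorphic_maps (subtopology T (cdom c)) (top_of_set (cmap c ` cdom c)) (cmap c) f"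
    using c unfolding is_chart_def homeomorphic_map_maps by blast
  obtain g where g: "homeomorphic_maps (subtopology T' (cdom d)) (top_of_set (cmap d ` cdom d)) (cmap d) g"
    using d unfolding is_chart_def homeomorphic_map_maps by blast
  have "homeomorphic_maps (prod_topology (subtopology T (cdom c)) (subtopology T' (cdom d)))
      (prod_topology (top_of_set (cmap c ` cdom c)) (top_of_set (cmap d ` cdom d)))
      (\<lambda>(x, y). (cmap c x, cmap d y)) (\<lambda>(x, y). (f x, g y))"
    using f g iffD2[OF homeomorphic_maps_prod] by blast
  moreover have "(\<lambda>(x, y). (cmap c x, cmap d y)) = map_prod (cmap c) (cmap d)" by auto
  ultimately have "homeomorphic_map (subtopology (prod_topology T T') (cdom c \<times> cdom d))
      (top_of_set (cmap c ` cdom c \<times> cmap d ` cdom d)) (map_prod (cmap c) (cmap d))"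
    unfolding subtopology_Times homeomorphic_map_maps by auto
  then show ?thesis
    using c d unfolding is_chart_def by (simp add: im openin_prod_Times_iff subspace_Times openin_Times)
qed

lemma cinv_prod_chart:
  assumes "is_chart T c" "is_chart T' d" "x \<in> cmap c ` cdom c" "y \<in> cmap d ` cdom d"
  shows "cinv (prod_chart c d) (x, y) = (cinv c x, cinv d y)"
proof -
  obtain p q where "p \<in> cdom c" "x = cmap c p" "q \<in> cdom d" "y = cmap d q" using assms by auto
  then show ?thesis
    using cinv_cmap[OF is_chart_prod[OF assms(1,2)], of "(p, q)"] assms by simp
qed

lemma compatible_charts_sym: "compatible_charts c d \<longleftrightarrow> compatible_charts d c"
  unfolding compatible_charts_def by (metis Int_commute)

lemma C_inf_on_prod_transition:
  assumes c: "is_chart T c" "is_chart T' d" and c': "is_chart T c'" "is_chart T' d'"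
    and compat: "compatible_charts c c'" "compatible_charts d d'"
  shows "C_inf_on (cmodel c \<times> cmodel d)
    (map_prod (cmap c) (cmap d) ` ((cdom c \<times> cdom d) \<inter> (cdom c' \<times> cdom d')))
    (map_prod (cmap c') (cmap d') \<circ> cinv (prod_chart c d))"
proof -
  have "C_inf_on (cmodel c \<times> cmodel d) (cmap c ` (cdom c \<inter> cdom c') \<times> cmap d ` (cdom d \<inter> cdom d'))
      (map_prod (cmap c' \<circ> cinv c) (cmap d' \<circ> cinv d))"
    using assms is_chart_openin[OF c(1)] is_chart_openin[OF c(2)]
    by (intro C_inf_on_map_prod) (auto simp: is_chart_def compatible_charts_def)
  then have "C_inf_on (cmodel c \<times> cmodel d) (cmap c ` (cdom c \<inter> cdom c') \<times> cmap d ` (cdom d \<inter> cdom d'))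
      (map_prod (cmap c') (cmap d') \<circ> cinv (prod_chart c d))"
    by (rule C_inf_on_cong) (auto simp: cinv_prod_chart[OF c] c)
  then show ?thesis by (rule C_inf_on_subset) auto
qed

lemma compatible_prod_charts:
  assumes "is_chart T c" "is_chart T' d" "is_chart T c'" "is_chart T' d'"
    "compatible_charts c c'" "compatible_charts d d'"
  shows "compatible_charts (prod_chart c d) (prod_chart c' d')"
  using C_inf_on_prod_transition[OF assms]
    C_inf_on_prod_transition[OF assms(3,4,1,2)] assms(5,6)
  unfolding compatible_charts_def[of "prod_chart c d"] compatible_charts_sym[of c] compatible_charts_sym[of d]
  by (simp add: Int_commute)

lemma prod_mfd_charts:
  assumes M: "manifold M" and N: "manifold N"
  shows "\<And>c. c \<in> atlas (prod_mfd M N) \<Longrightarrow> is_chart (mtop (prod_mfd M N)) c"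
    "\<And>c d. c \<in> atlas (prod_mfd M N) \<Longrightarrow> d \<in> atlas (prod_mfd M N) \<Longrightarrow> compatible_charts c d"
proof -
  show "is_chart (mtop (prod_mfd M N)) c" if "c \<in> atlas (prod_mfd M N)" for c
    using that M N unfolding atlas_prod_mfd manifold_def by (auto intro: is_chart_prod)
  show "compatible_charts c d" if "c \<in> atlas (prod_mfd M N)" "d \<in> atlas (prod_mfd M N)" for c d
  proof -
    obtain a b a' b' where *: "c = prod_chart a b" "d = prod_chart a' b'"
      "a \<in> atlas M" "a' \<in> atlas M" "b \<in> atlas N" "b' \<in> atlas N"
      using \<open>c \<in> _\<close> \<open>d \<in> _\<close> unfolding atlas_prod_mfd by auto
    show ?thesis
      unfolding * by (rule compatible_prod_charts[of "mtop M" _ "mtop N"])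
        (use M N * in \<open>auto simp: manifold_def\<close>)
  qed
qed

lemma dmanifold_prod_mfd:
  assumes M: "manifold M" and N: "manifold N"
  shows "dmanifold (prod_mfd M N)"
proof (rule compatible_charts_dmanifold)
  have "(\<Union>c\<in>atlas (prod_mfd M N). cdom c) = (\<Union>c\<in>atlas M. cdom c) \<times> (\<Union>d\<in>atlas N. cdom d)"
    unfolding atlas_prod_mfd by fastforce
  then show "(\<Union>c\<in>atlas (prod_mfd M N). cdom c) = points (prod_mfd M N)"
    using M N unfolding manifold_def by simp
qed (rule prod_mfd_charts[OF M N]; assumption)+

text \<open>\<open>cinv\<close> of a product chart is the pair of inverses only on the image of the
  chart. Here \<open>f\<close> is a formula in coordinates valid everywhere, which is differentiated
  in place of the raw composite.\<close>

lemma has_derivative_prod_chart: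
  assumes c: "is_chart T c" "p \<in> cdom c" and d: "is_chart T' d" "q \<in> cdom d"
    and f: "\<And>x y. x \<in> cdom c \<Longrightarrow> y \<in> cdom d \<Longrightarrow> f (cmap c x, cmap d y) = F (x, y)"
    and D: "(f has_derivative D) (at (cmap c p, cmap d q) within cmodel c \<times> cmodel d)"
  shows "(F \<circ> cinv (prod_chart c d) has_derivative D)
    (at (cmap (prod_chart c d) (p, q)) within cmodel (prod_chart c d))"
proof -
  let ?A = "cmap (prod_chart c d) ` (cdom (prod_chart c d) \<inter> cdom (prod_chart c d))"
  note cd = is_chart_prod[OF c(1) d(1)]
  have A: "at (cmap (prod_chart c d) (p, q)) within ?A =
      at (cmap (prod_chart c d) (p, q)) within cmodel (prod_chart c d)"
    by (rule is_chart_at_within[OF cd]) (use cd c d in \<open>auto simp: is_chart_def\<close>)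
  show ?thesis
    unfolding A[symmetric]
  proof (rule has_derivative_transform)
    show "cmap (prod_chart c d) (p, q) \<in> ?A" using c d by auto
    show "(F \<circ> cinv (prod_chart c d)) x = f x" if "x \<in> ?A" for x
      using that f by (auto simp: cinv_prod_chart[OF c(1) d(1)] cinv_cmap[OF c(1)] cinv_cmap[OF d(1)])
    show "(f has_derivative D) (at (cmap (prod_chart c d) (p, q)) within ?A)"
      unfolding A using D by simp
  qed
qed

lemma has_derivative_fst_Times:
  assumes "(f has_derivative D) (at x within V)"
  shows "((\<lambda>z. f (fst z)) has_derivative (\<lambda>z. D (fst z))) (at (x, y) within V \<times> W)"
  by (rule has_derivative_in_compose[of fst fst])
    (use assms in \<open>auto intro: has_derivative_subset has_derivative_fst\<close>)

lemma has_derivative_snd_Times: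
  assumes "(f has_derivative D) (at y within W)"
  shows "((\<lambda>z. f (snd z)) has_derivative (\<lambda>z. D (snd z))) (at (x, y) within V \<times> W)"
  by (rule has_derivative_in_compose[of snd snd])
    (use assms in \<open>auto intro: has_derivative_subset has_derivative_snd\<close>)

lemma mdiff_fst:
  assumes M: "dmanifold M" and N: "dmanifold N"
  shows "mdiff (prod_mfd M N) M fst"
  unfolding mdiff_def
proof (intro conjI ballI impI)
  show "continuous_map (mtop (prod_mfd M N)) (mtop M) fst"
    by (simp add: continuous_map_fst)
  fix e b z assume *: "e \<in> atlas (prod_mfd M N)" "b \<in> atlas M" "z \<in> cdom e" "fst z \<in> cdom b"
  then obtain c d p q where e: "e = prod_chart c d" "z = (p, q)" "c \<in> charts_at M p" "d \<in> charts_at N q"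
    unfolding atlas_prod_mfd charts_at_def by auto
  have b: "b \<in> charts_at M p" using * e by (simp add: charts_at_def)
  obtain D where D: "(cmap b \<circ> cinv c has_derivative D) (at (cmap c p) within cmodel c)"
    by (rule transition_derivative[OF M e(3) b])
  have "((cmap b \<circ> fst) \<circ> cinv (prod_chart c d) has_derivative (\<lambda>z. D (fst z)))
      (at (cmap (prod_chart c d) (p, q)) within cmodel (prod_chart c d))"
    by (rule has_derivative_prod_chart[OF charts_atD(1,2)[OF M e(3)] charts_atD(1,2)[OF N e(4)] _
          has_derivative_fst_Times[OF D]]) (simp add: cinv_cmap[OF charts_atD(1)[OF M e(3)]])
  then show "(cmap b \<circ> fst \<circ> cinv e) differentiable (at (cmap e z) within cmodel e)"
    unfolding e by (rule differentiableI)
qed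

lemma mdiff_snd:
  assumes M: "dmanifold M" and N: "dmanifold N"
  shows "mdiff (prod_mfd M N) N snd"
  unfolding mdiff_def
proof (intro conjI ballI impI)
  show "continuous_map (mtop (prod_mfd M N)) (mtop N) snd"
    by (simp add: continuous_map_snd)
  fix e b z assume *: "e \<in> atlas (prod_mfd M N)" "b \<in> atlas N" "z \<in> cdom e" "snd z \<in> cdom b"
  then obtain c d p q where e: "e = prod_chart c d" "z = (p, q)" "c \<in> charts_at M p" "d \<in> charts_at N q"
    unfolding atlas_prod_mfd charts_at_def by auto
  have b: "b \<in> charts_at N q" using * e by (simp add: charts_at_def)
  obtain D where D: "(cmap b \<circ> cinv d has_derivative D) (at (cmap d q) within cmodel d)"
    by (rule transition_derivative[OF N e(4) b])
  have "((cmap b \<circ> snd) \<circ> cinv (prod_chart c d) has_derivative (\<lambda>z. D (snd z)))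
      (at (cmap (prod_chart c d) (p, q)) within cmodel (prod_chart c d))"
    by (rule has_derivative_prod_chart[OF charts_atD(1,2)[OF M e(3)] charts_atD(1,2)[OF N e(4)] _
          has_derivative_snd_Times[OF D]]) (simp add: cinv_cmap[OF charts_atD(1)[OF N e(4)]])
  then show "(cmap b \<circ> snd \<circ> cinv e) differentiable (at (cmap e z) within cmodel e)"
    unfolding e by (rule differentiableI)
qed

lemma mdiff_Pair:
  assumes f: "mdiff K M f" and g: "mdiff K N g"
  shows "mdiff K (prod_mfd M N) (\<lambda>x. (f x, g x))"
  unfolding mdiff_def
proof (intro conjI ballI impI)
  show "continuous_map (mtop K) (mtop (prod_mfd M N)) (\<lambda>x. (f x, g x))"
    using mdiff_continuous[OF f] mdiff_continuous[OF g] by (simp add: continuous_map_pairedI)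
  fix c e p assume *: "c \<in> atlas K" "e \<in> atlas (prod_mfd M N)" "p \<in> cdom c" "(f p, g p) \<in> cdom e"
  then obtain a b where e: "e = prod_chart a b" "a \<in> charts_at M (f p)" "b \<in> charts_at N (g p)"
    unfolding atlas_prod_mfd charts_at_def by auto
  have c: "c \<in> charts_at K p" using * by (simp add: charts_at_def)
  obtain D where D: "(cmap a \<circ> f \<circ> cinv c has_derivative D) (at (cmap c p) within cmodel c)"
    by (rule mdiff_derivative[OF f c e(2)])
  obtain D' where D': "(cmap b \<circ> g \<circ> cinv c has_derivative D') (at (cmap c p) within cmodel c)"
    by (rule mdiff_derivative[OF g c e(3)])
  have "cmap e \<circ> (\<lambda>x. (f x, g x)) \<circ> cinv c = (\<lambda>x. ((cmap a \<circ> f \<circ> cinv c) x, (cmap b \<circ> g \<circ> cinv c) x))"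
    by (auto simp: e)
  then show "(cmap e \<circ> (\<lambda>x. (f x, g x)) \<circ> cinv c) differentiable (at (cmap c p) within cmodel c)"
    using differentiableI[OF has_derivative_Pair[OF D D']] by simp
qed

lemma mdiff_const:
  assumes "a \<in> points N" shows "mdiff M N (\<lambda>x. a)"
  using assms unfolding mdiff_def by (auto simp: o_def)

lemma mdiff_ident: "dmanifold M \<Longrightarrow> mdiff M M (\<lambda>x. x)"
  unfolding dmanifold_def by blast

text \<open>In product coordinates the projections are the linear maps \<open>fst\<close> and
  \<open>snd\<close>, hence their own derivatives. This is the identification of the tangent space
  of a product with the product of the tangent spaces.\<close>

lemma tangent_map_fst_snd:
  assumes M: "manifold M" and N: "manifold N" and v: "v \<in> tangent_space (prod_mfd M N) (p, q)"
    and c: "c \<in> charts_at M p" and d: "d \<in> charts_at N q"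
  shows "v (prod_chart c d) =
    (tangent_map (prod_mfd M N) M fst (p, q) v c, tangent_map (prod_mfd M N) N snd (p, q) v d)"
proof -
  note M' = manifold_dmanifold[OF M] and N' = manifold_dmanifold[OF N]
  note P = dmanifold_prod_mfd[OF M N]
  have cd: "prod_chart c d \<in> charts_at (prod_mfd M N) (p, q)"
    using c d unfolding charts_at_prod_mfd by auto
  note chc = charts_atD(1,2)[OF M' c] and chd = charts_atD(1,2)[OF N' d]
  have "((cmap c \<circ> fst) \<circ> cinv (prod_chart c d) has_derivative fst)
      (at (cmap (prod_chart c d) (p, q)) within cmodel (prod_chart c d))"
    by (rule has_derivative_prod_chart[OF chc chd, of fst])
      (auto intro: has_derivative_fst)
  then have 1: "tangent_map (prod_mfd M N) M fst (p, q) v c = fst (v (prod_chart c d))"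
    by (intro tangent_map_apply[OF P M' mdiff_fst[OF M' N'] cd _ v]) (use c in auto)
  have "((cmap d \<circ> snd) \<circ> cinv (prod_chart c d) has_derivative snd)
      (at (cmap (prod_chart c d) (p, q)) within cmodel (prod_chart c d))"
    by (rule has_derivative_prod_chart[OF chc chd, of snd])
      (auto intro: has_derivative_snd)
  then have 2: "tangent_map (prod_mfd M N) N snd (p, q) v d = snd (v (prod_chart c d))"
    by (intro tangent_map_apply[OF P N' mdiff_snd[OF M' N'] cd _ v]) (use d in auto)
  from 1 2 show ?thesis by simp
qed

lemma tangent_space_prod_eqI:
  assumes M: "manifold M" and N: "manifold N"
    and v: "v \<in> tangent_space (prod_mfd M N) (p, q)" "w \<in> tangent_space (prod_mfd M N) (p, q)"
    and pq: "p \<in> points M" "q \<in> points N"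
    and eq: "tangent_map (prod_mfd M N) M fst (p, q) v = tangent_map (prod_mfd M N) M fst (p, q) w"
      "tangent_map (prod_mfd M N) N snd (p, q) v = tangent_map (prod_mfd M N) N snd (p, q) w"
  shows "v = w"
proof -
  obtain c where c: "c \<in> charts_at M p" by (rule charts_at_ex[OF manifold_dmanifold[OF M] pq(1)])
  obtain d where d: "d \<in> charts_at N q" by (rule charts_at_ex[OF manifold_dmanifold[OF N] pq(2)])
  have cd: "prod_chart c d \<in> charts_at (prod_mfd M N) (p, q)"
    using c d unfolding charts_at_prod_mfd by auto
  show ?thesis
    by (rule tangent_space_eqI[OF dmanifold_prod_mfd[OF M N] v cd])
      (simp only: tangent_map_fst_snd[OF M N v(1) c d] tangent_map_fst_snd[OF M N v(2) c d] eq)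
qed

text \<open>The pair of coordinates of \<open>u\<close> and \<open>w\<close> in a single product
  chart determines \<open>v\<close>; its two components are then recognized in that chart.\<close>

lemma tangent_space_prod_ex:
  assumes M: "manifold M" and N: "manifold N"
    and pq: "p \<in> points M" "q \<in> points N"
    and u: "u \<in> tangent_space M p" and w: "w \<in> tangent_space N q"
  obtains v where "v \<in> tangent_space (prod_mfd M N) (p, q)"
    "tangent_map (prod_mfd M N) M fst (p, q) v = u" "tangent_map (prod_mfd M N) N snd (p, q) v = w"
proof -
  note M' = manifold_dmanifold[OF M] and N' = manifold_dmanifold[OF N]
  note P = dmanifold_prod_mfd[OF M N]
  have pq': "(p, q) \<in> points (prod_mfd M N)" using pq by simp
  obtain c where c: "c \<in> charts_at M p" by (rule charts_at_ex[OF M' pq(1)])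
  obtain d where d: "d \<in> charts_at N q" by (rule charts_at_ex[OF N' pq(2)])
  have cd: "prod_chart c d \<in> charts_at (prod_mfd M N) (p, q)"
    using c d unfolding charts_at_prod_mfd by auto
  have "(u c, w d) \<in> cmodel (prod_chart c d)"
    using tangent_space_cmodel[OF u c] tangent_space_cmodel[OF w d] by simp
  then obtain v where v: "v \<in> tangent_space (prod_mfd M N) (p, q)" "v (prod_chart c d) = (u c, w d)"
    by (rule tangent_space_ex[OF P cd])
  note eq = tangent_map_fst_snd[OF M N v(1) c d, unfolded v(2)]
  show ?thesis
  proof (rule that[OF v(1)])
    show "tangent_map (prod_mfd M N) M fst (p, q) v = u"
      using tangent_map_in[OF P M' mdiff_fst[OF M' N'] pq' v(1)] eq
      by (intro tangent_space_eqI[OF M' _ u c]) auto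
    show "tangent_map (prod_mfd M N) N snd (p, q) v = w"
      using tangent_map_in[OF P N' mdiff_snd[OF M' N'] pq' v(1)] eq
      by (intro tangent_space_eqI[OF N' _ w d]) auto
  qed
qed

section \<open>Embedded submanifolds and their slice charts\<close>

definition slice_chart :: "('a, 'e::euclidean_space) mfd \<Rightarrow> 'a set \<Rightarrow> ('a, 'e) chart \<Rightarrow> 'e set \<Rightarrow> bool" where
  "slice_chart M S c W \<longleftrightarrow> c \<in> max_atlas M \<and> subspace W \<and> W \<subseteq> cmodel c \<and>
     cmap c ` (cdom c \<inter> S) = cmap c ` cdom c \<inter> W"

abbreviation restrict_chart :: "('a, 'e) chart \<Rightarrow> 'a set \<Rightarrow> 'e set \<Rightarrow> ('a, 'e) chart" where
  "restrict_chart c S W \<equiv> \<lparr>cdom = cdom c \<inter> S, cmodel = W, cmap = cmap c\<rparr>"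

lemma mtop_submfd [simp]: "mtop (submfd M S) = subtopology (mtop M) S"
  by (simp add: submfd_def)

lemma atlas_submfd: "atlas (submfd M S) = {restrict_chart c S W | c W. slice_chart M S c W}"
  by (simp add: submfd_def slice_chart_def)

lemma max_atlas_chart: "c \<in> max_atlas M \<Longrightarrow> is_chart (mtop M) c"
  by (simp add: max_atlas_def)

lemma cinv_restrict_chart:
  assumes "is_chart T c" "x \<in> cmap c ` (cdom c \<inter> S)"
  shows "cinv (restrict_chart c S W) x = cinv c x"
proof -
  have "inj_on (cmap c) (cdom c \<inter> S)" using is_chart_inj[OF assms(1)] inj_on_subset by blast
  then show ?thesis
    using assms is_chart_inj[OF assms(1)] by (auto simp: cinv_def inv_into_f_f)
qed

lemma compatible_charts_derivative:
  assumes c: "is_chart T c" "p \<in> cdom c" and d: "is_chart T d" "p \<in> cdom d"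
    and compat: "compatible_charts c d"
  obtains D where "(cmap d \<circ> cinv c has_derivative D) (at (cmap c p) within cmodel c)"
proof -
  have op: "openin T (cdom d)" using d by (simp add: is_chart_def)
  have "(cmap d \<circ> cinv c) differentiable (at (cmap c p) within cmodel c)"
    by (rule C_inf_on_differentiable[OF _ is_chart_openin[OF c(1) op]])
      (use compat c d in \<open>auto simp: compatible_charts_def\<close>)
  then show ?thesis using that unfolding differentiable_def by blast
qed

text \<open>The passage between a chart of the maximal atlas and an atlas chart, in which tangent
  vectors have their coordinates. The two derivatives are inverse on the models because both
  composites differentiate the identity.\<close>

lemma max_atlas_derivative:
  assumes M: "dmanifold M" and c: "c \<in> max_atlas M" "p \<in> cdom c" and e: "e \<in> charts_at M p"
  obtains D D' where "(cmap e \<circ> cinv c has_derivative D) (at (cmap c p) within cmodel c)"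
    "(cmap c \<circ> cinv e has_derivative D') (at (cmap e p) within cmodel e)"
    "\<And>x. x \<in> cmodel e \<Longrightarrow> D' x \<in> cmodel c"
    "\<And>x. x \<in> cmodel c \<Longrightarrow> D' (D x) = x"
    "\<And>x. x \<in> cmodel e \<Longrightarrow> D (D' x) = x"
proof -
  note chc = max_atlas_chart[OF c(1)] and che = charts_atD(1,2)[OF M e]
  have compat: "compatible_charts c e" "compatible_charts e c"
    using c(1) charts_atD(3)[OF M e] unfolding max_atlas_def compatible_charts_def
    by (auto simp: Int_commute)
  obtain D where D: "(cmap e \<circ> cinv c has_derivative D) (at (cmap c p) within cmodel c)"
    by (rule compatible_charts_derivative[OF chc c(2) che compat(1)])
  obtain D' where D': "(cmap c \<circ> cinv e has_derivative D') (at (cmap e p) within cmodel e)"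
    by (rule compatible_charts_derivative[OF che chc c(2) compat(2)])
  have id: "(cmap d \<circ> cinv d has_derivative (\<lambda>x. x)) (at (cmap d p) within cmodel d)"
    if d: "is_chart (mtop M) d" "p \<in> cdom d" for d :: "('a, 'b) chart"
  proof -
    have op: "openin (mtop M) (cdom d)" using d by (simp add: is_chart_def)
    have A: "at (cmap d p) within cmap d ` (cdom d \<inter> cdom d) = at (cmap d p) within cmodel d"
      by (rule is_chart_at_within[OF d(1) op d(2) d(2)])
    show ?thesis
      unfolding A[symmetric]
      by (intro has_derivative_transform[OF _ _ has_derivative_ident]) (use d in auto)
  qed
  have comp: "(cmap b \<circ> cinv a has_derivative F' \<circ> F) (at (cmap a p) within cmodel a)"
    if "is_chart (mtop M) a" "is_chart (mtop M) d" "p \<in> cdom a" "p \<in> cdom d"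
      "(cmap d \<circ> cinv a has_derivative F) (at (cmap a p) within cmodel a)"
      "(cmap b \<circ> cinv d has_derivative F') (at (cmap d p) within cmodel d)"
    for a b d :: "('a, 'b) chart" and F F'
    using has_derivative_chart_compose[OF that(1,3,2), of "\<lambda>x. x" F "cmap b" F'] that by (simp add: o_def)
  show ?thesis
  proof (rule that[OF D D'])
    show "D' x \<in> cmodel c" if "x \<in> cmodel e" for x
      using has_derivative_chart_in[OF che chc, of "\<lambda>x. x" D' x] c D' that by (simp add: o_def)
    show "D' (D x) = x" if "x \<in> cmodel c" for x
      using has_derivative_unique_subspace[OF is_chart_subspace[OF chc] is_chart_cmodel[OF chc c(2)] that
          comp[OF chc che(1) c(2) che(2) D D'] id[OF chc c(2)]] by simp
    show "D (D' x) = x" if "x \<in> cmodel e" for x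
      using has_derivative_unique_subspace[OF is_chart_subspace[OF che(1)] is_chart_cmodel[OF che] that
          comp[OF che(1) chc che(2) c(2) D' D] id[OF che]] by simp
  qed
qed

lemma is_chart_restrict:
  assumes S: "slice_chart M S c W" shows "is_chart (mtop (submfd M S)) (restrict_chart c S W)"
proof -
  have c: "is_chart (mtop M) c" using S unfolding slice_chart_def by (blast intro: max_atlas_chart)
  have op: "openin (mtop M) (cdom c)" using c by (simp add: is_chart_def)
  have im: "cmap c ` (cdom c \<inter> S) = cmap c ` cdom c \<inter> W" and W: "subspace W" "W \<subseteq> cmodel c"
    using S by (auto simp: slice_chart_def)
  have "openin (top_of_set (cmodel c)) (cmap c ` cdom c)" using c by (simp add: is_chart_def)
  then have imop: "openin (top_of_set W) (cmap c ` (cdom c \<inter> S))"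
    unfolding im using W(2) by (auto simp: openin_open)
  have "homeomorphic_map (subtopology (subtopology (mtop M) (cdom c)) S)
      (subtopology (top_of_set (cmap c ` cdom c)) W) (cmap c)"
    by (rule homeomorphic_map_subtopologies)
      (use c im openin_subset[OF op] in \<open>auto simp: is_chart_def Int_absorb1\<close>)
  then have "homeomorphic_map (subtopology (subtopology (mtop M) S) (cdom c \<inter> S))
      (top_of_set (cmap c ` (cdom c \<inter> S))) (cmap c)"
    unfolding im by (simp add: subtopology_subtopology Int_commute)
  moreover have "openin (subtopology (mtop M) S) (cdom c \<inter> S)"
    using op by (auto simp: openin_subtopology)
  ultimately show ?thesis using W imop unfolding is_chart_def by simp
qed

text \<open>A derivative within the ambient model is also one within the smaller subspace
  \<open>W\<close>, and the two inverse charts agree on the slice.\<close>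

lemma has_derivative_restrict_chart:
  assumes S: "slice_chart M S c W" and p: "p \<in> cdom c" "p \<in> S"
    and D: "(h \<circ> cinv c has_derivative D) (at (cmap c p) within cmodel c)"
  shows "(h \<circ> cinv (restrict_chart c S W) has_derivative D) (at (cmap c p) within W)"
proof -
  let ?r = "restrict_chart c S W"
  have c: "is_chart (mtop M) c" using S unfolding slice_chart_def by (blast intro: max_atlas_chart)
  note r = is_chart_restrict[OF S]
  have A: "at (cmap ?r p) within cmap ?r ` (cdom ?r \<inter> cdom ?r) = at (cmap ?r p) within cmodel ?r"
    by (rule is_chart_at_within[OF r]) (use r p in \<open>auto simp: is_chart_def\<close>)
  have "(h \<circ> cinv c has_derivative D) (at (cmap c p) within W)"
    by (rule has_derivative_subset[OF D]) (use S in \<open>simp add: slice_chart_def\<close>)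
  then have "(h \<circ> cinv c has_derivative D) (at (cmap c p) within cmap c ` (cdom c \<inter> S))"
    using A by simp
  then have "(h \<circ> cinv ?r has_derivative D) (at (cmap c p) within cmap c ` (cdom c \<inter> S))"
    by (rule has_derivative_transform[rotated 2]) (use p cinv_restrict_chart[OF c] in auto)
  then show ?thesis using A by simp
qed

text \<open>For an arbitrary subset the atlas of \<open>submfd\<close> need not cover it, as there
  may be no slice charts. The assumption \<open>slices\<close> expresses that \<open>S\<close> is
  embedded.\<close>

locale embedded =
  fixes M :: "('a, 'e::euclidean_space) mfd" and S :: "'a set"
  assumes M: "dmanifold M" and S: "S \<subseteq> points M"
    and slices: "\<And>p. p \<in> S \<Longrightarrow> \<exists>c W. slice_chart M S c W \<and> p \<in> cdom c"
begin

lemma points_submfd: "points (submfd M S) = S"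
  using S by auto

text \<open>Besides the underlying slice chart \<open>c\<close>, an ambient atlas chart
  \<open>e\<close> is provided, through which \<open>c\<close> is compared with other
  charts.\<close>

lemma chart_cases:
  assumes "r \<in> atlas (submfd M S)" "p \<in> cdom r"
  obtains c W e where "r = restrict_chart c S W" "slice_chart M S c W" "c \<in> max_atlas M"
    "p \<in> cdom c" "p \<in> S" "e \<in> charts_at M p"
proof -
  obtain c W where *: "r = restrict_chart c S W" "slice_chart M S c W"
    using assms(1) unfolding atlas_submfd by blast
  then have "p \<in> cdom c" "p \<in> S" using assms(2) by auto
  moreover obtain e where "e \<in> charts_at M p" using charts_at_ex[OF M] S \<open>p \<in> S\<close> by blast
  ultimately show ?thesis using that * by (simp add: slice_chart_def)
qed

lemma mdiff_inclusion: "mdiff (submfd M S) M (\<lambda>x. x)"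
  unfolding mdiff_def
proof (intro conjI ballI impI)
  show "continuous_map (mtop (submfd M S)) (mtop M) (\<lambda>x. x)"
    by (simp add: continuous_map_from_subtopology)
  fix r d p assume r: "r \<in> atlas (submfd M S)" "d \<in> atlas M" "p \<in> cdom r" "p \<in> cdom d"
  have d: "d \<in> charts_at M p" using r by (simp add: charts_at_def)
  from r(1,3) obtain c W e where c: "r = restrict_chart c S W" "slice_chart M S c W" "c \<in> max_atlas M"
    "p \<in> cdom c" "p \<in> S" "e \<in> charts_at M p" by (rule chart_cases)
  obtain D where "(cmap d \<circ> cinv c has_derivative D) (at (cmap c p) within cmodel c)"
    using max_atlas_derivative[OF M c(3,4) d] by metis
  from has_derivative_restrict_chart[OF c(2,4,5) this]
  show "(cmap d \<circ> (\<lambda>x. x) \<circ> cinv r) differentiable (at (cmap r p) within cmodel r)"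
    unfolding c(1) by (auto simp: o_def intro: differentiableI)
qed

lemma mdiff_into:
  assumes K: "dmanifold K" and f: "mdiff K M f" and img: "\<And>x. x \<in> points K \<Longrightarrow> f x \<in> S"
  shows "mdiff K (submfd M S) f"
  unfolding mdiff_def
proof (intro conjI ballI impI)
  show "continuous_map (mtop K) (mtop (submfd M S)) f"
    using mdiff_continuous[OF f] img by (auto simp: continuous_map_in_subtopology)
  fix b r p assume r: "b \<in> atlas K" "r \<in> atlas (submfd M S)" "p \<in> cdom b" "f p \<in> cdom r"
  have b: "b \<in> charts_at K p" using r by (simp add: charts_at_def)
  from r(2,4) obtain c W e where c: "r = restrict_chart c S W" "slice_chart M S c W" "c \<in> max_atlas M"
    "f p \<in> cdom c" "f p \<in> S" "e \<in> charts_at M (f p)" by (rule chart_cases)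
  obtain D where D: "(cmap e \<circ> f \<circ> cinv b has_derivative D) (at (cmap b p) within cmodel b)"
    by (rule mdiff_derivative[OF f b c(6)])
  obtain D' where D': "(cmap c \<circ> cinv e has_derivative D') (at (cmap e (f p)) within cmodel e)"
    using max_atlas_derivative[OF M c(3,4,6)] by metis
  from has_derivative_chart_compose[OF charts_atD(1,2)[OF K b] charts_atD(1,2)[OF M c(6)]
      mdiff_continuous[OF f] D D']
  show "(cmap r \<circ> f \<circ> cinv b) differentiable (at (cmap b p) within cmodel b)"
    unfolding c(1) by (auto intro: differentiableI)
qed

text \<open>Two slice charts are compatible with the atlas of \<open>M\<close>; the derivative of
  the change between them is composed from their changes to and from an atlas chart
  \<open>e\<close>.\<close>

lemma dmanifold_submfd: "dmanifold (submfd M S)"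
  unfolding dmanifold_def
proof (intro conjI ballI)
  show "is_chart (mtop (submfd M S)) r" if "r \<in> atlas (submfd M S)" for r
    using that is_chart_restrict unfolding atlas_submfd by blast
  show "(\<Union>c\<in>atlas (submfd M S). cdom c) = points (submfd M S)"
    unfolding points_submfd atlas_submfd using slices by fastforce
  show "mdiff (submfd M S) (submfd M S) (\<lambda>x. x)"
    unfolding mdiff_def
  proof (intro conjI ballI impI)
    fix r r' p assume r: "r \<in> atlas (submfd M S)" "r' \<in> atlas (submfd M S)" "p \<in> cdom r" "p \<in> cdom r'"
    from r(1,3) obtain c W e where c: "r = restrict_chart c S W" "slice_chart M S c W" "c \<in> max_atlas M"
      "p \<in> cdom c" "p \<in> S" "e \<in> charts_at M p" by (rule chart_cases)
    from r(2,4) obtain c' W' e' where c': "r' = restrict_chart c' S W'" "slice_chart M S c' W'"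
      "c' \<in> max_atlas M" "p \<in> cdom c'" "p \<in> S" "e' \<in> charts_at M p" by (rule chart_cases)
    obtain D where D: "(cmap e \<circ> cinv c has_derivative D) (at (cmap c p) within cmodel c)"
      using max_atlas_derivative[OF M c(3,4,6)] by metis
    obtain D' where D': "(cmap c' \<circ> cinv e has_derivative D') (at (cmap e p) within cmodel e)"
      using max_atlas_derivative[OF M c'(3,4) c(6)] by metis
    have "(cmap c' \<circ> (\<lambda>x. x) \<circ> cinv c has_derivative D' \<circ> D) (at (cmap c p) within cmodel c)"
      by (rule has_derivative_chart_compose[OF max_atlas_chart[OF c(3)] c(4) charts_atD(1)[OF M c(6)]])
        (use D D' charts_atD(2)[OF M c(6)] in \<open>auto simp: o_def\<close>)
    from has_derivative_restrict_chart[OF c(2,4,5) this]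
    show "(cmap r' \<circ> (\<lambda>x. x) \<circ> cinv r) differentiable (at (cmap r p) within cmodel r)"
      unfolding c(1) c'(1) by (auto simp: o_def intro: differentiableI)
  qed simp
qed

text \<open>The inclusion is represented by the restriction to \<open>W\<close> of the invertible
  derivative \<open>D\<close>, so \<open>D'\<close> recovers the slice coordinates from the
  image.\<close>

lemma tangent_map_inclusion_inj:
  assumes p: "p \<in> S" and v: "v \<in> tangent_space (submfd M S) p" "w \<in> tangent_space (submfd M S) p"
    and eq: "tangent_map (submfd M S) M (\<lambda>x. x) p v = tangent_map (submfd M S) M (\<lambda>x. x) p w"
  shows "v = w"
proof -
  have "p \<in> points (submfd M S)" using p points_submfd by simp
  then obtain r where r: "r \<in> charts_at (submfd M S) p" by (rule charts_at_ex[OF dmanifold_submfd])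
  then have "r \<in> atlas (submfd M S)" "p \<in> cdom r" by (auto simp: charts_at_def)
  then obtain c W e where c: "r = restrict_chart c S W" "slice_chart M S c W" "c \<in> max_atlas M"
      "p \<in> cdom c" "p \<in> S" "e \<in> charts_at M p" by (rule chart_cases)
  obtain D D' where D: "(cmap e \<circ> cinv c has_derivative D) (at (cmap c p) within cmodel c)"
    "\<And>x. x \<in> cmodel c \<Longrightarrow> D' (D x) = x"
    using max_atlas_derivative[OF M c(3,4,6)] by metis
  have D': "(cmap e \<circ> (\<lambda>x. x) \<circ> cinv r has_derivative D) (at (cmap r p) within cmodel r)"
    using has_derivative_restrict_chart[OF c(2,4,5) D(1)] c(1) by (simp add: o_def)
  have "D' (tangent_map (submfd M S) M (\<lambda>x. x) p x e) = x r" if x: "x \<in> tangent_space (submfd M S) p" for x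
  proof -
    have "x r \<in> cmodel c" using tangent_space_cmodel[OF x r] c(1,2) by (auto simp: slice_chart_def)
    then show ?thesis
      using tangent_map_apply[OF dmanifold_submfd M mdiff_inclusion r c(6) x D'] D(2) by simp
  qed
  with v eq have "v r = w r" by metis
  then show ?thesis by (rule tangent_space_eqI[OF dmanifold_submfd v r])
qed

text \<open>A tangent vector of \<open>M\<close> is tangent to \<open>S\<close> once its coordinates
  in a slice chart lie in \<open>W\<close>. These coordinates are computed with any derivative
  \<open>F\<close> of the change from \<open>e\<close> to \<open>c\<close>, since all agree on
  \<open>q e\<close>.\<close>

lemma tangent_map_inclusion_image:
  assumes p: "p \<in> S" and c: "slice_chart M S c W" "p \<in> cdom c" and e: "e \<in> charts_at M p"
    and q: "q \<in> tangent_space M p"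
    and F: "(cmap c \<circ> cinv e has_derivative F) (at (cmap e p) within cmodel e)" "F (q e) \<in> W"
  obtains v where "v \<in> tangent_space (submfd M S) p" "tangent_map (submfd M S) M (\<lambda>x. x) p v = q"
proof -
  have max: "c \<in> max_atlas M" using c by (simp add: slice_chart_def)
  obtain D D' where D: "(cmap e \<circ> cinv c has_derivative D) (at (cmap c p) within cmodel c)"
    "(cmap c \<circ> cinv e has_derivative D') (at (cmap e p) within cmodel e)"
    "\<And>x. x \<in> cmodel e \<Longrightarrow> D (D' x) = x"
    using max_atlas_derivative[OF M max c(2) e] by metis
  note che = charts_atD(1,2)[OF M e]
  have qe: "q e \<in> cmodel e" by (rule tangent_space_cmodel[OF q e])
  have "D' (q e) = F (q e)"
    using has_derivative_unique_subspace[OF is_chart_subspace[OF che(1)] is_chart_cmodel[OF che] qe D(2) F(1)] .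
  then have W: "D' (q e) \<in> W" using F(2) by simp
  let ?r = "restrict_chart c S W"
  have r: "?r \<in> charts_at (submfd M S) p"
    using c p unfolding charts_at_def atlas_submfd by auto
  from W obtain v where v: "v \<in> tangent_space (submfd M S) p" "v ?r = D' (q e)"
    using tangent_space_ex[OF dmanifold_submfd r] by auto
  have D'': "(cmap e \<circ> (\<lambda>x. x) \<circ> cinv ?r has_derivative D) (at (cmap ?r p) within cmodel ?r)"
    using has_derivative_restrict_chart[OF c p D(1)] by (simp add: o_def)
  have "tangent_map (submfd M S) M (\<lambda>x. x) p v e = q e"
    using tangent_map_apply[OF dmanifold_submfd M mdiff_inclusion r e v(1) D''] v(2) D(3)[OF qe] by simp
  then have "tangent_map (submfd M S) M (\<lambda>x. x) p v = q"
    using tangent_map_in[OF dmanifold_submfd M mdiff_inclusion _ v(1)] p points_submfd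
    by (intro tangent_space_eqI[OF M _ q e]) auto
  with v(1) show ?thesis by (rule that)
qed

end

section \<open>Slice charts of the fibre product with a principal bundle\<close>

text \<open>Following an atlas chart by a diffeomorphism \<open>\<tau>\<close> with smooth inverse
  \<open>\<sigma>\<close> gives a chart of the maximal atlas: the new chart changes are the old ones
  composed with \<open>\<sigma>\<close> or \<open>\<tau>\<close>. The new model \<open>V\<close> may
  be another subspace of the same type.\<close>

lemma max_atlas_compose:
  assumes ch: "\<And>c. c \<in> atlas M \<Longrightarrow> is_chart (mtop M) c"
    and compat: "\<And>c d. c \<in> atlas M \<Longrightarrow> d \<in> atlas M \<Longrightarrow> compatible_charts c d"
    and e: "e \<in> atlas M"
    and O1: "openin (top_of_set (cmodel e)) O1" "O1 \<subseteq> cmap e ` cdom e"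
    and V: "subspace V" and O2: "openin (top_of_set V) O2"
    and \<tau>: "\<And>x. x \<in> O1 \<Longrightarrow> \<tau> x \<in> O2" "\<And>x. x \<in> O1 \<Longrightarrow> \<sigma> (\<tau> x) = x" "C_inf_on (cmodel e) O1 \<tau>"
    and \<sigma>: "\<And>y. y \<in> O2 \<Longrightarrow> \<sigma> y \<in> O1" "\<And>y. y \<in> O2 \<Longrightarrow> \<tau> (\<sigma> y) = y" "C_inf_on V O2 \<sigma>"
  shows "\<lparr>cdom = {p \<in> cdom e. cmap e p \<in> O1}, cmodel = V, cmap = \<lambda>p. \<tau> (cmap e p)\<rparr> \<in> max_atlas M"
    (is "?c \<in> _")
proof -
  note che = ch[OF e]
  have hom: "homeomorphic_map (subtopology (mtop M) (cdom e)) (top_of_set (cmap e ` cdom e)) (cmap e)"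
    and ope: "openin (mtop M) (cdom e)" and sub: "subspace (cmodel e)"
    using che by (auto simp: is_chart_def)
  have top: "topspace (subtopology (mtop M) (cdom e)) = cdom e"
    using openin_subset[OF ope] by auto
  have "openin (top_of_set (cmap e ` cdom e)) O1"
    using O1 che unfolding is_chart_def by (meson openin_imp_subset openin_subset_trans)
  then have "openin (subtopology (mtop M) (cdom e)) {p \<in> topspace (subtopology (mtop M) (cdom e)). cmap e p \<in> O1}"
    by (rule openin_continuous_map_preimage[OF homeomorphic_imp_continuous_map[OF hom]])
  then have op: "openin (mtop M) (cdom ?c)"
    unfolding top using openin_trans_full[OF _ ope] by simp
  have img: "cmap e ` cdom ?c = O1" using O1(2) by auto
  have img': "cmap ?c ` cdom ?c = O2"
  proof
    show "cmap ?c ` cdom ?c \<subseteq> O2" using \<tau>(1) by auto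
    show "O2 \<subseteq> cmap ?c ` cdom ?c"
    proof
      fix y assume y: "y \<in> O2"
      have "\<sigma> y \<in> cmap e ` cdom ?c" unfolding img by (rule \<sigma>(1)[OF y])
      then obtain p where p: "\<sigma> y = cmap e p" "p \<in> cdom ?c" by (rule imageE)
      then have "y = cmap ?c p" using \<sigma>(2)[OF y] by simp
      then show "y \<in> cmap ?c ` cdom ?c" using p(2) by (rule image_eqI)
    qed
  qed
  have "homeomorphic_map (subtopology (subtopology (mtop M) (cdom e)) (cdom ?c))
      (subtopology (top_of_set (cmap e ` cdom e)) O1) (cmap e)"
    by (rule homeomorphic_map_subtopologies[OF hom]) (use O1(2) top in auto)
  moreover have "cdom e \<inter> cdom ?c = cdom ?c" "cmap e ` cdom e \<inter> O1 = O1" using O1(2) by auto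
  ultimately have 1: "homeomorphic_map (subtopology (mtop M) (cdom ?c)) (top_of_set O1) (cmap e)"
    by (simp only: subtopology_subtopology)
  have "homeomorphic_maps (top_of_set O1) (top_of_set O2) \<tau> \<sigma>"
    unfolding homeomorphic_maps_def
    using \<tau> \<sigma> by (auto simp: continuous_map_subtopology_eu intro!: C_inf_on_continuous)
  then have "homeomorphic_map (top_of_set O1) (top_of_set O2) \<tau>"
    unfolding homeomorphic_map_maps by blast
  with 1 have "homeomorphic_map (subtopology (mtop M) (cdom ?c)) (top_of_set O2) (\<tau> \<circ> cmap e)"
    by (rule homeomorphic_map_compose)
  then have "homeomorphic_map (subtopology (mtop M) (cdom ?c)) (top_of_set (cmap ?c ` cdom ?c)) (cmap ?c)"
    unfolding img' by (simp add: o_def)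
  then have chc: "is_chart (mtop M) ?c"
    using op V O2 img' unfolding is_chart_def by simp
  have "compatible_charts ?c d" if d: "d \<in> atlas M" for d
  proof -
    note chd = ch[OF d]
    have opd: "openin (mtop M) (cdom d)" using chd by (simp add: is_chart_def)
    have "C_inf_on V (cmap ?c ` (cdom ?c \<inter> cdom d)) (\<lambda>y. (cmap d \<circ> cinv e) (\<sigma> y))"
    proof (rule C_inf_on_compose[where f=\<sigma> and g="cmap d \<circ> cinv e", OF V _ sub])
      show "openin (top_of_set V) (cmap ?c ` (cdom ?c \<inter> cdom d))"
        using is_chart_openin[OF chc opd] by simp
      show "cmap e ` (cdom e \<inter> cdom d) \<subseteq> cmodel e" using is_chart_cmodel[OF che] by auto
      show "\<sigma> ` (cmap ?c ` (cdom ?c \<inter> cdom d)) \<subseteq> cmap e ` (cdom e \<inter> cdom d)"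
        using \<tau>(2) by auto
      show "C_inf_on V (cmap ?c ` (cdom ?c \<inter> cdom d)) \<sigma>"
        by (rule C_inf_on_subset[OF \<sigma>(3)]) (use img' in blast)
      show "C_inf_on (cmodel e) (cmap e ` (cdom e \<inter> cdom d)) (cmap d \<circ> cinv e)"
        using compat[OF e d] by (simp add: compatible_charts_def)
    qed
    then have "C_inf_on V (cmap ?c ` (cdom ?c \<inter> cdom d)) (cmap d \<circ> cinv ?c)"
    proof (rule C_inf_on_cong)
      fix y assume "y \<in> cmap ?c ` (cdom ?c \<inter> cdom d)"
      then obtain p where p: "p \<in> cdom ?c" "y = cmap ?c p" by blast
      then have "cinv ?c y = p" using cinv_cmap[OF chc] by blast
      then show "(cmap d \<circ> cinv e) (\<sigma> y) = (cmap d \<circ> cinv ?c) y"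
        using p \<tau>(2) cinv_cmap[OF che] by simp
    qed
    moreover have "C_inf_on (cmodel d) (cmap d ` (cdom ?c \<inter> cdom d)) (\<lambda>y. \<tau> ((cmap e \<circ> cinv d) y))"
    proof (rule C_inf_on_compose[OF is_chart_subspace[OF chd] _ sub _ _ _ \<tau>(3)])
      show "openin (top_of_set (cmodel d)) (cmap d ` (cdom ?c \<inter> cdom d))"
        using is_chart_openin[OF chd op] by (simp add: Int_commute)
      show "O1 \<subseteq> cmodel e" using O1(1) openin_imp_subset by blast
      show "(cmap e \<circ> cinv d) ` (cmap d ` (cdom ?c \<inter> cdom d)) \<subseteq> O1"
        using cinv_cmap[OF chd] by auto
      have "C_inf_on (cmodel d) (cmap d ` (cdom d \<inter> cdom e)) (cmap e \<circ> cinv d)"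
        using compat[OF d e] by (simp add: compatible_charts_def)
      then show "C_inf_on (cmodel d) (cmap d ` (cdom ?c \<inter> cdom d)) (cmap e \<circ> cinv d)"
        by (rule C_inf_on_subset) auto
    qed
    then have "C_inf_on (cmodel d) (cmap d ` (cdom ?c \<inter> cdom d)) (cmap ?c \<circ> cinv d)"
      by (simp add: o_def)
    ultimately show ?thesis unfolding compatible_charts_def by simp
  qed
  then show ?thesis using chc unfolding max_atlas_def by blast
qed

text \<open>\<open>J\<close> is the derivative of \<open>\<alpha>\<close> at
  \<open>\<beta> y\<close> and \<open>K\<close> that of \<open>\<beta>\<close> at \<open>y\<close>;
  the chain rule makes them inverse. The gain is a linear isomorphism between models that live in
  different Euclidean types.\<close>

lemma C_inf_diffeo_derivative:
  fixes \<beta> :: "'e::euclidean_space \<Rightarrow> 'f::euclidean_space"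
  assumes V: "subspace V2" "subspace V3" "openin (top_of_set V2) O2" "openin (top_of_set V3) O3"
    and \<beta>: "\<And>y. y \<in> O2 \<Longrightarrow> \<beta> y \<in> O3" "\<And>y. y \<in> O2 \<Longrightarrow> \<alpha> (\<beta> y) = y" "C_inf_on V2 O2 \<beta>"
    and \<alpha>: "\<And>t. t \<in> O3 \<Longrightarrow> \<alpha> t \<in> O2" "\<And>t. t \<in> O3 \<Longrightarrow> \<beta> (\<alpha> t) = t" "C_inf_on V3 O3 \<alpha>"
    and y: "y \<in> O2"
  obtains J K where "bounded_linear J" "bounded_linear K"
    "\<And>t. t \<in> V3 \<Longrightarrow> J t \<in> V2" "\<And>z. z \<in> V2 \<Longrightarrow> K z \<in> V3"
    "\<And>t. t \<in> V3 \<Longrightarrow> K (J t) = t" "\<And>z. z \<in> V2 \<Longrightarrow> J (K z) = z"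
proof -
  have \<beta>y: "\<beta> y \<in> O3" "\<alpha> (\<beta> y) = y" using \<beta> y by auto
  have sub: "O2 \<subseteq> V2" "O3 \<subseteq> V3" using V(3,4) openin_imp_subset by blast+
  note at2 = at_within_openin[OF V(3) y] and at3 = at_within_openin[OF V(4) \<beta>y(1)]
  obtain K where K: "(\<beta> has_derivative K) (at y within V2)"
    using C_inf_on_differentiable[OF \<beta>(3) V(3) y] unfolding differentiable_def by blast
  obtain J where J: "(\<alpha> has_derivative J) (at (\<beta> y) within V3)"
    using C_inf_on_differentiable[OF \<alpha>(3) V(4) \<beta>y(1)] unfolding differentiable_def by blast
  have "(\<alpha> \<circ> \<beta> has_derivative J \<circ> K) (at y within O2)"
    using diff_chain_within[of \<beta> K y O2 \<alpha> J] K has_derivative_subset[OF J, of "\<beta> ` O2"] sub \<beta>(1)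
    unfolding at2 by blast
  then have 1: "((\<lambda>x. x) has_derivative J \<circ> K) (at y within V2)"
    unfolding at2[symmetric] by (rule has_derivative_transform[OF y, rotated]) (simp add: \<beta>(2))
  have "(\<beta> has_derivative K) (at (\<alpha> (\<beta> y)) within \<alpha> ` O3)"
    using has_derivative_subset[OF K, of "\<alpha> ` O3"] sub \<alpha>(1) \<beta>y(2) by auto
  then have "(\<beta> \<circ> \<alpha> has_derivative K \<circ> J) (at (\<beta> y) within O3)"
    using diff_chain_within[of \<alpha> J "\<beta> y" O3 \<beta> K] J unfolding at3 by blast
  then have 2: "((\<lambda>x. x) has_derivative K \<circ> J) (at (\<beta> y) within V3)"
    unfolding at3[symmetric] by (rule has_derivative_transform[OF \<beta>y(1), rotated]) (simp add: \<alpha>(2))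
  show ?thesis
  proof (rule that)
    show "bounded_linear J" "bounded_linear K" using J K has_derivative_bounded_linear by blast+
    show "J t \<in> V2" if "t \<in> V3" for t
      by (rule has_derivative_in_subspace[OF V(2,4) \<beta>y(1) that V(1) _ J]) (use \<alpha>(1) sub in auto)
    show "K z \<in> V3" if "z \<in> V2" for z
      by (rule has_derivative_in_subspace[OF V(1,3) y that V(2) _ K]) (use \<beta>(1) sub in auto)
    show "K (J t) = t" if "t \<in> V3" for t
      using has_derivative_unique_subspace[OF V(2) _ that 2 has_derivative_ident] \<beta>y sub by auto
    show "J (K z) = z" if "z \<in> V2" for z
      using has_derivative_unique_subspace[OF V(1) _ that 1 has_derivative_ident] y sub by auto
  qed
qed

text \<open>The second coordinate \<open>\<beta> y\<close> is shifted by \<open>\<eta> x\<close> and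
  carried back to \<open>V2\<close> by \<open>J\<close>. The inverse is explicit: apply
  \<open>K\<close>, undo the shift, apply \<open>\<alpha>\<close>. The image \<open>O'\<close> is
  generally not a product, because the shift depends on \<open>x\<close>.\<close>

lemma C_inf_shear:
  fixes \<beta> :: "'e::euclidean_space \<Rightarrow> 'f::euclidean_space" and \<eta> :: "'h::euclidean_space \<Rightarrow> 'f"
  assumes V: "subspace V1" "subspace V2" "subspace V3"
    and op: "openin (top_of_set V1) O1" "openin (top_of_set V2) O2" "openin (top_of_set V3) O3"
    and \<beta>: "\<And>y. y \<in> O2 \<Longrightarrow> \<beta> y \<in> O3" "\<And>y. y \<in> O2 \<Longrightarrow> \<alpha> (\<beta> y) = y" "C_inf_on V2 O2 \<beta>"
    and \<alpha>: "\<And>t. t \<in> O3 \<Longrightarrow> \<alpha> t \<in> O2" "\<And>t. t \<in> O3 \<Longrightarrow> \<beta> (\<alpha> t) = t" "C_inf_on V3 O3 \<alpha>"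
    and \<eta>: "\<And>x. x \<in> O1 \<Longrightarrow> \<eta> x \<in> V3" "C_inf_on V1 O1 \<eta>"
    and JK: "bounded_linear J" "bounded_linear K"
      "\<And>t. t \<in> V3 \<Longrightarrow> J t \<in> V2" "\<And>z. z \<in> V2 \<Longrightarrow> K z \<in> V3"
      "\<And>t. t \<in> V3 \<Longrightarrow> K (J t) = t" "\<And>z. z \<in> V2 \<Longrightarrow> J (K z) = z"
  defines "\<tau> \<equiv> \<lambda>z. (fst z, J (\<beta> (snd z) - \<eta> (fst z)))"
    and "\<sigma> \<equiv> \<lambda>z. (fst z, \<alpha> (K (snd z) + \<eta> (fst z)))"
    and "O' \<equiv> {z \<in> O1 \<times> V2. K (snd z) + \<eta> (fst z) \<in> O3}"
  shows "openin (top_of_set (V1 \<times> V2)) O'"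
    and "\<And>z. z \<in> O1 \<times> O2 \<Longrightarrow> \<tau> z \<in> O'" "\<And>z. z \<in> O1 \<times> O2 \<Longrightarrow> \<sigma> (\<tau> z) = z"
      "C_inf_on (V1 \<times> V2) (O1 \<times> O2) \<tau>"
    and "\<And>z. z \<in> O' \<Longrightarrow> \<sigma> z \<in> O1 \<times> O2" "\<And>z. z \<in> O' \<Longrightarrow> \<tau> (\<sigma> z) = z" "C_inf_on (V1 \<times> V2) O' \<sigma>"
proof -
  have sub: "O1 \<subseteq> V1" "O2 \<subseteq> V2" "O3 \<subseteq> V3" using op openin_imp_subset by blast+
  have V12: "subspace (V1 \<times> V2)" using V by (simp add: subspace_Times)
  have KJ: "K (J (\<beta> y - \<eta> x)) = \<beta> y - \<eta> x" "J (\<beta> y - \<eta> x) \<in> V2" if "y \<in> O2" "x \<in> O1" for x y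
  proof -
    have "\<beta> y - \<eta> x \<in> V3" using \<beta>(1)[OF that(1)] \<eta>(1)[OF that(2)] sub V(3) subspace_diff by blast
    then show "K (J (\<beta> y - \<eta> x)) = \<beta> y - \<eta> x" "J (\<beta> y - \<eta> x) \<in> V2" using JK by auto
  qed
  have op1: "openin (top_of_set (V1 \<times> V2)) (O1 \<times> V2)" by (rule openin_Times[OF op(1)]) simp
  have \<eta>1: "C_inf_on (V1 \<times> V2) (O1 \<times> V2) (\<lambda>z. \<eta> (fst z))"
    by (rule C_inf_on_compose[OF V12 op1 V(1) sub(1) _ C_inf_on_linear[OF bounded_linear_fst] \<eta>(2)]) auto
  have K1: "C_inf_on (V1 \<times> V2) (O1 \<times> V2) (\<lambda>z. K (snd z) + \<eta> (fst z))"
    by (intro C_inf_on_add \<eta>1 C_inf_on_linear bounded_linear_compose[OF JK(2) bounded_linear_snd])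
  have K1V: "K (snd z) + \<eta> (fst z) \<in> V3" if "z \<in> O1 \<times> V2" for z
    using that JK(4) \<eta>(1) V(3) subspace_add by (metis mem_Times_iff)
  have "openin (top_of_set (O1 \<times> V2)) ((O1 \<times> V2) \<inter> (\<lambda>z. K (snd z) + \<eta> (fst z)) -` O3)"
    by (rule continuous_openin_preimage[OF C_inf_on_continuous[OF K1] _ op(3)]) (use K1V in blast)
  moreover have "(O1 \<times> V2) \<inter> (\<lambda>z. K (snd z) + \<eta> (fst z)) -` O3 = O'" by (auto simp: O'_def)
  ultimately show op': "openin (top_of_set (V1 \<times> V2)) O'" using op1 openin_trans by metis
  show "\<tau> z \<in> O'" if "z \<in> O1 \<times> O2" for z
    using that KJ \<beta>(1) by (auto simp: \<tau>_def O'_def)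
  show "\<sigma> (\<tau> z) = z" if "z \<in> O1 \<times> O2" for z
    using that KJ \<beta>(2) by (auto simp: \<tau>_def \<sigma>_def)
  have op12: "openin (top_of_set (V1 \<times> V2)) (O1 \<times> O2)" by (rule openin_Times[OF op(1,2)])
  have "C_inf_on (V1 \<times> V2) (O1 \<times> O2) (\<lambda>z. \<beta> (snd z))"
    by (rule C_inf_on_compose[OF V12 op12 V(2) sub(2) _ C_inf_on_linear[OF bounded_linear_snd] \<beta>(3)]) auto
  moreover have "C_inf_on (V1 \<times> V2) (O1 \<times> O2) (\<lambda>z. \<eta> (fst z))"
    by (rule C_inf_on_subset[OF \<eta>1]) (use sub in auto)
  ultimately show "C_inf_on (V1 \<times> V2) (O1 \<times> O2) \<tau>"
    unfolding \<tau>_def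
    by (intro C_inf_on_Pair C_inf_on_linear[OF bounded_linear_fst] C_inf_on_linear_compose[OF JK(1)] C_inf_on_diff)
  show "\<sigma> z \<in> O1 \<times> O2" if "z \<in> O'" for z
    using that \<alpha>(1) by (auto simp: \<sigma>_def O'_def)
  show "\<tau> (\<sigma> z) = z" if "z \<in> O'" for z
    using that \<alpha>(2) JK(6) by (auto simp: \<sigma>_def \<tau>_def O'_def)
  have "C_inf_on (V1 \<times> V2) O' (\<lambda>z. \<alpha> (K (snd z) + \<eta> (fst z)))"
    by (rule C_inf_on_compose[OF V12 op' V(3) sub(3) _ C_inf_on_subset[OF K1] \<alpha>(3)]) (auto simp: O'_def)
  then show "C_inf_on (V1 \<times> V2) O' \<sigma>"
    unfolding \<sigma>_def by (intro C_inf_on_Pair C_inf_on_linear[OF bounded_linear_fst])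
qed

lemma openin_smooth_on_vimage:
  assumes f: "smooth_on M U N f" and A: "openin (mtop M) A" and B: "openin (mtop N) B"
  shows "openin (mtop M) {q \<in> A \<inter> U. f q \<in> B}"
proof -
  have U: "openin (mtop M) U" and cont: "continuous_map (subtopology (mtop M) U) (mtop N) f"
    using f unfolding smooth_on_def by auto
  have "openin (subtopology (mtop M) U) (A \<inter> U)" using A by (auto simp: openin_subtopology)
  from continuous_map_openin_vimage[OF cont this B] show ?thesis
    using openin_trans_full U by blast
qed

lemma principal_bundle_trivialization:
  assumes E: "principal_bundle G M E" and x: "x \<in> points M"
  obtains U \<psi> \<psi>' where "openin (mtop M) U" "x \<in> U"
    "smooth_on (prod_mfd M (gmfd G)) (U \<times> carrier G) (total E) \<psi>"
    "smooth_on (total E) {a \<in> points (total E). proj E a \<in> U} (prod_mfd M (gmfd G)) \<psi>'"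
    "\<And>y g. y \<in> U \<Longrightarrow> g \<in> carrier G \<Longrightarrow> \<psi>' (\<psi> (y, g)) = (y, g)"
    "\<And>a. a \<in> points (total E) \<Longrightarrow> proj E a \<in> U \<Longrightarrow> \<psi>' a \<in> U \<times> carrier G \<and> \<psi> (\<psi>' a) = a"
    "\<And>y g. y \<in> U \<Longrightarrow> g \<in> carrier G \<Longrightarrow> proj E (\<psi> (y, g)) = y"
    "\<And>y g h. y \<in> U \<Longrightarrow> g \<in> carrier G \<Longrightarrow> h \<in> carrier G \<Longrightarrow>
      ract E (\<psi> (y, g), h) = \<psi> (y, g \<otimes>\<^bsub>G\<^esub> h)"
proof -
  have "\<forall>x\<in>points M. \<exists>U \<psi> \<psi>'.
        openin (mtop M) U \<and> x \<in> U \<and>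
        smooth_on (prod_mfd M (gmfd G)) (U \<times> carrier G) (total E) \<psi> \<and>
        smooth_on (total E) {a \<in> points (total E). proj E a \<in> U} (prod_mfd M (gmfd G)) \<psi>' \<and>
        (\<forall>y\<in>U. \<forall>g\<in>carrier G. \<psi>' (\<psi> (y, g)) = (y, g)) \<and>
        (\<forall>a\<in>points (total E). proj E a \<in> U \<longrightarrow> \<psi>' a \<in> U \<times> carrier G \<and> \<psi> (\<psi>' a) = a) \<and>
        (\<forall>y\<in>U. \<forall>g\<in>carrier G. proj E (\<psi> (y, g)) = y \<and>
           (\<forall>h\<in>carrier G. ract E (\<psi> (y, g), h) = \<psi> (y, g \<otimes>\<^bsub>G\<^esub> h)))"
    using E unfolding principal_bundle_def by (elim conjE)
  from bspec[OF this x] show ?thesis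
    by (elim exE conjE) (rule that, (assumption | blast)+)
qed

text \<open>
  A local trivialization turns the defining equation \<open>s x = proj E z\<close> of the fibre product into the
  vanishing of a coordinate difference.  Transporting the coordinates of the trivialization to the
  model space of the total space by a derivative keeps the chart in the prescribed model type, and
  replaces the inverse function theorem by an explicit shear.
\<close>

lemma principal_bundle_slice_chart:
  fixes Y :: "('y, 'f::euclidean_space) mfd" and M :: "('x, 'e::euclidean_space) mfd"
    and E :: "('p, 'q::euclidean_space, 'x, 'g) pbundle" and G :: "('g, 'k::euclidean_space) lie_grp"
  assumes Y: "manifold Y" and M: "manifold M" and G: "lie_group G" and E: "principal_bundle G M E"
    and s: "smooth_map Y M s"
    and pts: "y \<in> points Y" "a \<in> points (total E)" "s y = proj E a"
  obtains c W b L where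
    "slice_chart (prod_mfd Y (total E)) {(x, z). x \<in> points Y \<and> z \<in> points (total E) \<and> s x = proj E z} c W"
    "(y, a) \<in> cdom c" "b \<in> charts_at M (s y)" "bounded_linear L" "W = {\<xi> \<in> cmodel c. L \<xi> = 0}"
    "\<And>x z. (x, z) \<in> cdom c \<Longrightarrow>
      s x \<in> cdom b \<and> proj E z \<in> cdom b \<and> L (cmap c (x, z)) = cmap b (proj E z) - cmap b (s x)"
proof -
  define P where "P = total E"
  have P: "manifold P" and G': "manifold (gmfd G)" "points (gmfd G) = carrier G"
    using E G by (auto simp: principal_bundle_def lie_group_def P_def)
  have \<pi>: "smooth_map P M (proj E)" using E by (auto simp: principal_bundle_def P_def)
  note dY = manifold_dmanifold[OF Y] and dM = manifold_dmanifold[OF M] and dP = manifold_dmanifold[OF P]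
    and dG = manifold_dmanifold[OF G'(1)]
  define Q where "Q = prod_mfd M (gmfd G)"
  have dQ: "dmanifold Q" unfolding Q_def by (rule dmanifold_prod_mfd[OF M G'(1)])
  have "s y \<in> points M" using mdiff_points[OF manifold_smooth_map_mdiff[OF Y M s] pts(1)] .
  from E this obtain U \<psi> \<psi>' where U: "openin (mtop M) U" "s y \<in> U"
    and \<psi>: "smooth_on Q (U \<times> carrier G) P \<psi>"
    and \<psi>': "smooth_on P {a \<in> points P. proj E a \<in> U} Q \<psi>'"
    and inv1: "\<And>y g. y \<in> U \<Longrightarrow> g \<in> carrier G \<Longrightarrow> \<psi>' (\<psi> (y, g)) = (y, g)"
    and inv2: "\<And>a. a \<in> points P \<Longrightarrow> proj E a \<in> U \<Longrightarrow> \<psi>' a \<in> U \<times> carrier G \<and> \<psi> (\<psi>' a) = a"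
    and pr: "\<And>y g. y \<in> U \<Longrightarrow> g \<in> carrier G \<Longrightarrow> proj E (\<psi> (y, g)) = y"
    unfolding Q_def P_def by (rule principal_bundle_trivialization) blast
  define EU where "EU = {a \<in> points P. proj E a \<in> U}"
  have aEU: "a \<in> EU" using pts U by (simp add: EU_def P_def)
  \<comment> \<open>The base component of the trivialization is the bundle projection; this is how
    the condition \<open>s x = proj E z\<close> becomes visible in coordinates.\<close>
  have fst\<psi>': "fst (\<psi>' z) = proj E z" if "z \<in> EU" for z
    using that inv2[of z] pr[of "fst (\<psi>' z)" "snd (\<psi>' z)"] by (auto simp: EU_def mem_Times_iff)
  obtain c1 where c1: "c1 \<in> charts_at Y y" by (rule charts_at_ex[OF dY pts(1)])
  obtain d where d: "d \<in> charts_at P a" using charts_at_ex[OF dP] pts(2) P_def by blast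
  obtain b where b: "b \<in> charts_at M (s y)" by (rule charts_at_ex[OF dM \<open>s y \<in> points M\<close>])
  have "snd (\<psi>' a) \<in> points (gmfd G)" using inv2[of a] aEU G'(2) by (auto simp: EU_def mem_Times_iff)
  then obtain k where k: "k \<in> charts_at (gmfd G) (snd (\<psi>' a))" by (rule charts_at_ex[OF dG])
  \<comment> \<open>The factor \<open>b\<close> is a chart at \<open>s y = proj E a\<close>, so the
    same chart measures \<open>s x\<close> and \<open>proj E z\<close>.\<close>
  define t where "t = prod_chart b k"
  have "\<psi>' a = (s y, snd (\<psi>' a))" using fst\<psi>'[OF aEU] pts(3) by (simp add: prod_eq_iff)
  moreover have "t \<in> charts_at Q (s y, snd (\<psi>' a))"
    unfolding t_def Q_def charts_at_prod_mfd using b k by blast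
  ultimately have tQ: "t \<in> charts_at Q (\<psi>' a)" by metis
  note chc1 = charts_atD(1,2,3)[OF dY c1] and chd = charts_atD(1,2,3)[OF dP d]
    and chb = charts_atD(1,2,3)[OF dM b] and cht = charts_atD(1,2,3)[OF dQ tQ] and chk = charts_atD(1,2,3)[OF dG k]
  have op: "openin (mtop Y) (cdom c1)" "openin (mtop P) (cdom d)" "openin (mtop M) (cdom b)" "openin (mtop Q) (cdom t)"
    using chc1 chd chb cht by (auto simp: is_chart_def)
  have smt: "cmodel t = cmodel b \<times> cmodel k" "cmap t = map_prod (cmap b) (cmap k)" "cdom t = cdom b \<times> cdom k"
    by (auto simp: t_def)
  define U1 where "U1 = {x \<in> cdom c1 \<inter> points Y. s x \<in> cdom b}"
  define U2 where "U2 = {z \<in> cdom d \<inter> EU. \<psi>' z \<in> cdom t}"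
  define U3 where "U3 = {q \<in> cdom t \<inter> (U \<times> carrier G). \<psi> q \<in> cdom d}"
  have opU: "openin (mtop Y) U1" "openin (mtop P) U2" "openin (mtop Q) U3"
    unfolding U1_def U2_def U3_def EU_def
    by (rule openin_smooth_on_vimage[OF s op(1,3)] openin_smooth_on_vimage[OF \<psi>' op(2,4)]
        openin_smooth_on_vimage[OF \<psi> op(4,2)])+
  define O1 where "O1 = cmap c1 ` U1"
  define O2 where "O2 = cmap d ` U2"
  define O3 where "O3 = cmap t ` U3"
  have U_sub: "cdom c1 \<inter> U1 = U1" "cdom d \<inter> U2 = U2" "cdom t \<inter> U3 = U3"
    by (auto simp: U1_def U2_def U3_def)
  have opO: "openin (top_of_set (cmodel c1)) O1" "openin (top_of_set (cmodel d)) O2"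
    "openin (top_of_set (cmodel t)) O3"
    using is_chart_openin[OF chc1(1) opU(1)] is_chart_openin[OF chd(1) opU(2)] is_chart_openin[OF cht(1) opU(3)]
    by (simp_all add: U_sub O1_def O2_def O3_def)
  \<comment> \<open>Only the base coordinates are to be compared, so \<open>s\<close> is padded by 0
    in the group coordinates, which the shear then leaves unshifted.\<close>
  define \<eta> :: "'f \<Rightarrow> 'e \<times> 'k" where "\<eta> x = ((cmap b \<circ> s \<circ> cinv c1) x, 0)" for x
  define \<beta> where "\<beta> = cmap t \<circ> \<psi>' \<circ> cinv d"
  define \<alpha> where "\<alpha> = cmap d \<circ> \<psi> \<circ> cinv t"
  have \<eta>: "C_inf_on (cmodel c1) O1 \<eta>"
    unfolding \<eta>_def O1_def U1_def
    by (intro C_inf_on_Pair smooth_on_C_inf_on[OF s chc1(3) chb(3)] C_inf_on_linear bounded_linear_zero)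
  have \<beta>: "C_inf_on (cmodel d) O2 \<beta>"
    unfolding \<beta>_def O2_def U2_def EU_def by (rule smooth_on_C_inf_on[OF \<psi>' chd(3) cht(3)])
  have \<alpha>: "C_inf_on (cmodel t) O3 \<alpha>"
    unfolding \<alpha>_def O3_def U3_def by (rule smooth_on_C_inf_on[OF \<psi> cht(3) chd(3)])
  have \<eta>_eq: "\<eta> (cmap c1 x) = (cmap b (s x), 0)" if "x \<in> U1" for x
    using that cinv_cmap[OF chc1(1)] by (auto simp: \<eta>_def U1_def)
  have \<beta>_eq: "\<beta> (cmap d z) = cmap t (\<psi>' z)" if "z \<in> U2" for z
    using that cinv_cmap[OF chd(1)] by (auto simp: \<beta>_def U2_def)
  have \<alpha>_eq: "\<alpha> (cmap t q) = cmap d (\<psi> q)" if "q \<in> U3" for q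
    using that cinv_cmap[OF cht(1)] by (auto simp: \<alpha>_def U3_def)
  have U23: "\<psi>' z \<in> U3 \<and> \<psi> (\<psi>' z) = z" if "z \<in> U2" for z
    using that inv2[of z] by (auto simp: U2_def U3_def EU_def)
  have U32: "\<psi> q \<in> U2 \<and> \<psi>' (\<psi> q) = q" if q: "q \<in> U3" for q
  proof -
    have "\<psi> q \<in> points P" using q openin_subset[OF op(2)] by (auto simp: U3_def)
    then show ?thesis
      using q inv1[of "fst q" "snd q"] pr[of "fst q" "snd q"] by (auto simp: U2_def U3_def EU_def mem_Times_iff)
  qed
  have \<beta>\<alpha>: "\<And>y. y \<in> O2 \<Longrightarrow> \<beta> y \<in> O3" "\<And>y. y \<in> O2 \<Longrightarrow> \<alpha> (\<beta> y) = y"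
      "\<And>t. t \<in> O3 \<Longrightarrow> \<alpha> t \<in> O2" "\<And>t. t \<in> O3 \<Longrightarrow> \<beta> (\<alpha> t) = t"
    using U23 U32 by (auto simp: O2_def O3_def \<alpha>_eq \<beta>_eq)
  have a2: "a \<in> U2" using charts_atD(2)[OF dQ tQ] chd(2) aEU by (simp add: U2_def)
  then have "cmap d a \<in> O2" by (simp add: O2_def)
  \<comment> \<open>The derivative at \<open>a\<close> serves only to identify the two models;
    \<open>J\<close> and \<open>K\<close> are used below as constant linear maps over the whole
    chart.\<close>
  then obtain J K where JK: "bounded_linear J" "bounded_linear K"
    "\<And>x. x \<in> cmodel t \<Longrightarrow> J x \<in> cmodel d" "\<And>z. z \<in> cmodel d \<Longrightarrow> K z \<in> cmodel t"
    "\<And>x. x \<in> cmodel t \<Longrightarrow> K (J x) = x" "\<And>z. z \<in> cmodel d \<Longrightarrow> J (K z) = z"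
    using C_inf_diffeo_derivative[OF is_chart_subspace[OF chd(1)] is_chart_subspace[OF cht(1)] opO(2,3)
        \<beta>\<alpha>(1,2) \<beta> \<beta>\<alpha>(3,4) \<alpha>] by metis
  have \<eta>V: "\<eta> x \<in> cmodel t" if "x \<in> O1" for x
    using that \<eta>_eq is_chart_cmodel[OF chb(1)] subspace_0[OF is_chart_subspace[OF chk(1)]]
    by (auto simp: smt O1_def U1_def)
  define e where "e = prod_chart c1 d"
  have e: "e \<in> atlas (prod_mfd Y P)" using chc1(3) chd(3) by (auto simp: e_def atlas_prod_mfd)
  have sme: "cmodel e = cmodel c1 \<times> cmodel d" "cmap e = map_prod (cmap c1) (cmap d)" "cdom e = cdom c1 \<times> cdom d"
    by (auto simp: e_def)
  note shear = C_inf_shear[OF is_chart_subspace[OF chc1(1)] is_chart_subspace[OF chd(1)] is_chart_subspace[OF cht(1)]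
      opO \<beta>\<alpha>(1,2) \<beta> \<beta>\<alpha>(3,4) \<alpha> \<eta>V \<eta> JK]
  have O12: "openin (top_of_set (cmodel e)) (O1 \<times> O2)" "O1 \<times> O2 \<subseteq> cmap e ` cdom e"
    using opO unfolding sme by (auto simp: openin_Times O1_def O2_def U1_def U2_def)
  have Ve: "subspace (cmodel c1 \<times> cmodel d)"
    by (intro subspace_Times is_chart_subspace[OF chc1(1)] is_chart_subspace[OF chd(1)])
  define \<tau> where "\<tau> = (\<lambda>z. (fst z, J (\<beta> (snd z) - \<eta> (fst z))))"
  define c where "c = \<lparr>cdom = {p \<in> cdom e. cmap e p \<in> O1 \<times> O2}, cmodel = cmodel c1 \<times> cmodel d,
    cmap = \<lambda>p. \<tau> (cmap e p)\<rparr>"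
  have c: "c \<in> max_atlas (prod_mfd Y P)"
    unfolding c_def \<tau>_def
    by (rule max_atlas_compose[OF prod_mfd_charts[OF Y P] e O12 Ve shear(1) _ _ _ shear(5,6,7)])
      (use shear(2,3,4) in \<open>simp_all add: sme\<close>)
  \<comment> \<open>\<open>O1\<close> and \<open>O2\<close> are images of \<open>U1\<close> and
    \<open>U2\<close>; injectivity of the charts turns membership of coordinates into membership of
    points.\<close>
  have domc: "cdom c = U1 \<times> U2"
  proof -
    have "x \<in> U1" if "x \<in> cdom c1" "cmap c1 x \<in> O1" for x
      using that is_chart_inj[OF chc1(1)] by (auto simp: O1_def U1_def dest: inj_onD)
    moreover have "z \<in> U2" if "z \<in> cdom d" "cmap d z \<in> O2" for z
      using that is_chart_inj[OF chd(1)] by (auto simp: O2_def U2_def dest: inj_onD)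
    ultimately show ?thesis
      by (auto simp: c_def sme) (auto simp: O1_def O2_def U1_def U2_def)
  qed
  \<comment> \<open>\<open>K\<close> undoes the \<open>J\<close> in the chart, and
    \<open>fst\<close> keeps the base part of \<open>\<beta> - \<eta>\<close>, that is, the
    coordinate difference of \<open>proj E z\<close> and \<open>s x\<close>. Its kernel in the model
    is the slice.\<close>
  define L where "L \<xi> = fst (K (snd \<xi>))" for \<xi> :: "'f \<times> 'q"
  define W where "W = {\<xi> \<in> cmodel c. L \<xi> = 0}"
  have L: "bounded_linear L"
    unfolding L_def
    by (rule bounded_linear_compose[OF bounded_linear_fst bounded_linear_compose[OF JK(2) bounded_linear_snd]])
  have eq: "s x \<in> cdom b \<and> proj E z \<in> cdom b \<and> L (cmap c (x, z)) = cmap b (proj E z) - cmap b (s x)"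
    if "(x, z) \<in> cdom c" for x z
  proof -
    have xz: "x \<in> U1" "z \<in> U2" using that domc by auto
    have "\<beta> (cmap d z) - \<eta> (cmap c1 x) \<in> cmodel t"
      using xz \<eta>V \<beta>\<alpha>(1) openin_imp_subset[OF opO(3)] is_chart_subspace[OF cht(1)]
      by (intro subspace_diff) (auto simp: O1_def O2_def)
    then have "L (cmap c (x, z)) = fst (\<beta> (cmap d z) - \<eta> (cmap c1 x))"
      by (simp add: L_def c_def \<tau>_def sme JK(5))
    moreover have "fst (\<psi>' z) = proj E z" "fst (\<psi>' z) \<in> cdom b" "s x \<in> cdom b"
      using xz fst\<psi>'[of z] by (auto simp: U1_def U2_def smt mem_Times_iff)
    ultimately show ?thesis using xz by (simp add: \<beta>_eq \<eta>_eq smt)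
  qed
  have "cmap c ` (cdom c \<inter> {(x, z). x \<in> points Y \<and> z \<in> points P \<and> s x = proj E z}) = cmap c ` cdom c \<inter> W"
  proof -
    have L0: "L (cmap c (x, z)) = 0 \<longleftrightarrow> x \<in> points Y \<and> z \<in> points P \<and> s x = proj E z"
      if xz: "(x, z) \<in> cdom c" for x z
    proof -
      have "x \<in> points Y" "z \<in> points P" using xz by (auto simp: domc U1_def U2_def EU_def)
      moreover have "L (cmap c (x, z)) = 0 \<longleftrightarrow> s x = proj E z"
        using eq[OF xz] inj_onD[OF is_chart_inj[OF chb(1)], of "proj E z" "s x"] by auto
      ultimately show ?thesis by blast
    qed
    have "cmap c p \<in> W \<longleftrightarrow> p \<in> {(x, z). x \<in> points Y \<and> z \<in> points P \<and> s x = proj E z}"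
      if p: "p \<in> cdom c" for p
    proof -
      obtain x z where "p = (x, z)" by (cases p)
      then show ?thesis
        using L0[of x z] p is_chart_cmodel[OF max_atlas_chart[OF c] p] by (simp add: W_def)
    qed
    then show ?thesis by blast
  qed
  moreover have "subspace W"
  proof -
    have "W = cmodel c \<inter> {\<xi>. L \<xi> = 0}" by (auto simp: W_def)
    then show ?thesis
      using subspace_inter[OF is_chart_subspace[OF max_atlas_chart[OF c]]
          linear_subspace_kernel[OF bounded_linear.linear[OF L]]] by simp
  qed
  ultimately have "slice_chart (prod_mfd Y P) {(x, z). x \<in> points Y \<and> z \<in> points P \<and> s x = proj E z} c W"
    using c unfolding slice_chart_def W_def by blast
  moreover have "(y, a) \<in> cdom c" using a2 pts chc1(2) chb(2) by (simp add: domc U1_def)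
  ultimately show ?thesis using b L W_def eq that unfolding P_def by blast
qed

section \<open>The tangent spaces of the pulled back arrows\<close>

locale groupoid_bundle =
  fixes X :: "('x, 'e::euclidean_space, 'y, 'f::euclidean_space) lie_gpd"
    and H :: "'y \<Rightarrow> ('y, 'f) tvec set"
    and G :: "('g, 'k::euclidean_space) lie_grp"
    and E :: "('p, 'q::euclidean_space, 'x, 'g) pbundle"
    and \<mu> :: "'y \<times> 'p \<Rightarrow> 'p"
  assumes X: "lie_groupoid X" and H: "groupoid_connection X H" and G: "lie_group G"
    and EX: "groupoid_principal_bundle G X E \<mu>"
begin

abbreviation "P \<equiv> source_pullback X E"
abbreviation "Q \<equiv> prod_mfd (arrs X) (total E)"
abbreviation "S \<equiv> {(\<gamma>, a). \<gamma> \<in> points (arrs X) \<and> a \<in> points (total E) \<and> src X \<gamma> = proj E a}"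
abbreviation "dfst \<equiv> tangent_map P (arrs X) fst"
abbreviation "dsnd \<equiv> tangent_map P (total E) snd"
abbreviation "d\<mu> \<equiv> tangent_map P (total E) \<mu>"
abbreviation "d\<pi> \<equiv> tangent_map (total E) (objs X) (proj E)"
abbreviation "dR g \<equiv> tangent_map (total E) (total E) (\<lambda>b. ract E (b, g))"

lemma P_eq: "P = submfd Q S"
  by (simp add: source_pullback_def fibprod_def)

lemma E: "principal_bundle G (objs X) E"
  using EX by (simp add: groupoid_principal_bundle_def)

lemma manifolds: "manifold (objs X)" "manifold (arrs X)" "manifold (total E)" "manifold (gmfd G)"
  using X E G by (auto simp: lie_groupoid_def principal_bundle_def lie_group_def)

lemmas dmanifolds = manifolds[THEN manifold_dmanifold] dmanifold_prod_mfd[OF manifolds(2,3)]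

lemma smooth_src: "smooth_map (arrs X) (objs X) (src X)"
  using X by (simp add: lie_groupoid_def submersion_def)

lemma mdiff_src: "mdiff (arrs X) (objs X) (src X)"
  by (rule manifold_smooth_map_mdiff[OF manifolds(2,1) smooth_src])

lemma mdiff_proj: "mdiff (total E) (objs X) (proj E)"
  by (rule manifold_smooth_map_mdiff[OF manifolds(3,1)]) (use E in \<open>simp add: principal_bundle_def\<close>)

sublocale P: embedded Q S
proof
  show "dmanifold Q" by (rule dmanifolds)
  show "S \<subseteq> points Q" by auto
  show "\<exists>c W. slice_chart Q S c W \<and> z \<in> cdom c" if "z \<in> S" for z
  proof -
    obtain \<gamma> a where z: "z = (\<gamma>, a)" "\<gamma> \<in> points (arrs X)" "a \<in> points (total E)" "src X \<gamma> = proj E a"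
      using \<open>z \<in> S\<close> by blast
    show ?thesis
      by (rule principal_bundle_slice_chart[OF manifolds(2,1) G E smooth_src z(2,3,4)]) (use z(1) in blast)
  qed
qed

lemma dmanifold_P: "dmanifold P"
  unfolding P_eq by (rule P.dmanifold_submfd)

lemma points_P: "points P = S"
  unfolding P_eq by (rule P.points_submfd)

lemma mdiff_P_Q: "mdiff P Q (\<lambda>z. z)"
  unfolding P_eq by (rule P.mdiff_inclusion)

lemmas mdiff_Q_fst = mdiff_fst[OF dmanifolds(2,3)] and mdiff_Q_snd = mdiff_snd[OF dmanifolds(2,3)]

lemma mdiff_P_fst: "mdiff P (arrs X) fst"
  by (rule mdiff_compose[OF dmanifolds(5) dmanifold_P dmanifolds(2) mdiff_P_Q mdiff_Q_fst])

lemma mdiff_P_snd: "mdiff P (total E) snd"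
  by (rule mdiff_compose[OF dmanifolds(5) dmanifold_P dmanifolds(3) mdiff_P_Q mdiff_Q_snd])

lemma mdiff_\<mu>: "mdiff P (total E) \<mu>"
proof (rule smooth_map_mdiff)
  show "is_chart (mtop P) c" if "c \<in> atlas P" for c using that dmanifold_P by (simp add: dmanifold_def)
  show "is_chart (mtop (total E)) c" if "c \<in> atlas (total E)" for c
    using that dmanifolds(3) by (simp add: dmanifold_def)
  show "smooth_map P (total E) \<mu>" using EX by (simp add: groupoid_principal_bundle_def)
qed

lemma tangent_P_inclusion:
  assumes z: "z \<in> S" and v: "v \<in> tangent_space P z"
  shows "tangent_map P Q (\<lambda>z. z) z v \<in> tangent_space Q z"
    "tangent_map Q (arrs X) fst z (tangent_map P Q (\<lambda>z. z) z v) = dfst z v"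
    "tangent_map Q (total E) snd z (tangent_map P Q (\<lambda>z. z) z v) = dsnd z v"
proof -
  have zP: "z \<in> points P" using z points_P by simp
  show "tangent_map P Q (\<lambda>z. z) z v \<in> tangent_space Q z"
    by (rule tangent_map_in[OF dmanifold_P dmanifolds(5) mdiff_P_Q zP v])
  show "tangent_map Q (arrs X) fst z (tangent_map P Q (\<lambda>z. z) z v) = dfst z v"
    using tangent_map_compose[OF dmanifolds(5) dmanifold_P dmanifolds(2) mdiff_P_Q mdiff_Q_fst zP v] by simp
  show "tangent_map Q (total E) snd z (tangent_map P Q (\<lambda>z. z) z v) = dsnd z v"
    using tangent_map_compose[OF dmanifolds(5) dmanifold_P dmanifolds(3) mdiff_P_Q mdiff_Q_snd zP v] by simp
qed

text \<open>The inclusion into the product is injective on tangent vectors, and a vector of the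
  product is determined by its two components.\<close>

lemma tangent_P_eqI:
  assumes z: "z \<in> S" and v: "v \<in> tangent_space P z" "w \<in> tangent_space P z"
    and eq: "dfst z v = dfst z w" "dsnd z v = dsnd z w"
  shows "v = w"
proof -
  obtain \<gamma> a where za: "z = (\<gamma>, a)" "\<gamma> \<in> points (arrs X)" "a \<in> points (total E)" using z by blast
  note t = tangent_P_inclusion[OF z v(1)] tangent_P_inclusion[OF z v(2)]
  have "tangent_map P Q (\<lambda>z. z) z v = tangent_map P Q (\<lambda>z. z) z w"
    using tangent_space_prod_eqI[OF manifolds(2,3) t(1)[unfolded za] t(4)[unfolded za] za(2,3)] t eq
    by (simp add: za)
  then show ?thesis
    using P.tangent_map_inclusion_inj[OF z] v unfolding P_eq by blast
qed

text \<open>Differentiates the identity \<open>src X (fst z) = proj E (snd z)\<close>, which holds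
  on the points of \<open>P\<close>.\<close>

lemma dsrc_dfst:
  assumes z: "z \<in> S" and v: "v \<in> tangent_space P z"
  shows "dsrc X (fst z) (dfst z v) = d\<pi> (snd z) (dsnd z v)"
proof -
  have zP: "z \<in> points P" using z points_P by simp
  have "dsrc X (fst z) (dfst z v) = tangent_map P (objs X) (\<lambda>z. src X (fst z)) z v"
    using tangent_map_compose[OF dmanifolds(2) dmanifold_P dmanifolds(1) mdiff_P_fst mdiff_src zP v] by simp
  also have "\<dots> = tangent_map P (objs X) (\<lambda>z. proj E (snd z)) z v"
    by (rule tangent_map_cong[OF dmanifold_P _ zP]) (auto simp: points_P)
  also have "\<dots> = d\<pi> (snd z) (dsnd z v)"
    using tangent_map_compose[OF dmanifolds(3) dmanifold_P dmanifolds(1) mdiff_P_snd mdiff_proj zP v] by simp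
  finally show ?thesis .
qed

text \<open>The pair \<open>(u, w)\<close> gives a vector \<open>q\<close> of the product. In the
  slice chart, \<open>L\<close> applied to its coordinates is the coordinate vector of
  \<open>d\<pi> a w - dsrc X \<gamma> u\<close>, which vanishes; so \<open>q\<close> is tangent to
  the slice.\<close>

lemma tangent_P_ex:
  assumes z: "(\<gamma>, a) \<in> S" and u: "u \<in> tangent_space (arrs X) \<gamma>" and w: "w \<in> tangent_space (total E) a"
    and eq: "dsrc X \<gamma> u = d\<pi> a w"
  obtains v where "v \<in> tangent_space P (\<gamma>, a)" "dfst (\<gamma>, a) v = u" "dsnd (\<gamma>, a) v = w"
proof -
  have pts: "\<gamma> \<in> points (arrs X)" "a \<in> points (total E)" "src X \<gamma> = proj E a" using z by auto
  have zQ: "(\<gamma>, a) \<in> points Q" using pts by simp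
  obtain q where q: "q \<in> tangent_space Q (\<gamma>, a)"
    "tangent_map Q (arrs X) fst (\<gamma>, a) q = u" "tangent_map Q (total E) snd (\<gamma>, a) q = w"
    by (rule tangent_space_prod_ex[OF manifolds(2,3) pts(1,2) u w])
  obtain c W b L where c: "slice_chart Q S c W" "(\<gamma>, a) \<in> cdom c"
    and b: "b \<in> charts_at (objs X) (src X \<gamma>)" and L: "bounded_linear L" "W = {\<xi> \<in> cmodel c. L \<xi> = 0}"
    and Leq: "\<And>x z. (x, z) \<in> cdom c \<Longrightarrow> src X x \<in> cdom b \<and> proj E z \<in> cdom b \<and>
        L (cmap c (x, z)) = cmap b (proj E z) - cmap b (src X x)"
    by (rule principal_bundle_slice_chart[OF manifolds(2,1) G E smooth_src pts]) blast
  have cmax: "c \<in> max_atlas Q" using c by (simp add: slice_chart_def)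
  obtain e where e: "e \<in> charts_at Q (\<gamma>, a)" by (rule charts_at_ex[OF dmanifolds(5) zQ])
  note che = charts_atD(1,2)[OF dmanifolds(5) e]
  obtain F where F: "(cmap c \<circ> cinv e has_derivative F) (at (cmap e (\<gamma>, a)) within cmodel e)"
    "\<And>x. x \<in> cmodel e \<Longrightarrow> F x \<in> cmodel c"
    using max_atlas_derivative[OF dmanifolds(5) cmax c(2) e] by metis
  have qe: "q e \<in> cmodel e" by (rule tangent_space_cmodel[OF q(1) e])
  have m1: "mdiff Q (objs X) (\<lambda>z. src X (fst z))" and m2: "mdiff Q (objs X) (\<lambda>z. proj E (snd z))"
    by (rule mdiff_compose[OF dmanifolds(2,5,1) mdiff_Q_fst mdiff_src]
        mdiff_compose[OF dmanifolds(3,5,1) mdiff_Q_snd mdiff_proj])+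
  have b1: "b \<in> charts_at (objs X) (src X (fst (\<gamma>, a)))" and b2: "b \<in> charts_at (objs X) (proj E (snd (\<gamma>, a)))"
    using b pts(3) by simp_all
  obtain D1 where D1: "(cmap b \<circ> (\<lambda>z. src X (fst z)) \<circ> cinv e has_derivative D1) (at (cmap e (\<gamma>, a)) within cmodel e)"
    by (rule mdiff_derivative[OF m1 e b1])
  obtain D2 where D2: "(cmap b \<circ> (\<lambda>z. proj E (snd z)) \<circ> cinv e has_derivative D2) (at (cmap e (\<gamma>, a)) within cmodel e)"
    by (rule mdiff_derivative[OF m2 e b2])
  have "D1 (q e) = dsrc X \<gamma> u b"
    using tangent_map_apply[OF dmanifolds(5,1) m1 e b1 q(1) D1]
      tangent_map_compose[OF dmanifolds(2,5,1) mdiff_Q_fst mdiff_src zQ q(1)] q(2) by simp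
  moreover have "D2 (q e) = d\<pi> a w b"
    using tangent_map_apply[OF dmanifolds(5,1) m2 e b2 q(1) D2]
      tangent_map_compose[OF dmanifolds(3,5,1) mdiff_Q_snd mdiff_proj zQ q(1)] q(3) by simp
  ultimately have D12: "D2 (q e) - D1 (q e) = 0" using eq by simp
  \<comment> \<open>The overlap of \<open>e\<close> and \<open>c\<close>, on which \<open>L\<close>
    in the chart \<open>c\<close> equals the difference of the \<open>b\<close>-coordinates. Its
    derivative is computed there in two ways, and the two results agree on
    \<open>q e\<close>.\<close>
  define A where "A = cmap e ` (cdom e \<inter> cdom c)"
  have opc: "openin (mtop Q) (cdom c)" using max_atlas_chart[OF cmax] by (simp add: is_chart_def)
  have A: "at (cmap e (\<gamma>, a)) within A = at (cmap e (\<gamma>, a)) within cmodel e"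
    unfolding A_def by (rule is_chart_at_within[OF che(1) opc che(2) c(2)])
  have eA: "cmap e (\<gamma>, a) \<in> A" using che(2) c(2) by (simp add: A_def)
  have "((\<lambda>x. (cmap b \<circ> (\<lambda>z. proj E (snd z)) \<circ> cinv e) x - (cmap b \<circ> (\<lambda>z. src X (fst z)) \<circ> cinv e) x)
      has_derivative (\<lambda>x. D2 x - D1 x)) (at (cmap e (\<gamma>, a)) within A)"
    unfolding A by (rule has_derivative_diff[OF D2 D1])
  then have "((\<lambda>x. L ((cmap c \<circ> cinv e) x)) has_derivative (\<lambda>x. D2 x - D1 x)) (at (cmap e (\<gamma>, a)) within A)"
    by (rule has_derivative_transform[OF eA, rotated])
      (auto simp: A_def cinv_cmap[OF che(1)] Leq)
  moreover have "((\<lambda>x. L ((cmap c \<circ> cinv e) x)) has_derivative (\<lambda>x. L (F x))) (at (cmap e (\<gamma>, a)) within A)"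
    unfolding A by (rule bounded_linear.has_derivative[OF L(1) F(1)])
  ultimately have "L (F (q e)) = D2 (q e) - D1 (q e)"
    unfolding A
    by (rule has_derivative_unique_subspace[OF is_chart_subspace[OF che(1)] is_chart_cmodel[OF che] qe, rotated])
  then have "F (q e) \<in> W" using D12 F(2)[OF qe] L(2) by simp
  then obtain v where v: "v \<in> tangent_space P (\<gamma>, a)" "tangent_map P Q (\<lambda>z. z) (\<gamma>, a) v = q"
    using P.tangent_map_inclusion_image[OF z c e q(1) F(1)] unfolding P_eq by blast
  show ?thesis
    using that[OF v(1)] tangent_P_inclusion[OF z v(1)] v(2) q by simp
qed

section \<open>Horizontal lifts\<close>

lemma H_complement:
  assumes "\<gamma> \<in> points (arrs X)"
  shows "H \<gamma> \<inter> tangent_ker (arrs X) (objs X) (src X) \<gamma> = {0}"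
    "{h + k | h k. h \<in> H \<gamma> \<and> k \<in> tangent_ker (arrs X) (objs X) (src X) \<gamma>} = tangent_space (arrs X) \<gamma>"
proof -
  have "\<forall>\<gamma>\<in>points (arrs X).
        H \<gamma> \<inter> tangent_ker (arrs X) (objs X) (src X) \<gamma> = {0} \<and>
        {h + k | h k. h \<in> H \<gamma> \<and> k \<in> tangent_ker (arrs X) (objs X) (src X) \<gamma>}
          = tangent_space (arrs X) \<gamma>"
    using H unfolding groupoid_connection_def by (elim conjE)
  from bspec[OF this assms] show "H \<gamma> \<inter> tangent_ker (arrs X) (objs X) (src X) \<gamma> = {0}"
    "{h + k | h k. h \<in> H \<gamma> \<and> k \<in> tangent_ker (arrs X) (objs X) (src X) \<gamma>} = tangent_space (arrs X) \<gamma>"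
    by (rule conjunct1, rule conjunct2)
qed

text \<open>The vector 0 lies in the kernel, being in the intersection, so \<open>h = h + 0\<close>
  belongs to the direct sum.\<close>

lemma H_tangent: "\<gamma> \<in> points (arrs X) \<Longrightarrow> h \<in> H \<gamma> \<Longrightarrow> h \<in> tangent_space (arrs X) \<gamma>"
proof -
  assume \<gamma>: "\<gamma> \<in> points (arrs X)" and h: "h \<in> H \<gamma>"
  have "0 \<in> tangent_ker (arrs X) (objs X) (src X) \<gamma>"
    using H_complement(1)[OF \<gamma>] by blast
  with h have "h + 0 \<in> tangent_space (arrs X) \<gamma>" unfolding H_complement(2)[OF \<gamma>, symmetric] by blast
  then show ?thesis by simp
qed

text \<open>Linearity of \<open>H \<gamma>\<close> comes from smoothness of the distribution:
  \<open>H \<gamma>\<close> is the span of a local frame.\<close>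

lemma H_diff: "\<gamma> \<in> points (arrs X) \<Longrightarrow> h \<in> H \<gamma> \<Longrightarrow> h' \<in> H \<gamma> \<Longrightarrow> h - h' \<in> H \<gamma>"
proof -
  assume \<gamma>: "\<gamma> \<in> points (arrs X)" and h: "h \<in> H \<gamma>" "h' \<in> H \<gamma>"
  have "smooth_distribution (arrs X) H" using H by (simp add: groupoid_connection_def)
  from bspec[OF this[unfolded smooth_distribution_def] \<gamma>]
  obtain U B where "\<gamma> \<in> U" "\<forall>q\<in>U. inj_on (\<lambda>X. X q) B \<and> independent ((\<lambda>X. X q) ` B) \<and>
      span ((\<lambda>X. X q) ` B) = H q" by (elim exE conjE)
  then have "span ((\<lambda>X. X \<gamma>) ` B) = H \<gamma>" by simp
  with h show ?thesis using span_diff[of h "(\<lambda>X. X \<gamma>) ` B" h'] by simp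
qed

text \<open>The difference of two such vectors is both horizontal and in the kernel, hence
  0.\<close>

lemma dsrc_inj:
  assumes \<gamma>: "\<gamma> \<in> points (arrs X)" and h: "h \<in> H \<gamma>" "h' \<in> H \<gamma>" and eq: "dsrc X \<gamma> h = dsrc X \<gamma> h'"
  shows "h = h'"
proof -
  note t = H_tangent[OF \<gamma> h(1)] H_tangent[OF \<gamma> h(2)]
  have "dsrc X \<gamma> (h - h') = 0"
    using tangent_map_diff[OF dmanifolds(2,1) mdiff_src \<gamma> t] eq by simp
  then have "h - h' \<in> tangent_ker (arrs X) (objs X) (src X) \<gamma>"
    using tangent_space_diff[OF dmanifolds(2) t] by (simp add: tangent_ker_def)
  with H_diff[OF \<gamma> h] have "h - h' \<in> {0}" unfolding H_complement(1)[OF \<gamma>, symmetric] by (rule IntI)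
  then show ?thesis by simp
qed

text \<open>A preimage exists because the source map is a submersion; discarding its kernel
  component makes it horizontal.\<close>

lemma horizontal_lift_ex:
  assumes \<gamma>: "\<gamma> \<in> points (arrs X)" and u: "u \<in> tangent_space (objs X) (src X \<gamma>)"
  obtains h where "h \<in> H \<gamma>" "dsrc X \<gamma> h = u"
proof -
  have "submersion (arrs X) (objs X) (src X)" using X by (simp add: lie_groupoid_def)
  then have "u \<in> dsrc X \<gamma> ` tangent_space (arrs X) \<gamma>"
    using \<gamma> u by (simp add: submersion_def)
  then obtain v where v: "v \<in> tangent_space (arrs X) \<gamma>" "dsrc X \<gamma> v = u" by blast
  from v(1) obtain h k where hk: "v = h + k" "h \<in> H \<gamma>" "k \<in> tangent_ker (arrs X) (objs X) (src X) \<gamma>"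
    unfolding H_complement(2)[OF \<gamma>, symmetric] by blast
  have "dsrc X \<gamma> v = dsrc X \<gamma> h + dsrc X \<gamma> k"
    unfolding hk(1)
    by (rule tangent_map_add[OF dmanifolds(2,1) mdiff_src \<gamma> H_tangent[OF \<gamma> hk(2)]])
      (use hk(3) in \<open>simp add: tangent_ker_def\<close>)
  then show ?thesis using that[OF hk(2)] hk(3) v(2) by (simp add: tangent_ker_def)
qed

lemma horizontal_lift_eq:
  assumes "\<gamma> \<in> points (arrs X)" "h \<in> H \<gamma>" "dsrc X \<gamma> h = u"
  shows "horizontal_lift X H \<gamma> u = h"
  unfolding horizontal_lift_def using dsrc_inj assms by (intro the_equality) auto

text \<open>The horizontal lift of \<open>w\<close> for the pulled back connection. Both
  \<open>theta_tilde\<close> and \<open>horizontal_proj\<close> are expressed through this one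
  vector, which makes the two sides of the theorem comparable.\<close>

definition lift :: "'y \<times> 'p \<Rightarrow> ('p, 'q) tvec \<Rightarrow> ('y \<times> 'p, 'f \<times> 'q) tvec" where
  "lift z w = (THE v. v \<in> tangent_space P z \<and> dfst z v \<in> H (fst z) \<and> dsnd z v = w)"

text \<open>Equal second components force equal images under \<open>dsrc\<close> of the first ones,
  and \<open>dsrc\<close> is injective on \<open>H\<close>.\<close>

lemma horizontal_eqI:
  assumes z: "z \<in> S" and v: "v \<in> tangent_space P z" "v' \<in> tangent_space P z"
    and H: "dfst z v \<in> H (fst z)" "dfst z v' \<in> H (fst z)" and eq: "dsnd z v = dsnd z v'"
  shows "v = v'"
proof -
  have "dsrc X (fst z) (dfst z v) = dsrc X (fst z) (dfst z v')"
    using dsrc_dfst[OF z] v eq by simp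
  then have "dfst z v = dfst z v'" using z H by (intro dsrc_inj[of "fst z"]) auto
  then show ?thesis using tangent_P_eqI[OF z v _ eq] by blast
qed

lemma lift_eq:
  assumes "z \<in> S" "v \<in> tangent_space P z" "dfst z v \<in> H (fst z)" "dsnd z v = w"
  shows "lift z w = v"
  unfolding lift_def using assms horizontal_eqI[OF assms(1)] by (intro the_equality) auto

text \<open>The horizontal lift of \<open>d\<pi> a w\<close> and \<open>w\<close> itself satisfy the
  compatibility condition of \<open>tangent_P_ex\<close>.\<close>

lemma lift:
  assumes z: "z \<in> S" and w: "w \<in> tangent_space (total E) (snd z)"
  shows "lift z w \<in> tangent_space P z" "dfst z (lift z w) \<in> H (fst z)" "dsnd z (lift z w) = w"
proof -
  obtain \<gamma> a where za: "z = (\<gamma>, a)" "\<gamma> \<in> points (arrs X)" "a \<in> points (total E)" "src X \<gamma> = proj E a"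
    using z by blast
  have "d\<pi> a w \<in> tangent_space (objs X) (src X \<gamma>)"
    using tangent_map_in[OF dmanifolds(3,1) mdiff_proj za(3)] w za by simp
  then obtain h where h: "h \<in> H \<gamma>" "dsrc X \<gamma> h = d\<pi> a w" by (rule horizontal_lift_ex[OF za(2)])
  obtain v where v: "v \<in> tangent_space P (\<gamma>, a)" "dfst (\<gamma>, a) v = h" "dsnd (\<gamma>, a) v = w"
    by (rule tangent_P_ex[OF z[unfolded za] H_tangent[OF za(2) h(1)] _ h(2)]) (use w za(1) in auto)
  have "lift z w = v" by (rule lift_eq[OF z]) (use v h za(1) in auto)
  then show "lift z w \<in> tangent_space P z" "dfst z (lift z w) \<in> H (fst z)" "dsnd z (lift z w) = w"
    using v h za(1) by auto
qed

lemma theta_tilde_eq: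
  assumes z: "(\<gamma>, a) \<in> S" and w: "w \<in> tangent_space (total E) a"
  shows "theta_tilde X H E \<mu> \<gamma> a w = d\<mu> (\<gamma>, a) (lift (\<gamma>, a) w)"
proof -
  have w': "w \<in> tangent_space (total E) (snd (\<gamma>, a))" using w by simp
  note l = lift[OF z w']
  have hl: "horizontal_lift X H \<gamma> (d\<pi> a w) = dfst (\<gamma>, a) (lift (\<gamma>, a) w)"
    using l z dsrc_dfst[OF z l(1)] by (intro horizontal_lift_eq) auto
  have "(THE v. v \<in> tangent_space P (\<gamma>, a) \<and> dfst (\<gamma>, a) v = horizontal_lift X H \<gamma> (d\<pi> a w) \<and> dsnd (\<gamma>, a) v = w)
      = lift (\<gamma>, a) w"
    unfolding hl using l tangent_P_eqI[OF z _ l(1)] by (intro the_equality) auto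
  then show ?thesis unfolding theta_tilde_def Let_def by simp
qed

text \<open>The source map of the pulled back groupoid is \<open>snd\<close>, so the projection of
  \<open>v\<close> is the horizontal vector with the same second component as
  \<open>v\<close>.\<close>

lemma horizontal_proj_eq:
  assumes z: "z \<in> S" and v: "v \<in> tangent_space P z"
  shows "horizontal_proj (pullback_groupoid X E \<mu>) (pullback_connection X H E) z v = lift z (dsnd z v)"
proof -
  have zP: "z \<in> points P" using z points_P by simp
  have w: "dsnd z v \<in> tangent_space (total E) (snd z)"
    by (rule tangent_map_in[OF dmanifold_P dmanifolds(3) mdiff_P_snd zP v])
  note l = lift[OF z w]
  have ker: "v - h \<in> tangent_ker P (total E) snd z \<longleftrightarrow> dsnd z h = dsnd z v" if h: "h \<in> tangent_space P z" for h
    using tangent_map_diff[OF dmanifold_P dmanifolds(3) mdiff_P_snd zP v h] tangent_space_diff[OF dmanifold_P v h]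
    by (auto simp: tangent_ker_def)
  have "(THE h. h \<in> pullback_connection X H E z \<and> v - h \<in> tangent_ker P (total E) snd z) = lift z (dsnd z v)"
  proof (rule the_equality)
    show "lift z (dsnd z v) \<in> pullback_connection X H E z \<and> v - lift z (dsnd z v) \<in> tangent_ker P (total E) snd z"
      using l ker[OF l(1)] by (simp add: pullback_connection_def)
    show "h = lift z (dsnd z v)" if "h \<in> pullback_connection X H E z \<and> v - h \<in> tangent_ker P (total E) snd z" for h
      using that ker[of h] lift_eq[OF z, of h "dsnd z v"] by (auto simp: pullback_connection_def)
  qed
  then show ?thesis by (simp add: horizontal_proj_def pullback_groupoid_def)
qed

lemma groupoid_lie_one_form_iff:
  "groupoid_lie_one_form G (pullback_groupoid X E \<mu>) (pullback_connection X H E) \<omega> \<longleftrightarrow>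
    lie_one_form G (total E) \<omega> \<and>
    (\<forall>\<gamma> a. (\<gamma>, a) \<in> S \<longrightarrow> (\<forall>w\<in>tangent_space (total E) a.
       \<omega> a w = \<omega> (\<mu> (\<gamma>, a)) (theta_tilde X H E \<mu> \<gamma> a w)))"
proof -
  let ?h = "\<lambda>z v. horizontal_proj (pullback_groupoid X E \<mu>) (pullback_connection X H E) z v"
  have "(\<forall>z\<in>points P. \<forall>v\<in>tangent_space P z.
      \<omega> (snd z) (dsnd z (?h z v)) = \<omega> (\<mu> z) (d\<mu> z (?h z v))) \<longleftrightarrow>
    (\<forall>z\<in>S. \<forall>w\<in>tangent_space (total E) (snd z). \<omega> (snd z) w = \<omega> (\<mu> z) (d\<mu> z (lift z w)))"
  proof (intro iffI ballI)
    fix z w assume *: "\<forall>z\<in>points P. \<forall>v\<in>tangent_space P z.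
      \<omega> (snd z) (dsnd z (?h z v)) = \<omega> (\<mu> z) (d\<mu> z (?h z v))"
      and z: "z \<in> S" and w: "w \<in> tangent_space (total E) (snd z)"
    \<comment> \<open>Take \<open>v = lift z w\<close>, which is its own horizontal projection, so
      every \<open>w\<close> is reached.\<close>
    from bspec[OF bspec[OF * z[folded points_P]] lift(1)[OF z w]]
    show "\<omega> (snd z) w = \<omega> (\<mu> z) (d\<mu> z (lift z w))"
      unfolding horizontal_proj_eq[OF z lift(1)[OF z w]] lift(3)[OF z w] .
  next
    fix z v assume *: "\<forall>z\<in>S. \<forall>w\<in>tangent_space (total E) (snd z). \<omega> (snd z) w = \<omega> (\<mu> z) (d\<mu> z (lift z w))"
      and zP: "z \<in> points P" and v: "v \<in> tangent_space P z"
    have z: "z \<in> S" using zP points_P by simp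
    have w: "dsnd z v \<in> tangent_space (total E) (snd z)"
      by (rule tangent_map_in[OF dmanifold_P dmanifolds(3) mdiff_P_snd zP v])
    from bspec[OF bspec[OF * z] w]
    show "\<omega> (snd z) (dsnd z (?h z v)) = \<omega> (\<mu> z) (d\<mu> z (?h z v))"
      unfolding horizontal_proj_eq[OF z v] lift(3)[OF z w] .
  qed
  also have "\<dots> \<longleftrightarrow> (\<forall>\<gamma> a. (\<gamma>, a) \<in> S \<longrightarrow> (\<forall>w\<in>tangent_space (total E) a.
       \<omega> a w = \<omega> (\<mu> (\<gamma>, a)) (theta_tilde X H E \<mu> \<gamma> a w)))"
    using theta_tilde_eq by auto
  finally show ?thesis
    unfolding groupoid_lie_one_form_def horizontal_form_def pullback_form_def
    by (simp add: pullback_groupoid_def)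
qed

section \<open>The actions on the Atiyah and adjoint bundles\<close>

lemma group_G: "group G" and points_G: "points (gmfd G) = carrier G"
  using G by (simp_all add: lie_group_def)

lemma mdiff_ract: "mdiff (prod_mfd (total E) (gmfd G)) (total E) (ract E)"
  by (rule smooth_map_mdiff)
    (use E prod_mfd_charts(1)[OF manifolds(3,4)] manifolds(3) in \<open>auto simp: principal_bundle_def manifold_def\<close>)

lemmas dmanifold_EG = dmanifold_prod_mfd[OF manifolds(3,4)]

lemma mdiff_R: "g \<in> carrier G \<Longrightarrow> mdiff (total E) (total E) (\<lambda>b. ract E (b, g))"
  by (rule mdiff_compose[OF dmanifold_EG dmanifolds(3,3) mdiff_Pair[OF mdiff_ident mdiff_const] mdiff_ract])
    (use points_G dmanifolds in auto)

lemma mdiff_orbit: "a \<in> points (total E) \<Longrightarrow> mdiff (gmfd G) (total E) (\<lambda>h. ract E (a, h))"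
  by (rule mdiff_compose[OF dmanifold_EG dmanifolds(4,3) mdiff_Pair[OF mdiff_const mdiff_ident] mdiff_ract])
    (use dmanifolds in auto)

lemma ract_points: "a \<in> points (total E) \<Longrightarrow> g \<in> carrier G \<Longrightarrow> ract E (a, g) \<in> points (total E)"
  using mdiff_points[OF mdiff_R] by blast

lemma ract_one: "a \<in> points (total E) \<Longrightarrow> ract E (a, \<one>\<^bsub>G\<^esub>) = a"
  using E by (simp add: principal_bundle_def)

lemma ract_mult:
  "a \<in> points (total E) \<Longrightarrow> g \<in> carrier G \<Longrightarrow> h \<in> carrier G \<Longrightarrow>
    ract E (ract E (a, g), h) = ract E (a, g \<otimes>\<^bsub>G\<^esub> h)"
  using E by (simp add: principal_bundle_def)

lemma proj_ract: "a \<in> points (total E) \<Longrightarrow> g \<in> carrier G \<Longrightarrow> proj E (ract E (a, g)) = proj E a"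
  using E by (simp add: principal_bundle_def)

text \<open>In a trivialization the action is right multiplication on the group component, where
  cancellation applies.\<close>

lemma ract_free:
  assumes a: "a \<in> points (total E)" and g: "g \<in> carrier G" and eq: "ract E (a, g) = a"
  shows "g = \<one>\<^bsub>G\<^esub>"
proof -
  interpret group G by (rule group_G)
  obtain U \<psi> \<psi>' where *: "proj E a \<in> U"
    "\<And>y g. y \<in> U \<Longrightarrow> g \<in> carrier G \<Longrightarrow> \<psi>' (\<psi> (y, g)) = (y, g)"
    "\<And>a. a \<in> points (total E) \<Longrightarrow> proj E a \<in> U \<Longrightarrow> \<psi>' a \<in> U \<times> carrier G \<and> \<psi> (\<psi>' a) = a"
    "\<And>y g h. y \<in> U \<Longrightarrow> g \<in> carrier G \<Longrightarrow> h \<in> carrier G \<Longrightarrow>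
      ract E (\<psi> (y, g), h) = \<psi> (y, g \<otimes>\<^bsub>G\<^esub> h)"
    by (rule principal_bundle_trivialization[OF E mdiff_points[OF mdiff_proj a]]) blast
  obtain y k where yk: "\<psi>' a = (y, k)" "y \<in> U" "k \<in> carrier G" "\<psi> (y, k) = a"
    using *(3)[OF a *(1)] by (cases "\<psi>' a") auto
  have "\<psi>' (ract E (a, g)) = (y, k \<otimes>\<^bsub>G\<^esub> g)"
    using *(2)[OF yk(2), of "k \<otimes>\<^bsub>G\<^esub> g"] *(4)[OF yk(2,3) g] yk(3,4) g by simp
  then have "k \<otimes>\<^bsub>G\<^esub> g = k" using eq yk(1) by simp
  then show ?thesis using yk(3) g by simp
qed

section \<open>Right translations and the adjoint action on tangent vectors\<close>

lemma dR_in: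
  "a \<in> points (total E) \<Longrightarrow> g \<in> carrier G \<Longrightarrow> w \<in> tangent_space (total E) a \<Longrightarrow>
    dR g a w \<in> tangent_space (total E) (ract E (a, g))"
  by (rule tangent_map_in[OF dmanifolds(3,3) mdiff_R])

lemma dR_mult:
  assumes "a \<in> points (total E)" "g \<in> carrier G" "h \<in> carrier G" "w \<in> tangent_space (total E) a"
  shows "dR h (ract E (a, g)) (dR g a w) = dR (g \<otimes>\<^bsub>G\<^esub> h) a w"
proof -
  have "dR (g \<otimes>\<^bsub>G\<^esub> h) a w = tangent_map (total E) (total E) (\<lambda>b. ract E (ract E (b, g), h)) a w"
    by (rule tangent_map_cong[OF dmanifolds(3) _ assms(1)]) (simp add: ract_mult assms)
  also have "\<dots> = dR h (ract E (a, g)) (dR g a w)"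
    by (rule tangent_map_compose[OF dmanifolds(3,3,3) mdiff_R[OF assms(2)] mdiff_R[OF assms(3)] assms(1,4)])
  finally show ?thesis ..
qed

lemma mdiff_conj:
  assumes g: "g \<in> carrier G"
  shows "mdiff (gmfd G) (gmfd G) (\<lambda>h. g \<otimes>\<^bsub>G\<^esub> h \<otimes>\<^bsub>G\<^esub> inv\<^bsub>G\<^esub> g)"
proof -
  interpret group G by (rule group_G)
  note GG = dmanifold_prod_mfd[OF manifolds(4,4)]
  have m: "mdiff (prod_mfd (gmfd G) (gmfd G)) (gmfd G) (\<lambda>(g, h). g \<otimes>\<^bsub>G\<^esub> h)"
    by (rule smooth_map_mdiff)
      (use G prod_mfd_charts(1)[OF manifolds(4,4)] manifolds(4) in \<open>auto simp: lie_group_def manifold_def\<close>)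
  have "mdiff (gmfd G) (gmfd G) (\<lambda>h. (\<lambda>(g, h). g \<otimes>\<^bsub>G\<^esub> h) (g, h))"
    by (rule mdiff_compose[OF GG dmanifolds(4,4) mdiff_Pair[OF mdiff_const mdiff_ident] m])
      (use g points_G dmanifolds in auto)
  then have l: "mdiff (gmfd G) (gmfd G) (\<lambda>h. g \<otimes>\<^bsub>G\<^esub> h)" by simp
  have "mdiff (gmfd G) (gmfd G) (\<lambda>h. (\<lambda>(g, h). g \<otimes>\<^bsub>G\<^esub> h) (g \<otimes>\<^bsub>G\<^esub> h, inv\<^bsub>G\<^esub> g))"
    by (rule mdiff_compose[OF GG dmanifolds(4,4) mdiff_Pair[OF l mdiff_const] m])
      (use g points_G in auto)
  then show ?thesis by simp
qed

lemma one_points: "\<one>\<^bsub>G\<^esub> \<in> points (gmfd G)"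
  using points_G group_G group.is_monoid monoid.one_closed by metis

lemma Adj_in:
  assumes "g \<in> carrier G" "x \<in> lie_algebra G"
  shows "Adj G g x \<in> lie_algebra G"
proof -
  interpret group G by (rule group_G)
  have "Adj G g x \<in> tangent_space (gmfd G) (g \<otimes>\<^bsub>G\<^esub> \<one>\<^bsub>G\<^esub> \<otimes>\<^bsub>G\<^esub> inv\<^bsub>G\<^esub> g)"
    using tangent_map_in[OF dmanifolds(4,4) mdiff_conj[OF assms(1)] one_points] assms(2)
    unfolding Adj_def lie_algebra_def by blast
  then show ?thesis using assms(1) by (simp add: lie_algebra_def)
qed

lemma Adj_one:
  assumes "x \<in> lie_algebra G" shows "Adj G \<one>\<^bsub>G\<^esub> x = x"
proof -
  interpret group G by (rule group_G)
  have "Adj G \<one>\<^bsub>G\<^esub> x = tangent_map (gmfd G) (gmfd G) (\<lambda>h. h) \<one>\<^bsub>G\<^esub> x"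
    unfolding Adj_def by (rule tangent_map_cong[OF dmanifolds(4) _ one_points]) (simp add: points_G)
  then show ?thesis
    using tangent_map_ident[OF dmanifolds(4) one_points] assms by (simp add: lie_algebra_def)
qed

lemma Adj_mult:
  assumes g: "g \<in> carrier G" "h \<in> carrier G" and x: "x \<in> lie_algebra G"
  shows "Adj G g (Adj G h x) = Adj G (g \<otimes>\<^bsub>G\<^esub> h) x"
proof -
  interpret group G by (rule group_G)
  have "Adj G (g \<otimes>\<^bsub>G\<^esub> h) x = tangent_map (gmfd G) (gmfd G)
      (\<lambda>k. g \<otimes>\<^bsub>G\<^esub> (h \<otimes>\<^bsub>G\<^esub> k \<otimes>\<^bsub>G\<^esub> inv\<^bsub>G\<^esub> h) \<otimes>\<^bsub>G\<^esub> inv\<^bsub>G\<^esub> g) \<one>\<^bsub>G\<^esub> x"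
    unfolding Adj_def
    by (rule tangent_map_cong[OF dmanifolds(4) _ one_points]) (use g in \<open>simp add: points_G m_assoc inv_mult_group\<close>)
  also have "\<dots> = Adj G g (Adj G h x)"
    using tangent_map_compose[OF dmanifolds(4,4,4) mdiff_conj[OF g(2)] mdiff_conj[OF g(1)] one_points, of x] x g
    by (simp add: Adj_def lie_algebra_def)
  finally show ?thesis ..
qed

lemma at_class_eq:
  assumes a: "a \<in> points (total E)" "w \<in> tangent_space (total E) a"
  shows "at_class G E a w = (\<lambda>g. (ract E (a, g), dR g a w)) ` carrier G"
  using a unfolding at_class_def at_rel_def by auto

lemma ad_class_eq:
  assumes a: "a \<in> points (total E)" "x \<in> lie_algebra G"
  shows "ad_class G E a x = (\<lambda>g. (ract E (a, g), Adj G (inv\<^bsub>G\<^esub> g) x)) ` carrier G"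
  using a unfolding ad_class_def ad_rel_def by auto

lemma carrier_image_mult:
  assumes g: "g \<in> carrier G" shows "(\<lambda>h. g \<otimes>\<^bsub>G\<^esub> h) ` carrier G = carrier G"
proof -
  interpret group G by (rule group_G)
  have "h \<in> (\<lambda>h. g \<otimes>\<^bsub>G\<^esub> h) ` carrier G" if "h \<in> carrier G" for h
    using g that by (intro image_eqI[of _ _ "inv\<^bsub>G\<^esub> g \<otimes>\<^bsub>G\<^esub> h"]) (auto simp: m_assoc[symmetric])
  then show ?thesis using g by auto
qed

text \<open>Classes are parametrized by the carrier; moving the representative by \<open>g\<close>
  only reindexes the parametrization by left multiplication with \<open>g\<close>. The same works
  for \<open>ad_class_ract\<close>.\<close>

lemma at_class_ract:
  assumes a: "a \<in> points (total E)" "w \<in> tangent_space (total E) a" and g: "g \<in> carrier G"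
  shows "at_class G E (ract E (a, g)) (dR g a w) = at_class G E a w"
proof -
  have "at_class G E (ract E (a, g)) (dR g a w) =
      (\<lambda>h. (ract E (a, h), dR h a w)) ` (\<lambda>h. g \<otimes>\<^bsub>G\<^esub> h) ` carrier G"
    unfolding at_class_eq[OF ract_points[OF a(1) g] dR_in[OF a(1) g a(2)]] image_image
    by (rule image_cong) (simp_all add: ract_mult dR_mult a g)
  then show ?thesis unfolding carrier_image_mult[OF g] at_class_eq[OF a] .
qed

lemma ad_class_ract:
  assumes a: "a \<in> points (total E)" "x \<in> lie_algebra G" and g: "g \<in> carrier G"
  shows "ad_class G E (ract E (a, g)) (Adj G (inv\<^bsub>G\<^esub> g) x) = ad_class G E a x"
proof -
  interpret group G by (rule group_G)
  have "ad_class G E (ract E (a, g)) (Adj G (inv\<^bsub>G\<^esub> g) x) =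
      (\<lambda>h. (ract E (a, h), Adj G (inv\<^bsub>G\<^esub> h) x)) ` (\<lambda>h. g \<otimes>\<^bsub>G\<^esub> h) ` carrier G"
    unfolding ad_class_eq[OF ract_points[OF a(1) g] Adj_in[OF inv_closed[OF g] a(2)]] image_image
    by (rule image_cong) (simp_all add: ract_mult Adj_mult inv_mult_group a g)
  then show ?thesis unfolding carrier_image_mult[OF g] ad_class_eq[OF a] .
qed

text \<open>If \<open>(a, x)\<close> lies in the class of \<open>(a, y)\<close>, some
  \<open>g\<close> relates them and fixes \<open>a\<close>; freeness gives that \<open>g\<close> is
  the unit, whose adjoint action is trivial.\<close>

lemma ad_class_inj:
  assumes a: "a \<in> points (total E)" and xy: "x \<in> lie_algebra G" "y \<in> lie_algebra G"
    and eq: "ad_class G E a x = ad_class G E a y"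
  shows "x = y"
proof -
  interpret group G by (rule group_G)
  have "(ract E (a, \<one>\<^bsub>G\<^esub>), Adj G (inv\<^bsub>G\<^esub> \<one>\<^bsub>G\<^esub>) x) \<in> ad_class G E a x"
    unfolding ad_class_eq[OF a xy(1)] by (rule imageI) simp
  then have "(a, x) \<in> ad_class G E a y" using eq by (simp add: ract_one[OF a] Adj_one[OF xy(1)])
  then obtain g where "g \<in> carrier G" "ract E (a, g) = a" "x = Adj G (inv\<^bsub>G\<^esub> g) y"
    unfolding ad_class_eq[OF a xy(2)] by auto
  then show ?thesis using ract_free[OF a, of g] Adj_one[OF xy(2)] by simp
qed

lemma At_fibre_iff:
  "C \<in> At_fibre G E x \<longleftrightarrow> (\<exists>a w. a \<in> points (total E) \<and> proj E a = x \<and> w \<in> tangent_space (total E) a \<and>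
      C = at_class G E a w)"
  unfolding At_fibre_def at_class_def quotient_def by auto

lemma ad_class_in_fibre:
  "a \<in> points (total E) \<Longrightarrow> y \<in> lie_algebra G \<Longrightarrow> ad_class G E a y \<in> ad_fibre G E (proj E a)"
  unfolding ad_fibre_def ad_class_def quotient_def by auto

lemma carrier_not_empty: "carrier G \<noteq> {}"
  using one_points points_G by auto

section \<open>The action of an arrow on tangent vectors and on orbit classes\<close>

lemma \<mu>_points: "(\<gamma>, a) \<in> S \<Longrightarrow> \<mu> (\<gamma>, a) \<in> points (total E)"
  using mdiff_points[OF mdiff_\<mu>] points_P by blast

lemma \<mu>_ract: "(\<gamma>, a) \<in> S \<Longrightarrow> g \<in> carrier G \<Longrightarrow> \<mu> (\<gamma>, ract E (a, g)) = ract E (\<mu> (\<gamma>, a), g)"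
  using EX by (auto simp: groupoid_principal_bundle_def)

lemma S_ract: "(\<gamma>, a) \<in> S \<Longrightarrow> g \<in> carrier G \<Longrightarrow> (\<gamma>, ract E (a, g)) \<in> S"
  by (auto simp: proj_ract ract_points)

lemma theta_tilde_in:
  assumes z: "(\<gamma>, a) \<in> S" and w: "w \<in> tangent_space (total E) a"
  shows "theta_tilde X H E \<mu> \<gamma> a w \<in> tangent_space (total E) (\<mu> (\<gamma>, a))"
proof -
  have "(\<gamma>, a) \<in> points P" using z points_P by simp
  then show ?thesis
    unfolding theta_tilde_eq[OF z w]
    by (rule tangent_map_in[OF dmanifold_P dmanifolds(3) mdiff_\<mu>]) (use lift(1)[OF z] w in simp)
qed

text \<open>Right translation by \<open>g\<close> lifts to the map \<open>F\<close> of the arrows,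
  which fixes \<open>\<gamma>\<close>. It therefore carries horizontal lifts to horizontal lifts,
  and it intertwines \<open>\<mu>\<close> with right translation.\<close>

lemma theta_tilde_ract:
  assumes z: "(\<gamma>, a) \<in> S" and w: "w \<in> tangent_space (total E) a" and g: "g \<in> carrier G"
  shows "theta_tilde X H E \<mu> \<gamma> (ract E (a, g)) (dR g a w) = dR g (\<mu> (\<gamma>, a)) (theta_tilde X H E \<mu> \<gamma> a w)"
proof -
  define F where "F z = (fst z, ract E (snd z, g))" for z :: "'y \<times> 'p"
  have a: "a \<in> points (total E)" and zP: "(\<gamma>, a) \<in> points P" using z points_P by auto
  have w': "w \<in> tangent_space (total E) (snd (\<gamma>, a))" using w by simp
  note l = lift[OF z w']
  have mRs: "mdiff P (total E) (\<lambda>z. ract E (snd z, g))"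
    by (rule mdiff_compose[OF dmanifolds(3) dmanifold_P dmanifolds(3) mdiff_P_snd mdiff_R[OF g]])
  have "mdiff P Q F" unfolding F_def by (rule mdiff_Pair[OF mdiff_P_fst mRs])
  from P.mdiff_into[OF dmanifold_P this] have mF: "mdiff P P F"
    unfolding P_eq[symmetric] using g by (auto simp: points_P F_def proj_ract ract_points)
  have Fz: "F (\<gamma>, a) = (\<gamma>, ract E (a, g))" by (simp add: F_def)
  define v where "v = tangent_map P P F (\<gamma>, a) (lift (\<gamma>, a) w)"
  have v: "v \<in> tangent_space P (\<gamma>, ract E (a, g))"
    using tangent_map_in[OF dmanifold_P dmanifold_P mF zP l(1)] by (simp add: v_def Fz)
  have "dfst (\<gamma>, ract E (a, g)) v = dfst (\<gamma>, a) (lift (\<gamma>, a) w)"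
    using tangent_map_compose[OF dmanifold_P dmanifold_P dmanifolds(2) mF mdiff_P_fst zP l(1)]
    by (simp add: v_def F_def)
  moreover have "dsnd (\<gamma>, ract E (a, g)) v = dR g a w"
    using tangent_map_compose[OF dmanifold_P dmanifold_P dmanifolds(3) mF mdiff_P_snd zP l(1)]
      tangent_map_compose[OF dmanifolds(3) dmanifold_P dmanifolds(3) mdiff_P_snd mdiff_R[OF g] zP l(1)] l(3)
    by (simp add: v_def F_def)
  \<comment> \<open>The first component of \<open>v\<close> is unchanged, hence still in
    \<open>H \<gamma>\<close>, and the second is \<open>dR g a w\<close>; these two properties
    characterize the lift.\<close>
  ultimately have lift_v: "lift (\<gamma>, ract E (a, g)) (dR g a w) = v"
    using l(2) by (intro lift_eq[OF S_ract[OF z g] v]) auto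
  have "theta_tilde X H E \<mu> \<gamma> (ract E (a, g)) (dR g a w) = d\<mu> (F (\<gamma>, a)) v"
    unfolding theta_tilde_eq[OF S_ract[OF z g] dR_in[OF a g w]] lift_v Fz ..
  also have "\<dots> = tangent_map P (total E) (\<lambda>z. \<mu> (F z)) (\<gamma>, a) (lift (\<gamma>, a) w)"
    unfolding v_def by (rule tangent_map_compose[OF dmanifold_P dmanifold_P dmanifolds(3) mF mdiff_\<mu> zP l(1), symmetric])
  also have "\<dots> = tangent_map P (total E) (\<lambda>z. ract E (\<mu> z, g)) (\<gamma>, a) (lift (\<gamma>, a) w)"
    by (rule tangent_map_cong[OF dmanifold_P _ zP]) (use \<mu>_ract g in \<open>auto simp: points_P F_def\<close>)
  also have "\<dots> = dR g (\<mu> (\<gamma>, a)) (d\<mu> (\<gamma>, a) (lift (\<gamma>, a) w))"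
    by (rule tangent_map_compose[OF dmanifolds(3) dmanifold_P dmanifolds(3) mdiff_\<mu> mdiff_R[OF g] zP l(1)])
  finally show ?thesis unfolding theta_tilde_eq[OF z w] .
qed

text \<open>By equivariance all representatives contribute the same class to the union, and there is
  at least one since the carrier is nonempty.\<close>

lemma At_action_at_class:
  assumes z: "(\<gamma>, a) \<in> S" and w: "w \<in> tangent_space (total E) a"
  shows "At_action G X H E \<mu> \<gamma> (at_class G E a w) = at_class G E (\<mu> (\<gamma>, a)) (theta_tilde X H E \<mu> \<gamma> a w)"
proof -
  have a: "a \<in> points (total E)" using z by simp
  have "at_class G E (\<mu> (\<gamma>, ract E (a, g))) (theta_tilde X H E \<mu> \<gamma> (ract E (a, g)) (dR g a w))
      = at_class G E (\<mu> (\<gamma>, a)) (theta_tilde X H E \<mu> \<gamma> a w)" if "g \<in> carrier G" for g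
    unfolding \<mu>_ract[OF z that] theta_tilde_ract[OF z w that]
    by (rule at_class_ract[OF \<mu>_points[OF z] theta_tilde_in[OF z w] that])
  then show ?thesis
    unfolding At_action_def at_class_eq[OF a w] using carrier_not_empty by simp
qed

lemma ad_action_ad_class:
  assumes z: "(\<gamma>, a) \<in> S" and x: "x \<in> lie_algebra G"
  shows "ad_action G E \<mu> \<gamma> (ad_class G E a x) = ad_class G E (\<mu> (\<gamma>, a)) x"
proof -
  have a: "a \<in> points (total E)" using z by simp
  have "ad_class G E (\<mu> (\<gamma>, ract E (a, g))) (Adj G (inv\<^bsub>G\<^esub> g) x) = ad_class G E (\<mu> (\<gamma>, a)) x"
    if "g \<in> carrier G" for g
    unfolding \<mu>_ract[OF z that] by (rule ad_class_ract[OF \<mu>_points[OF z] x that])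
  then show ?thesis
    unfolding ad_action_def ad_class_eq[OF a x] using carrier_not_empty by simp
qed

section \<open>The splitting defined by a connection form\<close>

context
  fixes \<omega> :: "'p \<Rightarrow> ('p, 'q) tvec \<Rightarrow> ('g, 'k) tvec"
  assumes \<omega>: "connection_form G E \<omega>"
begin

lemma \<omega>_form: "lie_one_form G (total E) \<omega>"
  using \<omega> by (simp add: connection_form_def)

lemma \<omega>_linear:
  assumes "a \<in> points (total E)" "v \<in> tangent_space (total E) a" "w \<in> tangent_space (total E) a"
  shows "\<omega> a v \<in> lie_algebra G" "\<omega> a (v + w) = \<omega> a v + \<omega> a w" "\<omega> a (r *\<^sub>R v) = r *\<^sub>R \<omega> a v"
  using \<omega>_form assms unfolding lie_one_form_def by blast+

lemma \<omega>_ract: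
  assumes "a \<in> points (total E)" "g \<in> carrier G" "w \<in> tangent_space (total E) a"
  shows "\<omega> (ract E (a, g)) (dR g a w) = Adj G (inv\<^bsub>G\<^esub> g) (\<omega> a w)"
  using \<omega> assms by (simp add: connection_form_def)

text \<open>At the unit the Maurer-Cartan form is the differential of \<open>\<lambda>h. h\<close>,
  up to values outside the carrier. This is what makes the induced map a retraction of the adjoint
  bundle.\<close>

lemma \<omega>_vertical:
  assumes a: "a \<in> points (total E)" and y: "y \<in> lie_algebra G"
  shows "tangent_map (gmfd G) (total E) (\<lambda>h. ract E (a, h)) \<one>\<^bsub>G\<^esub> y \<in> tangent_space (total E) a"
    "\<omega> a (tangent_map (gmfd G) (total E) (\<lambda>h. ract E (a, h)) \<one>\<^bsub>G\<^esub> y) = y"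
proof -
  interpret group G by (rule group_G)
  have y': "y \<in> tangent_space (gmfd G) \<one>\<^bsub>G\<^esub>" using y by (simp add: lie_algebra_def)
  show "tangent_map (gmfd G) (total E) (\<lambda>h. ract E (a, h)) \<one>\<^bsub>G\<^esub> y \<in> tangent_space (total E) a"
    using tangent_map_in[OF dmanifolds(4,3) mdiff_orbit[OF a] one_points y'] by (simp add: ract_one[OF a])
  have "\<omega> (ract E (a, \<one>\<^bsub>G\<^esub>)) (tangent_map (gmfd G) (total E) (\<lambda>h. ract E (a, h)) \<one>\<^bsub>G\<^esub> y)
      = maurer_cartan G \<one>\<^bsub>G\<^esub> y"
    using \<omega> a y' one_closed unfolding connection_form_def by blast
  also have "maurer_cartan G \<one>\<^bsub>G\<^esub> y = tangent_map (gmfd G) (gmfd G) (\<lambda>h. h) \<one>\<^bsub>G\<^esub> y"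
    unfolding maurer_cartan_def
    by (rule tangent_map_cong[OF dmanifolds(4) _ one_points]) (simp add: points_G)
  also have "\<dots> = y" by (rule tangent_map_ident[OF dmanifolds(4) one_points y'])
  finally show "\<omega> a (tangent_map (gmfd G) (total E) (\<lambda>h. ract E (a, h)) \<one>\<^bsub>G\<^esub> y) = y"
    by (simp add: ract_one[OF a])
qed

lemma atiyah_map_at_class:
  assumes a: "a \<in> points (total E)" and w: "w \<in> tangent_space (total E) a"
  shows "atiyah_map G E \<omega> (at_class G E a w) = ad_class G E a (\<omega> a w)"
proof -
  have "ad_class G E (ract E (a, g)) (\<omega> (ract E (a, g)) (dR g a w)) = ad_class G E a (\<omega> a w)"
    if "g \<in> carrier G" for g
    unfolding \<omega>_ract[OF a that w] by (rule ad_class_ract[OF a \<omega>_linear(1)[OF a w w] that])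
  then show ?thesis
    unfolding atiyah_map_def at_class_eq[OF a w] using carrier_not_empty by simp
qed

lemma atiyah_splitting_atiyah_map: "atiyah_splitting G (objs X) E (atiyah_map G E \<omega>)"
  unfolding atiyah_splitting_def
proof (intro conjI ballI allI impI)
  fix x C assume "C \<in> At_fibre G E x"
  then show "atiyah_map G E \<omega> C \<in> ad_fibre G E x"
    unfolding At_fibre_iff using atiyah_map_at_class ad_class_in_fibre \<omega>_linear(1) by metis
next
  fix a v w y z and r :: real
  assume a: "a \<in> points (total E)" and v: "v \<in> tangent_space (total E) a" "w \<in> tangent_space (total E) a"
    and y: "y \<in> lie_algebra G" "z \<in> lie_algebra G"
    and eq: "atiyah_map G E \<omega> (at_class G E a v) = ad_class G E a y \<and>
      atiyah_map G E \<omega> (at_class G E a w) = ad_class G E a z"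
  \<comment> \<open>The splitting condition speaks of arbitrary \<open>y\<close> and
    \<open>z\<close> representing the images; freeness of the action, through
    \<open>ad_class_inj\<close>, identifies them as values of \<open>\<omega>\<close>.\<close>
  have yz: "y = \<omega> a v" "z = \<omega> a w"
    using ad_class_inj[OF a] eq y \<omega>_linear(1)[OF a] v atiyah_map_at_class[OF a] by metis+
  show "atiyah_map G E \<omega> (at_class G E a (v + w)) = ad_class G E a (y + z)"
    using atiyah_map_at_class[OF a tangent_space_add[OF dmanifolds(3) v]] \<omega>_linear(2)[OF a v] yz by simp
  show "atiyah_map G E \<omega> (at_class G E a (r *\<^sub>R v)) = ad_class G E a (r *\<^sub>R y)"
    using atiyah_map_at_class[OF a tangent_space_scale[OF dmanifolds(3) v(1)]] \<omega>_linear(3)[OF a v(1) v(1)] yz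
    by simp
next
  fix a y assume a: "a \<in> points (total E)" and y: "y \<in> lie_algebra G"
  show "atiyah_map G E \<omega> (at_class G E a (tangent_map (gmfd G) (total E) (\<lambda>h. ract E (a, h)) \<one>\<^bsub>G\<^esub> y))
      = ad_class G E a y"
    using atiyah_map_at_class[OF a \<omega>_vertical(1)[OF a y]] \<omega>_vertical(2)[OF a y] by simp
next
  fix U W
  assume "openin (mtop (objs X)) U \<and>
        smooth_vector_field (total E) {a \<in> points (total E). proj E a \<in> U} W \<and>
        (\<forall>a\<in>points (total E). \<forall>g\<in>carrier G. proj E a \<in> U \<longrightarrow>
           dR g a (W a) = W (ract E (a, g)))"
  then have W: "smooth_vector_field (total E) {a \<in> points (total E). proj E a \<in> U} W" by blast
  \<comment> \<open>The representing function is \<open>\<omega>\<close> evaluated on the field,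
    smooth because \<open>\<omega>\<close> is a smooth form.\<close>
  have "smooth_lie_function G (total E) {a \<in> points (total E). proj E a \<in> U} (\<lambda>a. \<omega> a (W a))"
    using \<omega>_form W unfolding lie_one_form_def by blast
  moreover have "atiyah_map G E \<omega> (at_class G E a (W a)) = ad_class G E a (\<omega> a (W a))"
    if "a \<in> points (total E)" "proj E a \<in> U" for a
    using W that by (intro atiyah_map_at_class) (auto simp: smooth_vector_field_def)
  ultimately show "\<exists>f. smooth_lie_function G (total E) {a \<in> points (total E). proj E a \<in> U} f \<and>
           (\<forall>a\<in>points (total E). proj E a \<in> U \<longrightarrow>
              atiyah_map G E \<omega> (at_class G E a (W a)) = ad_class G E a (f a))"
    by blast
qed

lemma atiyah_map_equivariant_iff:
  assumes z: "(\<gamma>, a) \<in> S" and w: "w \<in> tangent_space (total E) a"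
  shows "atiyah_map G E \<omega> (At_action G X H E \<mu> \<gamma> (at_class G E a w)) =
      ad_action G E \<mu> \<gamma> (atiyah_map G E \<omega> (at_class G E a w)) \<longleftrightarrow>
    \<omega> a w = \<omega> (\<mu> (\<gamma>, a)) (theta_tilde X H E \<mu> \<gamma> a w)"
proof -
  have a: "a \<in> points (total E)" using z by simp
  note \<mu> = \<mu>_points[OF z] and t = theta_tilde_in[OF z w]
  have "atiyah_map G E \<omega> (At_action G X H E \<mu> \<gamma> (at_class G E a w)) =
      ad_class G E (\<mu> (\<gamma>, a)) (\<omega> (\<mu> (\<gamma>, a)) (theta_tilde X H E \<mu> \<gamma> a w))"
    unfolding At_action_at_class[OF z w] by (rule atiyah_map_at_class[OF \<mu> t])
  moreover have "ad_action G E \<mu> \<gamma> (atiyah_map G E \<omega> (at_class G E a w)) = ad_class G E (\<mu> (\<gamma>, a)) (\<omega> a w)"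
    unfolding atiyah_map_at_class[OF a w] by (rule ad_action_ad_class[OF z \<omega>_linear(1)[OF a w w]])
  ultimately show ?thesis
    using ad_class_inj[OF \<mu> \<omega>_linear(1)[OF \<mu> t t] \<omega>_linear(1)[OF a w w]] by auto
qed

lemma defines_connection_iff:
  "defines_connection G X H E \<mu> (atiyah_map G E \<omega>) \<longleftrightarrow>
    groupoid_lie_one_form G (pullback_groupoid X E \<mu>) (pullback_connection X H E) \<omega>"
proof -
  \<comment> \<open>Each class over \<open>src X \<gamma>\<close> is represented by a vector at some
    \<open>a\<close> with \<open>(\<gamma>, a)\<close> in \<open>S\<close>, so quantifying over
    classes amounts to quantifying over representatives.\<close>
  have "(\<forall>\<gamma>\<in>points (arrs X). \<forall>C\<in>At_fibre G E (src X \<gamma>).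
        atiyah_map G E \<omega> (At_action G X H E \<mu> \<gamma> C) = ad_action G E \<mu> \<gamma> (atiyah_map G E \<omega> C)) \<longleftrightarrow>
    (\<forall>\<gamma> a. (\<gamma>, a) \<in> S \<longrightarrow> (\<forall>w\<in>tangent_space (total E) a.
        atiyah_map G E \<omega> (At_action G X H E \<mu> \<gamma> (at_class G E a w)) =
        ad_action G E \<mu> \<gamma> (atiyah_map G E \<omega> (at_class G E a w))))"
    unfolding Ball_def At_fibre_iff by fastforce
  also have "\<dots> \<longleftrightarrow> (\<forall>\<gamma> a. (\<gamma>, a) \<in> S \<longrightarrow> (\<forall>w\<in>tangent_space (total E) a.
       \<omega> a w = \<omega> (\<mu> (\<gamma>, a)) (theta_tilde X H E \<mu> \<gamma> a w)))"
    using atiyah_map_equivariant_iff by blast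
  finally show ?thesis
    unfolding defines_connection_def groupoid_lie_one_form_iff
    using atiyah_splitting_atiyah_map \<omega>_form by blast
qed

end

end

theorem lemma5p2:
  fixes X :: "('x, 'e::euclidean_space, 'y, 'f::euclidean_space) lie_gpd"
    and H :: "'y \<Rightarrow> ('y, 'f) tvec set"
    and G :: "('g, 'k::euclidean_space) lie_grp"
    and E :: "('p, 'q::euclidean_space, 'x, 'g) pbundle"
    and \<mu> :: "'y \<times> 'p \<Rightarrow> 'p"
    and \<omega> :: "'p \<Rightarrow> ('p, 'q) tvec \<Rightarrow> ('g, 'k) tvec"
  assumes "lie_groupoid X"
    and "groupoid_connection X H"
    and "integrable_distribution (arrs X) H"
    and "lie_group G"
    and "groupoid_principal_bundle G X E \<mu>"
    and "connection_form G E \<omega>"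
  shows "defines_connection G X H E \<mu> (atiyah_map G E \<omega>) \<longleftrightarrow>
         groupoid_lie_one_form G (pullback_groupoid X E \<mu>) (pullback_connection X H E) \<omega>"
proof -
  interpret groupoid_bundle X H G E \<mu> using assms by unfold_locales
  show ?thesis by (rule defines_connection_iff[OF assms(6)])
qed

end
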